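(* Let $X$ be a Banach space and let $\Gamma:[0,1]\to cwk(X)$ be a variationally McShane integrable multifunction. Then each strongly measurable selection of $\Gamma$ is variationally McShane integrable (equivalently, Bochner integrable). In particular, if $X$ is separable, then each scalarly measurable selection of $\Gamma$ is Bochner integrable. Consequently, $\Gamma$ is Aumann integrable, and the Aumann integral of $\Gamma$ over $[0,1]$ coincides with its variational McShane integral over $[0,1]$.
   Context: $[0,1]$ carries Lebesgue measure $\lambda$; $\mathcal{I}$ is the family of all closed subintervals of $[0,1]$ and $|I|$ is the length of $I\in\mathcal{I}$. $cwk(X)$ is the family of all non-empty convex weakly compact subsets of $X$, with Minkowski addition, multiplication by scalars, and the Hausdorff distance $d_H$. A function $f:[0,1]\to X$ is a selection of $\Gamma$ if $f(t)\in\Gamma(t)$ for every $t\in[0,1]$. A function $f:[0,1]\to X$ is strongly (Bochner) measurable if it is the $\lambda$-a.e. norm limit of simple measurable functions, and scalarly measurable if $x^*f$ is measurable for every $x^*\in X^*$. A gauge is a function $\delta:[0,1]\to(0,\infty)$. A partition of $[0,1]$ is a finite collection $\{(I_1,t_1),\dots,(I_p,t_p)\}$ of non-overlapping closed subintervals with union $[0,1]$ and points $t_i\in[0,1]$ (not necessarily in $I_i$); it is $\delta$-fine if $I_i\subset(t_i-\delta(t_i),t_i+\delta(t_i))$ for all $i$. $\Gamma:[0,1]\to cwk(X)$ is variationally McShane integrable if there is a finitely additive $\Phi_\Gamma:\mathcal{I}\to cwk(X)$ such that for every $\varepsilon>0$ there is a gauge $\delta$ with $\sum_{j=1}^p d_H(\Phi_\Gamma(I_j),\Gamma(t_j)|I_j|)<\varepsilon$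 for every $\delta$-fine partition of $[0,1]$; its variational McShane integral over $[0,1]$ is $\Phi_\Gamma([0,1])$. For functions $f:[0,1]\to X$ the same definition is used with $f$ identified with $t\mapsto\{f(t)\}$ and the primitive taking values in $X$. A multifunction $\Gamma$ is measurable (Effros measurable) if $\{t:\Gamma(t)\cap O\ne\emptyset\}$ is Lebesgue measurable for each open $O\subset X$. A measurable multifunction $\Gamma$ is Aumann integrable if it admits at least one Bochner integrable selection; its Aumann integral is the set $\{\int_0^1 f\,d\lambda: f \text{ a Bochner integrable selection of }\Gamma\}$. *)

theory Defs
  imports "HOL-Analysis.Analysis" "HOL-Library.Set_Algebras"
begin

section \<open>Weakly compact convex sets and the Hausdorff distance\<close>

definition weak_topology :: "'a::real_normed_vector topology" where
  "weak_topology = pullback_topology UNIV (\<lambda>x (g :: 'a \<Rightarrow>\<^sub>L real). blinfun_apply g x) euclidean"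

definition cwk :: "'a::real_normed_vector set set" where
  "cwk = {K. K \<noteq> {} \<and> convex K \<and> compactin weak_topology K}"

text \<open>Only meaningful for non-empty bounded sets, as the suprema are taken in the reals.\<close>

definition hausdorff_dist :: "'a::metric_space set \<Rightarrow> 'a set \<Rightarrow> real" where
  "hausdorff_dist A B = max (SUP a\<in>A. infdist a B) (SUP b\<in>B. infdist b A)"


section \<open>The variational McShane integral\<close>

text \<open>
  Intervals are taken non-degenerate. Admitting one-point intervals would change nothing:
  additivity forces a \<open>cwk\<close>-valued interval function to be \<open>{0}\<close> there.
\<close>

definition closed_subintervals :: "real set set" where
  "closed_subintervals = {{a..b} | a b. 0 \<le> a \<and> a < b \<and> b \<le> 1}"

text \<open>Addition is the Minkowski sum of \<open>HOL-Library.Set_Algebras\<close>.\<close>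

definition finitely_additive :: "(real set \<Rightarrow> 'a::real_normed_vector set) \<Rightarrow> bool" where
  "finitely_additive \<Phi> \<longleftrightarrow>
     (\<forall>I\<in>closed_subintervals. \<forall>J\<in>closed_subintervals.
        interior I \<inter> interior J = {} \<and> I \<union> J \<in> closed_subintervals
        \<longrightarrow> \<Phi> (I \<union> J) = \<Phi> I + \<Phi> J)"

definition gauge_fun :: "(real \<Rightarrow> real) \<Rightarrow> bool" where
  "gauge_fun \<delta> \<longleftrightarrow> (\<forall>t\<in>{0..1}. 0 < \<delta> t)"

text \<open>
  Unlike in \<^const>\<open>tagged_division_of\<close>, the tags need not lie in the corresponding intervals.
\<close>

definition mcshane_partition :: "(real set \<times> real) set \<Rightarrow> bool" where
  "mcshane_partition P \<longleftrightarrow>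
     finite P \<and>
     (\<forall>(I, t)\<in>P. I \<in> closed_subintervals \<and> t \<in> {0..1}) \<and>
     (\<forall>(I, t)\<in>P. \<forall>(J, s)\<in>P. (I, t) \<noteq> (J, s) \<longrightarrow> interior I \<inter> interior J = {}) \<and>
     (\<Union>(I, t)\<in>P. I) = {0..1}"

definition delta_fine :: "(real \<Rightarrow> real) \<Rightarrow> (real set \<times> real) set \<Rightarrow> bool" where
  "delta_fine \<delta> P \<longleftrightarrow> (\<forall>(I, t)\<in>P. I \<subseteq> {t - \<delta> t <..< t + \<delta> t})"

definition vM_primitive ::
    "(real \<Rightarrow> 'a::real_normed_vector set) \<Rightarrow> (real set \<Rightarrow> 'a set) \<Rightarrow> bool" where
  "vM_primitive \<Gamma> \<Phi> \<longleftrightarrow>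
     (\<forall>I\<in>closed_subintervals. \<Phi> I \<in> cwk) \<and>
     finitely_additive \<Phi> \<and>
     (\<forall>\<epsilon>>0. \<exists>\<delta>. gauge_fun \<delta> \<and>
        (\<forall>P. mcshane_partition P \<and> delta_fine \<delta> P \<longrightarrow>
           (\<Sum>(I, t)\<in>P. hausdorff_dist (\<Phi> I) ((*\<^sub>R) (measure lebesgue I) ` \<Gamma> t)) < \<epsilon>))"

definition vM_integrable :: "(real \<Rightarrow> 'a::real_normed_vector set) \<Rightarrow> bool" where
  "vM_integrable \<Gamma> \<longleftrightarrow> (\<exists>\<Phi>. vM_primitive \<Gamma> \<Phi>)"

definition vM_integral :: "(real \<Rightarrow> 'a::real_normed_vector set) \<Rightarrow> 'a set" where
  "vM_integral \<Gamma> = (THE S. \<exists>\<Phi>. vM_primitive \<Gamma> \<Phi> \<and> S = \<Phi> {0..1})"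

definition vM_integrable_fun :: "(real \<Rightarrow> 'a::real_normed_vector) \<Rightarrow> bool" where
  "vM_integrable_fun f \<longleftrightarrow>
     (\<exists>\<phi> :: real set \<Rightarrow> 'a. vM_primitive (\<lambda>t. {f t}) (\<lambda>I. {\<phi> I}))"


section \<open>Measurability and the Bochner integral\<close>

definition strongly_measurable :: "(real \<Rightarrow> 'a::real_normed_vector) \<Rightarrow> bool" where
  "strongly_measurable f \<longleftrightarrow>
     (\<exists>s. (\<forall>n::nat. simple_function (lebesgue_on {0..1}) (s n)) \<and>
          (AE t in lebesgue_on {0..1}. (\<lambda>n. s n t) \<longlonglongrightarrow> f t))"

definition scalarly_measurable :: "(real \<Rightarrow> 'a::real_normed_vector) \<Rightarrow> bool" where
  "scalarly_measurable f \<longleftrightarrow>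
     (\<forall>g :: 'a \<Rightarrow>\<^sub>L real. (\<lambda>t. blinfun_apply g (f t)) \<in> borel_measurable (lebesgue_on {0..1}))"

text \<open>
  The library's \<^const>\<open>has_bochner_integral\<close> is restricted to second-countable spaces, whereas
  the spaces here may be non-separable. This is the same definition, with Borel measurability
  replaced by strong measurability.
\<close>

definition has_Bochner_integral_01 :: "(real \<Rightarrow> 'a::real_normed_vector) \<Rightarrow> 'a \<Rightarrow> bool" where
  "has_Bochner_integral_01 f x \<longleftrightarrow>
     strongly_measurable f \<and>
     (\<exists>s. (\<forall>n::nat. Bochner_Integration.simple_bochner_integrable (lebesgue_on {0..1}) (s n)) \<and>
          (\<lambda>n. \<integral>\<^sup>+t. ennreal (norm (f t - s n t)) \<partial>lebesgue_on {0..1}) \<longlonglongrightarrow> 0 \<and>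
          (\<lambda>n. Bochner_Integration.simple_bochner_integral (lebesgue_on {0..1}) (s n)) \<longlonglongrightarrow> x)"

definition Bochner_integrable :: "(real \<Rightarrow> 'a::real_normed_vector) \<Rightarrow> bool" where
  "Bochner_integrable f \<longleftrightarrow> (\<exists>x. has_Bochner_integral_01 f x)"


section \<open>Selections and the Aumann integral\<close>

definition selection_of :: "(real \<Rightarrow> 'a) \<Rightarrow> (real \<Rightarrow> 'a set) \<Rightarrow> bool" where
  "selection_of f \<Gamma> \<longleftrightarrow> (\<forall>t\<in>{0..1}. f t \<in> \<Gamma> t)"

definition Effros_measurable :: "(real \<Rightarrow> 'a::topological_space set) \<Rightarrow> bool" where
  "Effros_measurable \<Gamma> \<longleftrightarrow> (\<forall>U. open U \<longrightarrow> {t\<in>{0..1}. \<Gamma> t \<inter> U \<noteq> {}} \<in> sets lebesgue)"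

definition Aumann_integrable :: "(real \<Rightarrow> 'a::real_normed_vector set) \<Rightarrow> bool" where
  "Aumann_integrable \<Gamma> \<longleftrightarrow>
     Effros_measurable \<Gamma> \<and> (\<exists>f. selection_of f \<Gamma> \<and> Bochner_integrable f)"

definition Aumann_integral :: "(real \<Rightarrow> 'a::real_normed_vector set) \<Rightarrow> 'a set" where
  "Aumann_integral \<Gamma> = {x. \<exists>f. selection_of f \<Gamma> \<and> has_Bochner_integral_01 f x}"

end

theory Submission
  imports Defs
begin

text \<open>
  Let \<open>\<Gamma>\<close> be variationally McShane integrable with primitive \<open>\<Phi>\<close>.

  The tags of a McShane partition are free, so the tags of a sufficiently fine partition may be
  replaced by those of one fixed fine partition. Comparing both Riemann sums with \<open>\<Phi>\<close> shows
  that, for a step function \<open>\<tau>\<close>, every fine McShane sum of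
  \<open>t \<mapsto> hausdorff_dist (\<Gamma> t) (\<Gamma> (\<tau> t))\<close> is small. Small McShane sums of a nonnegative function force
  a small upper Lebesgue integral (\<open>mcshane_sums_bound_upper_integral\<close>). Hence \<open>\<Gamma>\<close> is an
  \<open>L\<^sup>1\<close>-limit, in the Hausdorff distance, of multifunctions with finitely many values
  (\<open>step_approximation\<close>). This yields an integrable bound for the norms of the values, hence the Bochner integrability of every strongly measurable
  selection; Effros measurability; and, by choosing finitely valued selections of the successive
  approximations close to one another, Bochner integrable selections whose integrals are dense in
  \<open>\<Phi> {0..1}\<close> (\<open>Bochner_selections_dense\<close>).

  A Bochner integrable \<open>f\<close> is variationally McShane integrable, with its indefinite integral as
  primitive (\<open>Bochner_imp_vM_primitive\<close>): \<open>f\<close> oscillates little on each of countably many measurable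
  sets, and the gauge keeps an interval tagged in one of these sets inside an open set that is only
  slightly larger. Comparing Riemann sums then places the integral of every Bochner integrable
  selection in \<open>\<Phi> {0..1}\<close> (\<open>vM_primitive_mono\<close>).

  The converse, that every \<open>x \<in> \<Phi> {0..1}\<close> is the integral of a selection, is where weak compactness
  enters (\<open>primitive_subset_Aumann_integral\<close>). The selections whose integrals are within \<open>1 / n\<close> of
  \<open>x\<close> form a decreasing sequence of nonempty convex sets. Only countably many functionals matter,
  those that norm a separable closed subspace \<open>Y\<close> containing all values in question. They define a
  bounded quadratic energy, and the parallelogram law makes near-minimizers of the energy in the
  successive sets converge, almost everywhere, along each of these functionals. Weak compactness of
  \<open>\<Gamma> t\<close> provides a point of \<open>\<Gamma> t \<inter> Y\<close> realizing the limits; Pettis' measurability theorem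
  (\<open>pettis_measurability\<close>), which also settles the scalarly measurable selections in a separable
  space, makes these points a strongly measurable selection, and dominated convergence identifies
  its integral with \<open>x\<close>.

  In a non-separable space, Bochner integrals are handled through the functionals of the dual space
  (\<open>has_Bochner_integral_01_iff\<close>). This rests on the Hahn--Banach theorem, which also gives
  the norm-closedness and boundedness of weakly compact sets.
\<close>

section \<open>The Hahn--Banach theorem\<close>

definition sublinear :: "('a::real_vector \<Rightarrow> real) \<Rightarrow> bool" where
  "sublinear p \<longleftrightarrow> (\<forall>x y. p (x + y) \<le> p x + p y) \<and> (\<forall>c\<ge>0. \<forall>x. p (c *\<^sub>R x) \<le> c * p x)"

lemma sublinear_add: "sublinear p \<Longrightarrow> p (x + y) \<le> p x + p y"
  and sublinear_scale_le: "sublinear p \<Longrightarrow> 0 \<le> c \<Longrightarrow> p (c *\<^sub>R x) \<le> c * p x"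
  by (auto simp: sublinear_def)

lemma sublinear_zero: "sublinear p \<Longrightarrow> p 0 = 0"
  using sublinear_add[of p 0 0] sublinear_scale_le[of p 0 0] by auto

lemma sublinear_scale:
  assumes "sublinear p" "0 \<le> c"
  shows "p (c *\<^sub>R x) = c * p x"
proof (cases "c = 0")
  case False
  then have "p ((1/c) *\<^sub>R (c *\<^sub>R x)) \<le> (1/c) * p (c *\<^sub>R x)"
    using assms by (intro sublinear_scale_le) auto
  then have "c * p x \<le> p (c *\<^sub>R x)" using False assms by (simp add: field_simps)
  then show ?thesis using sublinear_scale_le[OF assms, of x] by simp
qed (use sublinear_zero assms in auto)

lemma sublinear_neg: "sublinear p \<Longrightarrow> - p (- x) \<le> p x"
  using sublinear_add[of p x "-x"] sublinear_zero[of p] by simp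

text \<open>
  The largest sublinear functional below \<open>q\<close> that takes the value \<open>- q z\<close> at \<open>- z\<close>. A minimal
  sublinear \<open>q\<close> coincides with it for every \<open>z\<close>.
\<close>

definition flatten_along :: "'a::real_vector \<Rightarrow> ('a \<Rightarrow> real) \<Rightarrow> 'a \<Rightarrow> real" where
  "flatten_along z q y = (INF t\<in>{0..}. q (y + t *\<^sub>R z) - t * q z)"

lemma flatten_along_le:
  assumes "sublinear q" "0 \<le> t"
  shows "flatten_along z q y \<le> q (y + t *\<^sub>R z) - t * q z"
  unfolding flatten_along_def
proof (rule cINF_lower)
  show "bdd_below ((\<lambda>t. q (y + t *\<^sub>R z) - t * q z) ` {0..})"
  proof (rule bdd_belowI2[where m="- q (- y)"])
    fix t :: real assume t: "t \<in> {0..}"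
    have "q (t *\<^sub>R z) \<le> q (y + t *\<^sub>R z) + q (- y)"
      using sublinear_add[OF assms(1), of "y + t *\<^sub>R z" "-y"] by simp
    then show "- q (- y) \<le> q (y + t *\<^sub>R z) - t * q z"
      using sublinear_scale[OF assms(1), of t z] t by simp
  qed
qed (use assms in auto)

lemma flatten_along_ge:
  assumes "\<And>t. 0 \<le> t \<Longrightarrow> c \<le> q (y + t *\<^sub>R z) - t * q z"
  shows "c \<le> flatten_along z q y"
  unfolding flatten_along_def by (rule cINF_greatest) (use assms in auto)

lemma sublinear_flatten_along:
  assumes q: "sublinear q"
  shows "sublinear (flatten_along z q)"
  unfolding sublinear_def
proof (intro conjI allI impI)
  fix x y
  have *: "flatten_along z q (x + y) - (q (y + t *\<^sub>R z) - t * q z) \<le> q (x + s *\<^sub>R z) - s * q z"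
    if "0 \<le> s" "0 \<le> t" for s t
  proof -
    have "flatten_along z q (x + y) \<le> q ((x + y) + (s + t) *\<^sub>R z) - (s + t) * q z"
      using that by (intro flatten_along_le q) auto
    moreover have "q ((x + y) + (s + t) *\<^sub>R z) \<le> q (x + s *\<^sub>R z) + q (y + t *\<^sub>R z)"
      using sublinear_add[OF q, of "x + s *\<^sub>R z" "y + t *\<^sub>R z"]
      by (simp add: algebra_simps)
    ultimately show ?thesis by (simp add: algebra_simps)
  qed
  have "flatten_along z q (x + y) - (q (y + t *\<^sub>R z) - t * q z) \<le> flatten_along z q x"
    if "0 \<le> t" for t
    by (rule flatten_along_ge) (rule *[OF _ that])
  then have "flatten_along z q (x + y) - flatten_along z q x \<le> flatten_along z q y"
    by (intro flatten_along_ge) (simp add: algebra_simps)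
  then show "flatten_along z q (x + y) \<le> flatten_along z q x + flatten_along z q y" by simp
next
  fix c :: real and x assume c: "0 \<le> c"
  show "flatten_along z q (c *\<^sub>R x) \<le> c * flatten_along z q x"
  proof (cases "c = 0")
    case True
    then show ?thesis
      using flatten_along_le[OF q order_refl, of z 0] sublinear_zero[OF q] by simp
  next
    case False
    have "flatten_along z q (c *\<^sub>R x) / c \<le> flatten_along z q x"
    proof (rule flatten_along_ge)
      fix t :: real assume t: "0 \<le> t"
      have "flatten_along z q (c *\<^sub>R x) \<le> q (c *\<^sub>R x + (c * t) *\<^sub>R z) - (c * t) * q z"
        using c t by (intro flatten_along_le q) auto
      also have "q (c *\<^sub>R x + (c * t) *\<^sub>R z) = c * q (x + t *\<^sub>R z)"
        using sublinear_scale[OF q c, of "x + t *\<^sub>R z"] by (simp add: algebra_simps)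
      finally show "flatten_along z q (c *\<^sub>R x) / c \<le> q (x + t *\<^sub>R z) - t * q z"
        using c False by (simp add: field_simps)
    qed
    then show ?thesis using c False by (simp add: field_simps)
  qed
qed

text \<open>
  Zorn's lemma applies because the pointwise infimum of a chain is again sublinear; the bound
  \<open>- p (- x)\<close> from below keeps the infimum finite.
\<close>

lemma exists_minimal_sublinear:
  assumes p: "sublinear p"
  obtains m where "sublinear m" "m \<le> p" "\<And>q. sublinear q \<Longrightarrow> q \<le> m \<Longrightarrow> q = m"
proof -
  define A where "A = {q. sublinear q \<and> q \<le> p}"
  define R where "R = (\<lambda>a b :: 'a \<Rightarrow> real. b \<le> a)"
  have "\<exists>m\<in>A. \<forall>a\<in>A. R m a \<longrightarrow> a = m"
  proof (rule predicate_Zorn)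
    show "partial_order_on A (relation_of R A)"
      by (auto simp: partial_order_on_def preorder_on_def refl_on_def trans_def antisym_def
          relation_of_def R_def)
  next
    fix C assume "C \<in> Chains (relation_of R A)"
    then have CA: "C \<subseteq> A" and chain: "\<And>a b. a \<in> C \<Longrightarrow> b \<in> C \<Longrightarrow> a \<le> b \<or> b \<le> a"
      by (auto simp: Chains_def relation_of_def R_def)
    show "\<exists>u\<in>A. \<forall>a\<in>C. R a u"
    proof (cases "C = {}")
      case True then show ?thesis using p by (auto simp: A_def)
    next
      case False
      define u where "u x = (INF q\<in>C. q x)" for x
      have lower: "u x \<le> q x" if "q \<in> C" for q x
        unfolding u_def
      proof (rule cINF_lower)
        show "bdd_below ((\<lambda>q. q x) ` C)"
        proof (rule bdd_belowI2[where m="- p (- x)"])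
          fix q assume "q \<in> C"
          then have "sublinear q" "q (- x) \<le> p (- x)" using CA by (auto simp: A_def le_fun_def)
          then show "- p (- x) \<le> q x" using sublinear_neg[of q x] by simp
        qed
      qed fact
      have greatest: "c \<le> u x" if "\<And>q. q \<in> C \<Longrightarrow> c \<le> q x" for c x
        unfolding u_def by (rule cINF_greatest) (use False that in auto)
      have "sublinear u"
        unfolding sublinear_def
      proof (intro conjI allI impI)
        fix x y
        have *: "u (x + y) - q1 x \<le> q2 y" if "q1 \<in> C" "q2 \<in> C" for q1 q2
        proof -
          have "\<exists>q\<in>C. q \<le> q1 \<and> q \<le> q2"
            using chain[OF that] that by (blast intro: order_refl)
          then obtain q where q: "q \<in> C" "q \<le> q1" "q \<le> q2" by blast
          have "u (x + y) \<le> q (x + y)" by (rule lower) fact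
          also have "\<dots> \<le> q x + q y" using q CA by (auto simp: A_def intro: sublinear_add)
          also have "\<dots> \<le> q1 x + q2 y" using q by (intro add_mono) (auto simp: le_fun_def)
          finally show ?thesis by simp
        qed
        have "u (x + y) - u y \<le> q1 x" if q1: "q1 \<in> C" for q1
        proof -
          have "u (x + y) - q1 x \<le> u y" by (rule greatest) (rule *[OF q1])
          then show ?thesis by simp
        qed
        then have "u (x + y) - u y \<le> u x" by (rule greatest)
        then show "u (x + y) \<le> u x + u y" by simp
      next
        fix c :: real and x assume c: "0 \<le> c"
        show "u (c *\<^sub>R x) \<le> c * u x"
        proof (cases "c = 0")
          case True
          obtain q where "q \<in> C" using False by auto
          then show ?thesis using lower[of q 0] CA sublinear_zero[of q] True by (auto simp: A_def)
        next
          case False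
          have "u (c *\<^sub>R x) / c \<le> u x"
          proof (rule greatest)
            fix q assume q: "q \<in> C"
            then have "u (c *\<^sub>R x) \<le> c * q x"
              using lower[OF q, of "c *\<^sub>R x"] CA sublinear_scale_le[of q c x] c by (auto simp: A_def)
            then show "u (c *\<^sub>R x) / c \<le> q x" using c False by (simp add: field_simps)
          qed
          then show ?thesis using c False by (simp add: field_simps)
        qed
      qed
      moreover have "u \<le> p"
      proof (rule le_funI)
        fix x
        obtain q where q: "q \<in> C" using False by auto
        then have "q x \<le> p x" using CA by (auto simp: A_def le_fun_def)
        then show "u x \<le> p x" using lower[OF q, of x] by simp
      qed
      ultimately show ?thesis using lower by (auto simp: A_def R_def le_fun_def)
    qed
  qed
  then obtain m where "sublinear m" "m \<le> p" "\<forall>a. sublinear a \<and> a \<le> p \<longrightarrow> a \<le> m \<longrightarrow> a = m"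
    by (auto simp: A_def R_def)
  then show ?thesis by (intro that) (auto intro: order_trans)
qed

text \<open>
  Minimality gives \<open>m = flatten_along z m\<close>, whose value at \<open>- z\<close> is at most \<open>- m z\<close>. So \<open>m\<close> is odd,
  and an odd sublinear functional is linear.
\<close>

lemma minimal_sublinear_linear:
  assumes m: "sublinear m" and min: "\<And>q. sublinear q \<Longrightarrow> q \<le> m \<Longrightarrow> q = m"
  shows "linear m"
proof -
  have le: "flatten_along z m \<le> m" for z
    using flatten_along_le[OF m order_refl, of z] by (auto simp: le_fun_def)
  have odd: "m (- z) = - m z" for z
  proof -
    have "m (- z) = flatten_along z m (- z)"
      using min[OF sublinear_flatten_along[OF m] le] by simp
    also have "\<dots> \<le> - m z"
      using flatten_along_le[OF m, of 1 z "- z"] sublinear_zero[OF m] by simp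
    finally show ?thesis using sublinear_neg[OF m, of "z"] by simp
  qed
  show ?thesis
  proof (rule linearI)
    fix x y
    have "m (- x + - y) \<le> m (- x) + m (- y)" by (rule sublinear_add[OF m])
    moreover have "m (- x + - y) = - m (x + y)" using odd[of "x + y"] by simp
    ultimately show "m (x + y) = m x + m y" using sublinear_add[OF m, of x y] odd by simp
  next
    fix c x
    show "m (c *\<^sub>R x) = c *\<^sub>R m x"
    proof (cases "0 \<le> c")
      case False
      then have "m ((- c) *\<^sub>R (- x)) = (- c) * m (- x)" by (intro sublinear_scale m) auto
      then show ?thesis using odd by simp
    qed (simp add: sublinear_scale[OF m])
  qed
qed

text \<open>
  Starting Zorn's lemma below \<open>flatten_along z p\<close> instead of \<open>p\<close> pins the value at \<open>z\<close>.
\<close>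

theorem hahn_banach_dominated:
  assumes p: "sublinear p"
  obtains f where "linear f" "\<And>x. f x \<le> p x" "f z = p z"
proof -
  obtain m where m: "sublinear m" "m \<le> flatten_along z p"
    and min: "\<And>q. sublinear q \<Longrightarrow> q \<le> m \<Longrightarrow> q = m"
    using exists_minimal_sublinear[OF sublinear_flatten_along[OF p]] by metis
  have lin: "linear m" by (rule minimal_sublinear_linear) fact+
  have le: "m x \<le> p x" for x
    using m(2) flatten_along_le[OF p order_refl, of z x] by (auto simp: le_fun_def intro: order_trans)
  have "m (- z) \<le> flatten_along z p (- z)" using m(2) by (simp add: le_fun_def)
  also have "\<dots> \<le> - p z"
    using flatten_along_le[OF p, of 1 z "- z"] sublinear_zero[OF p] by simp
  finally have "p z \<le> m z" using linear_neg[OF lin, of z] by simp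
  with le[of z] show ?thesis by (intro that[OF lin le]) auto
qed

corollary hahn_banach_blinfun:
  fixes p :: "'a::real_normed_vector \<Rightarrow> real"
  assumes p: "sublinear p" and p_le: "\<And>x. p x \<le> norm x"
  obtains g :: "'a \<Rightarrow>\<^sub>L real" where "norm g \<le> 1" "\<And>x. g x \<le> p x" "g z = p z"
proof -
  obtain f where f: "linear f" "\<And>x. f x \<le> p x" "f z = p z"
    using hahn_banach_dominated[OF p] by metis
  have abs: "\<bar>f x\<bar> \<le> norm x" for x
    using f(2)[of x] p_le[of x] f(2)[of "- x"] p_le[of "- x"] linear_neg[OF f(1), of x] by auto
  have bl: "bounded_linear f"
    using f(1) abs by (intro bounded_linear.intro) (auto simp: bounded_linear_axioms_def intro!: exI[of _ 1])
  have "norm (Blinfun f) \<le> 1"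
    by (rule norm_blinfun_bound) (use abs bl in \<open>auto simp: bounded_linear_Blinfun_apply\<close>)
  then show ?thesis
    by (intro that[of "Blinfun f"]) (use f bl in \<open>auto simp: bounded_linear_Blinfun_apply\<close>)
qed

corollary exists_norming_functional:
  fixes z :: "'a::real_normed_vector"
  obtains g :: "'a \<Rightarrow>\<^sub>L real" where "norm g \<le> 1" "g z = norm z"
proof -
  have "sublinear (norm :: 'a \<Rightarrow> real)"
    by (auto simp: sublinear_def norm_triangle_ineq)
  then show ?thesis using hahn_banach_blinfun[of norm z] that by fastforce
qed

lemma infdist_lessD:
  assumes "infdist x A < r" "A \<noteq> {}"
  obtains a where "a \<in> A" "dist x a < r"
  using assms cInf_lessD[of "dist x ` A" r] by (auto simp: infdist_notempty)

text \<open>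
  The distance to a subspace is sublinear and vanishes on the subspace only.
\<close>

corollary separate_from_closed_subspace:
  fixes z :: "'a::real_normed_vector"
  assumes Y: "subspace Y" "closed Y" and z: "z \<notin> Y"
  obtains g :: "'a \<Rightarrow>\<^sub>L real" where "\<And>y. y \<in> Y \<Longrightarrow> g y = 0" "g z \<noteq> 0"
proof -
  have ne: "Y \<noteq> {}" using subspace_0[OF Y(1)] by auto
  have "sublinear (\<lambda>x. infdist x Y)"
    unfolding sublinear_def
  proof (intro conjI allI impI)
    fix x y
    show "infdist (x + y) Y \<le> infdist x Y + infdist y Y"
    proof (rule field_le_epsilon)
      fix e :: real assume e: "0 < e"
      have "infdist x Y < infdist x Y + e/2" "infdist y Y < infdist y Y + e/2" using e by auto
      then obtain a b where ab: "a \<in> Y" "dist x a < infdist x Y + e/2"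
          "b \<in> Y" "dist y b < infdist y Y + e/2"
        using ne by (elim infdist_lessD)
      have "infdist (x + y) Y \<le> dist (x + y) (a + b)"
        using ab Y by (intro infdist_le subspace_add) auto
      also have "\<dots> \<le> dist x a + dist y b" by (rule dist_triangle_add)
      finally show "infdist (x + y) Y \<le> infdist x Y + infdist y Y + e" using ab by simp
    qed
  next
    fix c :: real and x assume c: "0 \<le> c"
    show "infdist (c *\<^sub>R x) Y \<le> c * infdist x Y"
    proof (cases "c = 0")
      case True then show ?thesis using subspace_0[OF Y(1)] by simp
    next
      case False
      have "infdist (c *\<^sub>R x) Y / c \<le> infdist x Y"
        unfolding infdist_notempty[OF ne, of x]
      proof (rule cINF_greatest[OF ne])
        fix a assume "a \<in> Y"
        then have "infdist (c *\<^sub>R x) Y \<le> dist (c *\<^sub>R x) (c *\<^sub>R a)"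
          using Y by (intro infdist_le subspace_scale)
        also have "\<dots> = c * dist x a"
          using c norm_scaleR[of c "x - a"] by (simp add: dist_norm scaleR_diff_right)
        finally show "infdist (c *\<^sub>R x) Y / c \<le> dist x a" using c False by (simp add: field_simps)
      qed
      then show ?thesis using c False by (simp add: field_simps)
    qed
  qed
  moreover have "infdist x Y \<le> norm x" for x
    using infdist_le[OF subspace_0[OF Y(1)], of x] by simp
  ultimately obtain g :: "'a \<Rightarrow>\<^sub>L real" where g: "\<And>x. g x \<le> infdist x Y" "g z = infdist z Y"
    using hahn_banach_blinfun[of "\<lambda>x. infdist x Y" z] by metis
  have "g y = 0" if "y \<in> Y" for y
    using g(1)[of y] g(1)[of "- y"] that subspace_neg[OF Y(1) that] by (simp add: blinfun.minus_right)
  moreover have "g z \<noteq> 0"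
    using z Y ne g(2) by (simp add: in_closed_iff_infdist_zero)
  ultimately show ?thesis using that by blast
qed

section \<open>Convex weakly compact sets\<close>

lemma continuous_map_weak_blinfun:
  "continuous_map weak_topology euclidean (blinfun_apply (g :: 'a::real_normed_vector \<Rightarrow>\<^sub>L real))"
proof -
  have "continuous_map (euclidean :: (('a \<Rightarrow>\<^sub>L real) \<Rightarrow> real) topology) euclidean (\<lambda>h. h g)"
    by (simp add: continuous_on_product_coordinates)
  from continuous_map_pullback[OF this, of UNIV "\<lambda>x (g :: 'a \<Rightarrow>\<^sub>L real). blinfun_apply g x"]
  show ?thesis by (simp add: weak_topology_def o_def)
qed

lemma topspace_weak_topology [simp]: "topspace weak_topology = UNIV"
  by (simp add: weak_topology_def topspace_pullback_topology)

lemma openin_weak_imp_open: "openin weak_topology (U :: 'a::real_normed_vector set) \<Longrightarrow> open U"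
proof -
  assume "openin weak_topology U"
  then obtain V where V: "open V" "U = (\<lambda>x (g :: 'a \<Rightarrow>\<^sub>L real). blinfun_apply g x) -` V"
    by (auto simp: weak_topology_def openin_pullback_topology)
  have "continuous_on UNIV (\<lambda>x (g :: 'a \<Rightarrow>\<^sub>L real). blinfun_apply g x)"
    by (intro continuous_on_coordinatewise_then_product continuous_intros)
  then show "open U" using V by (auto simp: continuous_on_open_vimage)
qed

lemma closedin_weak_imp_closed: "closedin weak_topology (U :: 'a::real_normed_vector set) \<Longrightarrow> closed U"
  by (auto simp: closedin_def closed_def Compl_eq_Diff_UNIV intro: openin_weak_imp_open)

lemma closedin_weak_preimage:
  fixes g :: "'a::real_normed_vector \<Rightarrow>\<^sub>L real"
  shows "closed C \<Longrightarrow> closedin weak_topology {x. g x \<in> C}"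
  using closedin_continuous_map_preimage[OF continuous_map_weak_blinfun, of C g] by simp

lemma Hausdorff_weak_topology: "Hausdorff_space (weak_topology :: 'a::real_normed_vector topology)"
  unfolding Hausdorff_space_def
proof (intro allI impI)
  fix x y :: 'a assume "x \<in> topspace weak_topology \<and> y \<in> topspace weak_topology \<and> x \<noteq> y"
  then obtain g :: "'a \<Rightarrow>\<^sub>L real" where "g (x - y) \<noteq> 0"
    using exists_norming_functional[of "x - y"] by (metis norm_eq_zero right_minus_eq)
  then have "g x \<noteq> g y" by (simp add: blinfun.diff_right)
  then obtain U V where UV: "open U" "open V" "g x \<in> U" "g y \<in> V" "U \<inter> V = {}"
    using hausdorff[of "g x" "g y"] by blast
  have "openin weak_topology {z. g z \<in> U}" "openin weak_topology {z. g z \<in> V}"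
    using openin_continuous_map_preimage[OF continuous_map_weak_blinfun, of U g]
      openin_continuous_map_preimage[OF continuous_map_weak_blinfun, of V g] UV by auto
  then show "\<exists>U V. openin weak_topology U \<and> openin weak_topology V \<and> x \<in> U \<and> y \<in> V \<and> disjnt U V"
    using UV by (intro exI[of _ "{z. g z \<in> U}"] exI[of _ "{z. g z \<in> V}"]) (auto simp: disjnt_def)
qed

text \<open>
  A closed subspace is the intersection of the kernels of the functionals that vanish on it.
\<close>

lemma weakly_closed_subspace:
  fixes Y :: "'a::real_normed_vector set"
  assumes "subspace Y" "closed Y"
  shows "closedin weak_topology Y"
proof -
  have "Y = \<Inter> {{x. g x \<in> {0}} | g :: 'a \<Rightarrow>\<^sub>L real. \<forall>y\<in>Y. g y = 0}"
  proof (intro equalityI subsetI)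
    fix z assume z: "z \<in> \<Inter> {{x. g x \<in> {0}} | g :: 'a \<Rightarrow>\<^sub>L real. \<forall>y\<in>Y. g y = 0}"
    show "z \<in> Y"
    proof (rule ccontr)
      assume "z \<notin> Y"
      then obtain g :: "'a \<Rightarrow>\<^sub>L real" where "\<And>y. y \<in> Y \<Longrightarrow> g y = 0" "g z \<noteq> 0"
        using separate_from_closed_subspace[OF assms] by metis
      then show False using z by auto
    qed
  qed auto
  also have "closedin weak_topology \<dots>"
  proof (rule closedin_Inter)
    show "{{x. g x \<in> {0}} | g :: 'a \<Rightarrow>\<^sub>L real. \<forall>y\<in>Y. g y = 0} \<noteq> {}"
      by (auto intro!: exI[of _ "0 :: 'a \<Rightarrow>\<^sub>L real"])
  qed (use closedin_weak_preimage[of "{0}"] in auto)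
  finally show ?thesis .
qed

lemma cwk_nonempty: "K \<in> cwk \<Longrightarrow> K \<noteq> {}"
  and cwk_convex: "K \<in> cwk \<Longrightarrow> convex K"
  and cwk_compactin: "K \<in> cwk \<Longrightarrow> compactin weak_topology K"
  by (auto simp: cwk_def)

lemma cwk_closed: "K \<in> cwk \<Longrightarrow> closed K"
  by (intro closedin_weak_imp_closed compactin_imp_closedin Hausdorff_weak_topology cwk_compactin)

lemma cwk_singleton [simp]: "{x} \<in> cwk"
  by (simp add: cwk_def)

text \<open>
  Uniform boundedness: every functional is bounded on \<open>K\<close>, so the dual space is a countable union of
  the closed sets of functionals bounded by \<open>n\<close> on \<open>K\<close>. By Baire one of them contains a ball, and
  norming functionals turn the resulting bound on a ball of the dual into a bound on \<open>K\<close>.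
\<close>

lemma cwk_bounded:
  fixes K :: "'a::real_normed_vector set"
  assumes K: "K \<in> cwk"
  shows "bounded K"
proof -
  define F where "F n = {g :: 'a \<Rightarrow>\<^sub>L real. \<forall>x\<in>K. \<bar>g x\<bar> \<le> real n}" for n
  have closed_F: "closed (F n)" for n
  proof -
    have "F n = (\<Inter>x\<in>K. {g :: 'a \<Rightarrow>\<^sub>L real. \<bar>g x\<bar> \<le> real n})" by (auto simp: F_def)
    moreover have "closed {g :: 'a \<Rightarrow>\<^sub>L real. \<bar>g x\<bar> \<le> real n}" for x
      by (intro closed_Collect_le continuous_intros)
    ultimately show ?thesis by auto
  qed
  have "\<exists>n. g \<in> F n" for g
  proof -
    have "compact (g ` K)"
      using image_compactin[OF cwk_compactin[OF K] continuous_map_weak_blinfun, of g]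
      by (simp add: compactin_euclidean_iff)
    then have "bounded (g ` K)" by (rule compact_imp_bounded)
    then obtain B where "\<forall>x\<in>K. \<bar>g x\<bar> \<le> B"
      unfolding bounded_iff by auto
    then show ?thesis
      using real_arch_simple[of B] order_trans unfolding F_def by blast
  qed
  then have "(\<Union>n. F n) = UNIV" by auto
  moreover have "interior (\<Union>n. F n) = {}" if "\<forall>n. interior (F n) = {}"
    using Baire_category_alt[of "euclidean :: ('a \<Rightarrow>\<^sub>L real) topology" "range F"] that closed_F
    by (auto simp: completely_metrizable_space_euclidean)
  ultimately obtain n g0 where "g0 \<in> interior (F n)" by auto
  then obtain r where r: "0 < r" "cball g0 r \<subseteq> F n"
    by (auto simp: mem_interior_cball)
  have "norm x \<le> 2 * real n / r" if x: "x \<in> K" for x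
  proof -
    obtain g :: "'a \<Rightarrow>\<^sub>L real" where g: "norm g \<le> 1" "g x = norm x"
      using exists_norming_functional[of x] by metis
    have "g0 + r *\<^sub>R g \<in> cball g0 r" "g0 \<in> cball g0 r"
      using g r by (auto simp: dist_norm mult_left_le)
    then have "g0 + r *\<^sub>R g \<in> F n" "g0 \<in> F n" using r(2) by (auto simp del: mem_cball)
    then have "\<bar>(g0 + r *\<^sub>R g) x\<bar> \<le> n" "\<bar>g0 x\<bar> \<le> n" using x by (auto simp: F_def)
    then have "r * norm x \<le> 2 * n" using g by (simp add: blinfun.add_left blinfun.scaleR_left)
    then show ?thesis using r by (simp add: field_simps)
  qed
  then show ?thesis by (auto simp: bounded_iff)
qed

section \<open>The Hausdorff distance\<close>

lemma infdist_le_hausdorff_dist: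
  assumes "bounded A" "B \<noteq> {}" "a \<in> A"
  shows "infdist a B \<le> hausdorff_dist A B"
proof -
  obtain b where b: "b \<in> B" using assms by auto
  obtain e where e: "\<forall>y\<in>A. dist b y \<le> e" using \<open>bounded A\<close> bounded_any_center by blast
  have "bdd_above ((\<lambda>a. infdist a B) ` A)"
    by (rule bdd_aboveI2[where M = e]) (use e b in \<open>auto intro!: infdist_le2 simp: dist_commute\<close>)
  then have "infdist a B \<le> (SUP a\<in>A. infdist a B)" using assms by (intro cSUP_upper) auto
  then show ?thesis by (simp add: hausdorff_dist_def)
qed

lemma hausdorff_dist_leI:
  assumes "A \<noteq> {}" "B \<noteq> {}"
    and "\<And>a. a \<in> A \<Longrightarrow> infdist a B \<le> r" and "\<And>b. b \<in> B \<Longrightarrow> infdist b A \<le> r"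
  shows "hausdorff_dist A B \<le> r"
  unfolding hausdorff_dist_def using assms by (auto intro!: cSUP_least)

lemma hausdorff_dist_commute: "hausdorff_dist A B = hausdorff_dist B A"
  by (simp add: hausdorff_dist_def max.commute)

lemma hausdorff_dist_lessD:
  assumes "bounded A" "B \<noteq> {}" "hausdorff_dist A B < r" "a \<in> A"
  obtains b where "b \<in> B" "dist a b < r"
  using infdist_le_hausdorff_dist[OF assms(1,2,4)] assms(2,3) infdist_lessD[of a B r] by force

lemma hausdorff_dist_nonneg:
  assumes "bounded A" "A \<noteq> {}" "B \<noteq> {}"
  shows "0 \<le> hausdorff_dist A B"
proof -
  obtain a where "a \<in> A" using assms by auto
  then show ?thesis using infdist_le_hausdorff_dist[OF assms(1,3), of a] infdist_nonneg[of a B] by simp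
qed

lemma hausdorff_dist_singletons [simp]: "hausdorff_dist {a} {b} = dist a b"
  by (simp add: hausdorff_dist_def infdist_def dist_commute)

lemma hausdorff_dist_triangle:
  assumes "bounded A" "A \<noteq> {}" "bounded B" "B \<noteq> {}" "bounded C" "C \<noteq> {}"
  shows "hausdorff_dist A C \<le> hausdorff_dist A B + hausdorff_dist B C"
proof -
  have *: "infdist a C \<le> hausdorff_dist A B + hausdorff_dist B C"
    if AB: "bounded A" "a \<in> A" "bounded B" "B \<noteq> {}" "C \<noteq> {}" for a and A B C :: "'a set"
  proof (rule field_le_epsilon)
    fix e :: real assume "0 < e"
    then obtain b where b: "b \<in> B" "dist a b < hausdorff_dist A B + e"
      using hausdorff_dist_lessD[of A B "hausdorff_dist A B + e" a] AB by auto
    have "infdist a C \<le> infdist b C + dist a b" by (rule infdist_triangle)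
    also have "\<dots> \<le> hausdorff_dist B C + (hausdorff_dist A B + e)"
      using b that by (intro add_mono infdist_le_hausdorff_dist) auto
    finally show "infdist a C \<le> hausdorff_dist A B + hausdorff_dist B C + e" by simp
  qed
  show ?thesis
  proof (rule hausdorff_dist_leI)
    fix c assume "c \<in> C"
    then show "infdist c A \<le> hausdorff_dist A B + hausdorff_dist B C"
      using *[of C c B A] assms by (simp add: hausdorff_dist_commute)
  qed (use assms * in auto)
qed

lemma hausdorff_dist_scaleR:
  fixes A B :: "'a::real_normed_vector set"
  assumes "bounded A" "A \<noteq> {}" "bounded B" "B \<noteq> {}" "0 < c"
  shows "c * hausdorff_dist A B \<le> hausdorff_dist ((*\<^sub>R) c ` A) ((*\<^sub>R) c ` B)"
proof -
  have *: "infdist a B \<le> hausdorff_dist ((*\<^sub>R) c ` A) ((*\<^sub>R) c ` B) / c"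
    if AB: "bounded A" "a \<in> A" "B \<noteq> {}" for a and A B :: "'a set"
  proof (rule field_le_epsilon)
    fix e :: real assume e: "0 < e"
    let ?h = "hausdorff_dist ((*\<^sub>R) c ` A) ((*\<^sub>R) c ` B)"
    obtain b where b: "b \<in> B" "dist (c *\<^sub>R a) (c *\<^sub>R b) < ?h + c * e"
      using hausdorff_dist_lessD[of "(*\<^sub>R) c ` A" "(*\<^sub>R) c ` B" "?h + c * e" "c *\<^sub>R a"]
        AB e \<open>0 < c\<close> bounded_scaling[of A c] by auto
    have "dist (c *\<^sub>R a) (c *\<^sub>R b) = c * dist a b"
      using \<open>0 < c\<close> norm_scaleR[of c "a - b"] by (simp add: dist_norm scaleR_diff_right)
    with b have "dist a b \<le> ?h / c + e" using \<open>0 < c\<close> by (simp add: field_simps)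
    then show "infdist a B \<le> ?h / c + e" using b by (meson infdist_le order_trans)
  qed
  have "hausdorff_dist A B \<le> hausdorff_dist ((*\<^sub>R) c ` A) ((*\<^sub>R) c ` B) / c"
    by (rule hausdorff_dist_leI)
       (use assms * *[of B _ A] in \<open>auto simp: hausdorff_dist_commute[of "(*\<^sub>R) c ` B"]\<close>)
  then show ?thesis using assms by (simp add: field_simps)
qed

lemma sum_selection_near:
  fixes A B :: "'i \<Rightarrow> 'a::real_normed_vector set"
  assumes I: "finite I" and bdd: "\<And>i. i \<in> I \<Longrightarrow> bounded (A i)" and ne: "\<And>i. i \<in> I \<Longrightarrow> B i \<noteq> {}"
    and a: "\<And>i. i \<in> I \<Longrightarrow> a i \<in> A i" and r: "(\<Sum>i\<in>I. hausdorff_dist (A i) (B i)) < r"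
  obtains b where "\<And>i. i \<in> I \<Longrightarrow> b i \<in> B i" "dist (\<Sum>i\<in>I. a i) (\<Sum>i\<in>I. b i) < r"
proof -
  define e where "e = (r - (\<Sum>i\<in>I. hausdorff_dist (A i) (B i))) / (card I + 1)"
  have e: "0 < e" using r by (simp add: e_def)
  have "\<forall>i\<in>I. \<exists>b. b \<in> B i \<and> dist (a i) b < hausdorff_dist (A i) (B i) + e"
  proof
    fix i assume i: "i \<in> I"
    show "\<exists>b. b \<in> B i \<and> dist (a i) b < hausdorff_dist (A i) (B i) + e"
      using hausdorff_dist_lessD[OF bdd[OF i] ne[OF i] _ a[OF i], of "hausdorff_dist (A i) (B i) + e"] e
      by auto
  qed
  then obtain b where b: "\<And>i. i \<in> I \<Longrightarrow> b i \<in> B i"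
      "\<And>i. i \<in> I \<Longrightarrow> dist (a i) (b i) < hausdorff_dist (A i) (B i) + e"
    by metis
  have "dist (\<Sum>i\<in>I. a i) (\<Sum>i\<in>I. b i) = norm (\<Sum>i\<in>I. a i - b i)"
    by (simp add: dist_norm sum_subtractf)
  also have "\<dots> \<le> (\<Sum>i\<in>I. dist (a i) (b i))" unfolding dist_norm by (rule norm_sum)
  also have "\<dots> \<le> (\<Sum>i\<in>I. hausdorff_dist (A i) (B i) + e)"
    using b by (intro sum_mono) (simp add: less_imp_le)
  also have "\<dots> = (\<Sum>i\<in>I. hausdorff_dist (A i) (B i)) + card I * e" by (simp add: sum.distrib)
  also have "\<dots> < (\<Sum>i\<in>I. hausdorff_dist (A i) (B i)) + (card I + 1) * e" using e by (simp add: algebra_simps)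
  also have "\<dots> = r" by (simp add: e_def)
  finally show ?thesis using b by (intro that[of b])
qed

section \<open>Strong measurability\<close>

abbreviation unit_measure :: "real measure" ("\<mu>") where
  "\<mu> \<equiv> lebesgue_on {0..1}"

interpretation unit: finite_measure \<mu>
  by (rule finite_measure_lebesgue_on) auto

interpretation unit: complete_measure \<mu>
proof
  fix A B assume AB: "A \<subseteq> B" "B \<in> null_sets \<mu>"
  then have "B \<in> null_sets lebesgue" "B \<subseteq> {0..1}"
    by (auto simp: null_sets_restrict_space)
  then have "A \<in> null_sets lebesgue" "A \<subseteq> {0..1}"
    using AB null_sets_completion_subset by (blast, blast)
  then show "A \<in> sets \<mu>"
    by (auto simp: sets_restrict_space_iff)
qed

lemma measure_unit: "measure \<mu> {0..1} = 1"
  by (simp add: measure_restrict_space)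

lemma borel_measurable_cong_AE:
  fixes f g :: "real \<Rightarrow> real"
  assumes f: "f \<in> borel_measurable \<mu>" and ae: "AE t in \<mu>. f t = g t"
  shows "g \<in> borel_measurable \<mu>"
proof (rule measurableI)
  fix A :: "real set" assume A: "A \<in> sets borel"
  have f_A: "f -` A \<inter> space \<mu> \<in> sets \<mu>" using f A by (rule measurable_sets)
  have iff: "AE t in \<mu>. t \<in> f -` A \<inter> space \<mu> \<longleftrightarrow> t \<in> g -` A \<inter> space \<mu>"
    using ae by eventually_elim auto
  show "g -` A \<inter> space \<mu> \<in> sets \<mu>"
    by (rule unit.in_sets_AE[OF iff f_A Int_lower2])
qed auto

lemma borel_measurable_AE_LIMSEQ:
  fixes f :: "real \<Rightarrow> real"
  assumes s: "\<And>n. s n \<in> borel_measurable \<mu>" and ae: "AE t in \<mu>. (\<lambda>n. s n t) \<longlonglongrightarrow> f t"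
  shows "f \<in> borel_measurable \<mu>"
proof (rule borel_measurable_cong_AE)
  show "(\<lambda>t. lim (\<lambda>n. s n t)) \<in> borel_measurable \<mu>" by (intro borel_measurable_lim_metric s)
  show "AE t in \<mu>. lim (\<lambda>n. s n t) = f t" using ae by eventually_elim (rule limI)
qed

lemma strongly_measurable_simple: "simple_function \<mu> f \<Longrightarrow> strongly_measurable f"
  unfolding strongly_measurable_def by (intro exI[of _ "\<lambda>_. f"]) auto

lemma strongly_measurable_continuous2:
  fixes h :: "'a::real_normed_vector \<Rightarrow> 'b::real_normed_vector \<Rightarrow> 'c::real_normed_vector"
  assumes f: "strongly_measurable f" and g: "strongly_measurable g"
    and h: "continuous_on UNIV (\<lambda>(x, y). h x y)"
  shows "strongly_measurable (\<lambda>t. h (f t) (g t))"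
proof -
  obtain s where s: "\<And>n. simple_function \<mu> (s n)" "AE t in \<mu>. (\<lambda>n. s n t) \<longlonglongrightarrow> f t"
    using f unfolding strongly_measurable_def by blast
  obtain r where r: "\<And>n. simple_function \<mu> (r n)" "AE t in \<mu>. (\<lambda>n. r n t) \<longlonglongrightarrow> g t"
    using g unfolding strongly_measurable_def by blast
  have "AE t in \<mu>. (\<lambda>n. h (s n t) (r n t)) \<longlonglongrightarrow> h (f t) (g t)"
    using s(2) r(2)
  proof eventually_elim
    case (elim t)
    then have "(\<lambda>n. (s n t, r n t)) \<longlonglongrightarrow> (f t, g t)" by (intro tendsto_Pair)
    from continuous_on_tendsto_compose[OF h this] show ?case by simp
  qed
  then show ?thesis unfolding strongly_measurable_def
    using simple_function_compose2[OF s(1) r(1), of h] by (intro exI[of _ "\<lambda>n t. h (s n t) (r n t)"]) auto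
qed

lemma strongly_measurable_const: "strongly_measurable (\<lambda>_. c)"
  by (intro strongly_measurable_simple simple_function_const)

lemma borel_measurable_continuous_strongly_measurable:
  fixes \<phi> :: "'a::real_normed_vector \<Rightarrow> real"
  assumes f: "strongly_measurable f" and \<phi>: "continuous_on UNIV \<phi>"
  shows "(\<lambda>t. \<phi> (f t)) \<in> borel_measurable \<mu>"
proof -
  obtain s where s: "\<And>n. simple_function \<mu> (s n)" "AE t in \<mu>. (\<lambda>n. s n t) \<longlonglongrightarrow> f t"
    using f unfolding strongly_measurable_def by blast
  show ?thesis
  proof (rule borel_measurable_AE_LIMSEQ)
    show "(\<lambda>t. \<phi> (s n t)) \<in> borel_measurable \<mu>" for n
      by (rule borel_measurable_simple_function, rule simple_function_compose1, rule s(1))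
    show "AE t in \<mu>. (\<lambda>n. \<phi> (s n t)) \<longlonglongrightarrow> \<phi> (f t)"
      using s(2)
    proof eventually_elim
      case (elim t)
      from continuous_on_tendsto_compose[OF \<phi> elim] show ?case by simp
    qed
  qed
qed

lemma strongly_measurable_imp_separably_valued:
  fixes f :: "real \<Rightarrow> 'a::real_normed_vector"
  assumes "strongly_measurable f"
  obtains d :: "nat \<Rightarrow> 'a" where "AE t in \<mu>. f t \<in> closure (range d)"
proof -
  obtain s where s: "\<And>n. simple_function \<mu> (s n)" "AE t in \<mu>. (\<lambda>n. s n t) \<longlonglongrightarrow> f t"
    using assms unfolding strongly_measurable_def by blast
  define D where "D = (\<Union>n::nat. s n ` {0..1})"
  have D: "countable D" "D \<noteq> {}"
    using s(1) by (auto simp: D_def simple_function_def countable_finite intro!: countable_UN)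
  have "AE t in \<mu>. f t \<in> closure D"
    using s(2) AE_space
  proof eventually_elim
    case (elim t)
    then have "\<forall>n. s n t \<in> D" unfolding D_def by fastforce
    with elim(1) show ?case by (meson closure_sequential)
  qed
  then show ?thesis using that[of "from_nat_into D"] D by (simp add: range_from_nat_into)
qed

text \<open>
  At stage \<open>n\<close> the function is replaced by the nearest of the points \<open>d 0, \<dots>, d n\<close>, with the smallest
  index in case of a tie. The distances to these points are all that has to be measurable.
\<close>

lemma strongly_measurableI_separable:
  fixes f :: "real \<Rightarrow> 'a::real_normed_vector" and d :: "nat \<Rightarrow> 'a"
  assumes meas [measurable]: "\<And>k. (\<lambda>t. norm (f t - d k)) \<in> borel_measurable \<mu>"
    and sep: "AE t in \<mu>. f t \<in> closure (range d)"
  shows "strongly_measurable f"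
proof -
  define nearest where
    "nearest n t k \<longleftrightarrow> k \<le> n \<and> (\<forall>j\<in>{..n}. norm (f t - d k) \<le> norm (f t - d j))" for n t and k :: nat
  define idx where "idx n t = (LEAST k. nearest n t k)" for n t
  have ex: "\<exists>k. nearest n t k" for n t
  proof -
    have "\<exists>k\<in>{..n}. \<forall>j\<in>{..n}. norm (f t - d k) \<le> norm (f t - d j)"
      using arg_min_if_finite[of "{..n}" "\<lambda>k. norm (f t - d k)"]
      by (intro bexI[of _ "arg_min_on (\<lambda>k. norm (f t - d k)) {..n}"]) (auto simp: not_less)
    then show ?thesis by (auto simp: nearest_def)
  qed
  have idx: "nearest n t (idx n t)" for n t
    unfolding idx_def using ex[of n t] by (rule LeastI_ex)
  have simple: "simple_function \<mu> (idx n)" for n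
    unfolding simple_function_def
  proof (intro conjI ballI)
    show "finite (idx n ` space \<mu>)"
      by (rule finite_subset[of _ "{..n}"]) (use idx in \<open>auto simp: nearest_def\<close>)
    have "idx n \<in> measurable \<mu> (count_space UNIV)"
      unfolding idx_def nearest_def by measurable
    then show "idx n -` {k} \<inter> space \<mu> \<in> sets \<mu>" for k by (rule measurable_sets) auto
  qed
  have "AE t in \<mu>. (\<lambda>n. d (idx n t)) \<longlonglongrightarrow> f t"
    using sep
  proof eventually_elim
    case (elim t)
    show ?case
    proof (rule LIMSEQ_I)
      fix e :: real assume "0 < e"
      with elim obtain k where k: "dist (d k) (f t) < e"
        by (auto simp: closure_approachable)
      show "\<exists>no. \<forall>n\<ge>no. norm (d (idx n t) - f t) < e"
      proof (intro exI[of _ k] allI impI)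
        fix n assume "k \<le> n"
        then have "norm (f t - d (idx n t)) \<le> norm (f t - d k)"
          using idx[of n t] by (auto simp: nearest_def)
        then show "norm (d (idx n t) - f t) < e" using k by (simp add: dist_norm norm_minus_commute)
      qed
    qed
  qed
  moreover have "simple_function \<mu> (\<lambda>t. d (idx n t))" for n
    by (rule simple_function_compose1[OF simple])
  ultimately show ?thesis unfolding strongly_measurable_def
    by (intro exI[of _ "\<lambda>n t. d (idx n t)"]) auto
qed

lemma norm_eq_SUP_norming:
  fixes d :: "nat \<Rightarrow> 'a::real_normed_vector" and y :: "nat \<Rightarrow> 'a \<Rightarrow>\<^sub>L real"
  assumes y: "\<And>k. norm (y k) \<le> 1" "\<And>k. y k (d k) = norm (d k)" and z: "z \<in> closure (range d)"
  shows "norm z = (SUP k. y k z)"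
proof (rule antisym)
  have le: "y k x \<le> norm x" for k x
  proof -
    have "norm (y k x) \<le> norm (y k) * norm x" by (rule norm_blinfun)
    also have "\<dots> \<le> 1 * norm x" by (intro mult_right_mono y) auto
    finally show ?thesis by simp
  qed
  then show "(SUP k. y k z) \<le> norm z" by (intro cSUP_least) auto
  have bdd: "bdd_above (range (\<lambda>k. y k z))" by (rule bdd_aboveI2) (rule le)
  show "norm z \<le> (SUP k. y k z)"
  proof (rule field_le_epsilon)
    fix e :: real assume "0 < e"
    with z obtain k where k: "dist (d k) z < e/2" by (auto simp: closure_approachable dest: half_gt_zero)
    have "norm z \<le> norm (d k) + e/2" using k norm_triangle_ineq2[of z "d k"] by (simp add: dist_norm norm_minus_commute)
    also have "norm (d k) = y k z + y k (d k - z)" by (simp add: y blinfun.diff_right)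
    also have "y k (d k - z) \<le> e/2" using le[of k "d k - z"] k by (simp add: dist_norm)
    finally have "norm z \<le> y k z + e" by simp
    moreover have "y k z \<le> (SUP k. y k z)" by (intro cSUP_upper bdd) auto
    ultimately show "norm z \<le> (SUP k. y k z) + e" by simp
  qed
qed

text \<open>
  On the closed subspace spanned by \<open>d\<close> the norm is the supremum of countably many functionals, so
  scalar measurability along them makes the distances to the points of \<open>d\<close> measurable.
\<close>

lemma pettis_measurability:
  fixes f :: "real \<Rightarrow> 'a::real_normed_vector" and d :: "nat \<Rightarrow> 'a" and y :: "nat \<Rightarrow> 'a \<Rightarrow>\<^sub>L real"
  assumes sub: "subspace (closure (range d))"
    and y: "\<And>k. norm (y k) \<le> 1" "\<And>k. y k (d k) = norm (d k)"
    and meas [measurable]: "\<And>k. (\<lambda>t. y k (f t)) \<in> borel_measurable \<mu>"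
    and sep: "AE t in \<mu>. f t \<in> closure (range d)"
  shows "strongly_measurable f"
proof (rule strongly_measurableI_separable[OF _ sep])
  fix j
  have "bdd_above (range (\<lambda>k. y k (f t) - y k (d j)))" for t
  proof (rule bdd_aboveI2)
    fix k
    have "norm (y k (f t - d j)) \<le> norm (y k) * norm (f t - d j)" by (rule norm_blinfun)
    also have "\<dots> \<le> 1 * norm (f t - d j)" by (intro mult_right_mono y) auto
    finally show "y k (f t) - y k (d j) \<le> norm (f t - d j)" by (simp add: blinfun.diff_right)
  qed
  then have "(\<lambda>t. SUP k. y k (f t) - y k (d j)) \<in> borel_measurable \<mu>"
    by (intro borel_measurable_cSUP) auto
  moreover have "AE t in \<mu>. (SUP k. y k (f t) - y k (d j)) = norm (f t - d j)"
    using sep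
  proof eventually_elim
    case (elim t)
    have "d j \<in> closure (range d)" by (intro subsetD[OF closure_subset]) auto
    then have "f t - d j \<in> closure (range d)" using elim by (intro subspace_diff[OF sub])
    from norm_eq_SUP_norming[OF y this] show ?case by (simp add: blinfun.diff_right)
  qed
  ultimately show "(\<lambda>t. norm (f t - d j)) \<in> borel_measurable \<mu>"
    by (rule borel_measurable_cong_AE)
qed

section \<open>The Bochner integral\<close>

lemma strongly_measurable_norm:
  fixes f :: "real \<Rightarrow> 'a::real_normed_vector"
  assumes "strongly_measurable f" shows "(\<lambda>t. norm (f t)) \<in> borel_measurable \<mu>"
  by (rule borel_measurable_continuous_strongly_measurable[OF assms]) (intro continuous_intros)

lemma strongly_measurable_blinfun:
  fixes f :: "real \<Rightarrow> 'a::real_normed_vector" and g :: "'a \<Rightarrow>\<^sub>L real"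
  assumes "strongly_measurable f" shows "(\<lambda>t. g (f t)) \<in> borel_measurable \<mu>"
  by (rule borel_measurable_continuous_strongly_measurable[OF assms]) (intro continuous_intros)

lemma strongly_measurable_lincomb:
  fixes f g :: "real \<Rightarrow> 'a::real_normed_vector"
  assumes "strongly_measurable f" "strongly_measurable g"
  shows "strongly_measurable (\<lambda>t. a *\<^sub>R f t + b *\<^sub>R g t)"
  by (rule strongly_measurable_continuous2[OF assms]) (auto intro!: continuous_intros simp: split_beta)

lemma strongly_measurable_diff:
  fixes f g :: "real \<Rightarrow> 'a::real_normed_vector"
  assumes "strongly_measurable f" "strongly_measurable g"
  shows "strongly_measurable (\<lambda>t. f t - g t)"
  using strongly_measurable_lincomb[OF assms, of 1 "-1"] by simp

lemma strongly_measurable_cong_AE: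
  fixes f g :: "real \<Rightarrow> 'a::real_normed_vector"
  assumes "strongly_measurable f" "AE t in \<mu>. f t = g t"
  shows "strongly_measurable g"
proof -
  obtain s where s: "\<And>n. simple_function \<mu> (s n)" "AE t in \<mu>. (\<lambda>n. s n t) \<longlonglongrightarrow> f t"
    using assms(1) unfolding strongly_measurable_def by blast
  have "AE t in \<mu>. (\<lambda>n. s n t) \<longlonglongrightarrow> g t"
    using s(2) assms(2) by eventually_elim simp
  then show ?thesis using s(1) unfolding strongly_measurable_def by blast
qed

lemma simple_function_bounded:
  fixes s :: "real \<Rightarrow> 'a::real_normed_vector"
  assumes "simple_function \<mu> s"
  obtains B where "\<And>t. t \<in> {0..1} \<Longrightarrow> norm (s t) \<le> B"
proof -
  have "finite (s ` {0..1})" using assms by (simp add: simple_function_def)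
  then have "bounded (s ` {0..1})" by (rule finite_imp_bounded)
  then obtain B where "\<forall>x\<in>s ` {0..1}. norm x \<le> B" by (auto simp: bounded_iff)
  then show ?thesis by (intro that[of B]) auto
qed

lemma simple_function_simple_bochner_integrable:
  fixes s :: "real \<Rightarrow> 'a::real_normed_vector"
  assumes "simple_function \<mu> s"
  shows "Bochner_Integration.simple_bochner_integrable \<mu> s"
  using assms by (intro simple_bochner_integrable.intros) auto

lemma integrable_bounded_by:
  fixes f h :: "real \<Rightarrow> real"
  assumes "integrable \<mu> h" "f \<in> borel_measurable \<mu>" "AE t in \<mu>. \<bar>f t\<bar> \<le> h t"
  shows "integrable \<mu> f"
  using assms(1,2)
proof (rule Bochner_Integration.integrable_bound)
  show "AE t in \<mu>. norm (f t) \<le> norm (h t)" using assms(3) by eventually_elim auto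
qed

lemma integrable_blinfun_norm:
  fixes f :: "real \<Rightarrow> 'a::real_normed_vector" and g :: "'a \<Rightarrow>\<^sub>L real"
  assumes f: "strongly_measurable f" and int: "integrable \<mu> (\<lambda>t. norm (f t))"
  shows "integrable \<mu> (\<lambda>t. g (f t))"
proof (rule integrable_bounded_by)
  show "integrable \<mu> (\<lambda>t. norm g * norm (f t))" using int by simp
  show "AE t in \<mu>. \<bar>g (f t)\<bar> \<le> norm g * norm (f t)"
    using norm_blinfun[of g] by auto
qed (rule strongly_measurable_blinfun[OF f])

lemma integrable_norm_simple:
  fixes s :: "real \<Rightarrow> 'a::real_normed_vector"
  assumes s: "simple_function \<mu> s"
  shows "integrable \<mu> (\<lambda>t. norm (s t))"
proof -
  obtain B where "\<And>t. t \<in> {0..1} \<Longrightarrow> norm (s t) \<le> B" using simple_function_bounded[OF s] by metis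
  then have "AE t in \<mu>. \<bar>norm (s t)\<bar> \<le> B" by (intro AE_I2) simp
  then show ?thesis
    by (rule integrable_bounded_by[rotated 2])
      (auto intro: strongly_measurable_norm[OF strongly_measurable_simple[OF s]])
qed

lemma integrable_norm_diff:
  fixes f g :: "real \<Rightarrow> 'a::real_normed_vector"
  assumes "strongly_measurable f" "integrable \<mu> (\<lambda>t. norm (f t))"
    and "strongly_measurable g" "integrable \<mu> (\<lambda>t. norm (g t))"
  shows "integrable \<mu> (\<lambda>t. norm (f t - g t))"
  by (rule integrable_bounded_by[of "\<lambda>t. norm (f t) + norm (g t)"])
     (use assms in \<open>auto intro!: strongly_measurable_norm strongly_measurable_diff norm_triangle_ineq4\<close>)

lemma abs_integral_blinfun_le:
  fixes f :: "real \<Rightarrow> 'a::real_normed_vector" and g :: "'a \<Rightarrow>\<^sub>L real"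
  assumes f: "strongly_measurable f" "integrable \<mu> (\<lambda>t. norm (f t))"
  shows "\<bar>\<integral>t. g (f t) \<partial>\<mu>\<bar> \<le> norm g * (\<integral>t. norm (f t) \<partial>\<mu>)"
proof -
  have "\<bar>\<integral>t. g (f t) \<partial>\<mu>\<bar> \<le> (\<integral>t. \<bar>g (f t)\<bar> \<partial>\<mu>)" by (rule integral_abs_bound)
  also have "\<dots> \<le> (\<integral>t. norm g * norm (f t) \<partial>\<mu>)"
    using norm_blinfun[of g] f by (intro integral_mono integrable_abs integrable_blinfun_norm) auto
  finally show ?thesis by simp
qed

lemma integral_blinfun_diff:
  fixes f h :: "real \<Rightarrow> 'a::real_normed_vector" and g :: "'a \<Rightarrow>\<^sub>L real"
  assumes "strongly_measurable f" "integrable \<mu> (\<lambda>t. norm (f t))"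
    and "strongly_measurable h" "integrable \<mu> (\<lambda>t. norm (h t))"
  shows "(\<integral>t. g (f t - h t) \<partial>\<mu>) = (\<integral>t. g (f t) \<partial>\<mu>) - (\<integral>t. g (h t) \<partial>\<mu>)"
  unfolding blinfun.diff_right
  by (intro Bochner_Integration.integral_diff integrable_blinfun_norm assms)

lemma simple_bochner_integral_blinfun:
  fixes s :: "real \<Rightarrow> 'a::real_normed_vector" and g :: "'a \<Rightarrow>\<^sub>L real"
  assumes s: "simple_function \<mu> s"
  shows "g (Bochner_Integration.simple_bochner_integral \<mu> s) = (\<integral>t. g (s t) \<partial>\<mu>)"
proof -
  have "linear (blinfun_apply g)" by (simp add: bounded_linear.linear blinfun.bounded_linear_right)
  then have "g (Bochner_Integration.simple_bochner_integral \<mu> s)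
      = Bochner_Integration.simple_bochner_integral \<mu> (\<lambda>t. g (s t))"
    using simple_bochner_integral_linear[OF _ simple_function_simple_bochner_integrable[OF s]] by metis
  also have "\<dots> = (\<integral>t. g (s t) \<partial>\<mu>)"
    by (intro simple_bochner_integrable_eq_integral simple_function_simple_bochner_integrable
        simple_function_compose1[OF s])
  finally show ?thesis .
qed

text \<open>
  Functionals commute with the integral of simple functions and are continuous for the
  \<open>L\<^sup>1\<close>-distance.
\<close>

lemma has_Bochner_integral_01_D:
  fixes f :: "real \<Rightarrow> 'a::real_normed_vector" and g :: "'a \<Rightarrow>\<^sub>L real"
  assumes "has_Bochner_integral_01 f x"
  shows "strongly_measurable f" "integrable \<mu> (\<lambda>t. norm (f t))" "(\<integral>t. g (f t) \<partial>\<mu>) = g x"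
proof -
  obtain s where f: "strongly_measurable f"
    and s: "\<And>n. Bochner_Integration.simple_bochner_integrable \<mu> (s n)"
    and L1: "(\<lambda>n. \<integral>\<^sup>+t. ennreal (norm (f t - s n t)) \<partial>\<mu>) \<longlonglongrightarrow> 0"
    and lim: "(\<lambda>n. Bochner_Integration.simple_bochner_integral \<mu> (s n)) \<longlonglongrightarrow> x"
    using assms unfolding has_Bochner_integral_01_def by blast
  show "strongly_measurable f" by (rule f)
  have simple: "simple_function \<mu> (s n)" for n using s[of n] by (auto elim: simple_bochner_integrable.cases)
  note sm = strongly_measurable_simple[OF simple]
  have meas: "(\<lambda>t. norm (f t - s n t)) \<in> borel_measurable \<mu>" for n
    by (intro strongly_measurable_norm strongly_measurable_diff f sm)
  have "eventually (\<lambda>n. (\<integral>\<^sup>+t. ennreal (norm (f t - s n t)) \<partial>\<mu>) < 1) sequentially"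
    using L1 by (rule order_tendstoD) simp
  then obtain N where N: "(\<integral>\<^sup>+t. ennreal (norm (f t - s n t)) \<partial>\<mu>) < 1" if "n \<ge> N" for n
    by (auto simp: eventually_sequentially)
  have int_diff: "integrable \<mu> (\<lambda>t. norm (f t - s n t))" if "n \<ge> N" for n
    using meas N[OF that] by (intro integrableI_bounded) (auto intro: order_less_trans)
  show int: "integrable \<mu> (\<lambda>t. norm (f t))"
  proof (rule integrable_bounded_by)
    show "integrable \<mu> (\<lambda>t. norm (f t - s N t) + norm (s N t))"
      by (intro Bochner_Integration.integrable_add int_diff integrable_norm_simple simple order_refl)
    show "AE t in \<mu>. \<bar>norm (f t)\<bar> \<le> norm (f t - s N t) + norm (s N t)"
      by (simp add: norm_diff_ineq norm_triangle_sub add.commute)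
  qed (rule strongly_measurable_norm[OF f])
  have L1': "(\<lambda>n. \<integral>t. norm (f t - s n t) \<partial>\<mu>) \<longlonglongrightarrow> 0"
  proof -
    have "(\<lambda>n. ennreal (\<integral>t. norm (f t - s n t) \<partial>\<mu>)) \<longlonglongrightarrow> ennreal 0"
    proof (rule Lim_transform_eventually)
      show "(\<lambda>n. \<integral>\<^sup>+t. ennreal (norm (f t - s n t)) \<partial>\<mu>) \<longlonglongrightarrow> ennreal 0" using L1 by simp
      show "eventually (\<lambda>n. (\<integral>\<^sup>+t. ennreal (norm (f t - s n t)) \<partial>\<mu>) = ennreal (\<integral>t. norm (f t - s n t) \<partial>\<mu>)) sequentially"
        unfolding eventually_sequentially using int_diff
        by (intro exI[of _ N]) (auto intro!: nn_integral_eq_integral)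
    qed
    then show ?thesis by (subst (asm) tendsto_ennreal_iff) auto
  qed
  have "(\<lambda>n. \<integral>t. g (s n t) \<partial>\<mu>) \<longlonglongrightarrow> (\<integral>t. g (f t) \<partial>\<mu>)"
  proof (rule LIM_zero_cancel, rule Lim_null_comparison)
    show "(\<lambda>n. norm g * (\<integral>t. norm (f t - s n t) \<partial>\<mu>)) \<longlonglongrightarrow> 0"
      using tendsto_mult_right_zero[OF L1'] by simp
    show "eventually (\<lambda>n. norm ((\<integral>t. g (s n t) \<partial>\<mu>) - (\<integral>t. g (f t) \<partial>\<mu>))
        \<le> norm g * (\<integral>t. norm (f t - s n t) \<partial>\<mu>)) sequentially"
      unfolding eventually_sequentially
    proof (intro exI[of _ N] allI impI)
      fix n assume n: "N \<le> n"
      have "(\<integral>t. g (f t) \<partial>\<mu>) - (\<integral>t. g (s n t) \<partial>\<mu>) = (\<integral>t. g (f t - s n t) \<partial>\<mu>)"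
        using integral_blinfun_diff[OF f int sm[of n] integrable_norm_simple[OF simple], of g] by simp
      also have "\<bar>\<dots>\<bar> \<le> norm g * (\<integral>t. norm (f t - s n t) \<partial>\<mu>)"
        by (intro abs_integral_blinfun_le strongly_measurable_diff f sm int_diff n)
      finally show "norm ((\<integral>t. g (s n t) \<partial>\<mu>) - (\<integral>t. g (f t) \<partial>\<mu>))
          \<le> norm g * (\<integral>t. norm (f t - s n t) \<partial>\<mu>)" by (simp add: abs_minus_commute)
    qed
  qed
  moreover have "(\<lambda>n. \<integral>t. g (s n t) \<partial>\<mu>) \<longlonglongrightarrow> g x"
    using blinfun.tendsto[OF tendsto_const lim, of g] by (simp add: simple_bochner_integral_blinfun simple)
  ultimately show "(\<integral>t. g (f t) \<partial>\<mu>) = g x" by (rule LIMSEQ_unique)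
qed

lemma blinfun_eqD: "(\<And>g :: 'a::real_normed_vector \<Rightarrow>\<^sub>L real. g x = g y) \<Longrightarrow> x = y"
  using exists_norming_functional[of "x - y"]
  by (metis blinfun.diff_right eq_iff_diff_eq_0 norm_eq_zero)

text \<open>
  Approximating simple functions need not be dominated. They are set to \<open>0\<close> wherever their norm
  exceeds that of a simple approximation of \<open>norm (f t)\<close> by more than \<open>1\<close>. Almost everywhere this
  changes only finitely many terms of the sequence, and dominated convergence gives convergence in
  \<open>L\<^sup>1\<close>; the integrals are then a Cauchy sequence.
\<close>

lemma Bochner_integral_exists:
  fixes f :: "real \<Rightarrow> 'a::banach"
  assumes f: "strongly_measurable f" and int: "integrable \<mu> (\<lambda>t. norm (f t))"
  obtains x where "has_Bochner_integral_01 f x"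
proof -
  obtain s where s: "\<And>n. simple_function \<mu> (s n)" "AE t in \<mu>. (\<lambda>n. s n t) \<longlonglongrightarrow> f t"
    using f unfolding strongly_measurable_def by blast
  obtain v where v: "\<And>n. simple_function \<mu> (v n)"
      "\<And>t. t \<in> space \<mu> \<Longrightarrow> (\<lambda>n. v n t) \<longlonglongrightarrow> norm (f t)"
      "\<And>n t. t \<in> space \<mu> \<Longrightarrow> dist (v n t) 0 \<le> 2 * dist (norm (f t)) 0"
    using borel_measurable_implies_sequence_metric[OF strongly_measurable_norm[OF f], of 0] by metis
  define r where "r n t = (if norm (s n t) \<le> \<bar>v n t\<bar> + 1 then s n t else 0)" for n t
  have r_simple: "simple_function \<mu> (r n)" for n
    unfolding r_def
    using simple_function_compose2[OF s(1) v(1), of "\<lambda>x a. if norm x \<le> \<bar>a\<bar> + 1 then x else 0" n n] by simp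
  have r_lim: "AE t in \<mu>. (\<lambda>n. r n t) \<longlonglongrightarrow> f t"
    using s(2) AE_space
  proof eventually_elim
    case (elim t)
    have "(\<lambda>n. \<bar>v n t\<bar> + 1 - norm (s n t)) \<longlonglongrightarrow> \<bar>norm (f t)\<bar> + 1 - norm (f t)"
      by (intro tendsto_intros elim v)
    then have "eventually (\<lambda>n. 0 < \<bar>v n t\<bar> + 1 - norm (s n t)) sequentially"
      by (rule order_tendstoD) simp
    then have "eventually (\<lambda>n. s n t = r n t) sequentially"
      by eventually_elim (simp add: r_def)
    with elim(1) show ?case by (rule Lim_transform_eventually)
  qed
  have r_bound: "norm (f t - r n t) \<le> 3 * norm (f t) + 1" if t: "t \<in> space \<mu>" for n t
  proof -
    have "norm (r n t) \<le> 2 * norm (f t) + 1" using v(3)[OF t, of n] by (auto simp: r_def)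
    then show ?thesis using norm_triangle_ineq4[of "f t" "r n t"] by simp
  qed
  note r_sm = strongly_measurable_simple[OF r_simple]
  have L1: "(\<lambda>n. \<integral>t. norm (f t - r n t) \<partial>\<mu>) \<longlonglongrightarrow> (\<integral>t. 0 \<partial>\<mu>)"
  proof (rule integral_dominated_convergence[where w="\<lambda>t. 3 * norm (f t) + 1"])
    show "AE t in \<mu>. (\<lambda>n. norm (f t - r n t)) \<longlonglongrightarrow> 0"
      using r_lim
    proof eventually_elim
      case (elim t)
      have "(\<lambda>n. norm (f t - r n t)) \<longlonglongrightarrow> norm (f t - f t)" by (intro tendsto_intros elim)
      then show ?case by simp
    qed
    show "AE t in \<mu>. norm (norm (f t - r n t)) \<le> 3 * norm (f t) + 1" for n
      using AE_space by eventually_elim (simp add: r_bound)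
  qed (use int in \<open>auto intro!: strongly_measurable_norm strongly_measurable_diff f r_sm\<close>)
  have int_diff: "integrable \<mu> (\<lambda>t. norm (f t - r n t))" for n
    by (intro integrable_norm_diff f int r_sm integrable_norm_simple r_simple)
  define S where "S n = Bochner_Integration.simple_bochner_integral \<mu> (r n)" for n
  have dist_S: "dist (S m) (S n) \<le> (\<integral>t. norm (f t - r m t) \<partial>\<mu>) + (\<integral>t. norm (f t - r n t) \<partial>\<mu>)" for m n
  proof -
    obtain g :: "'a \<Rightarrow>\<^sub>L real" where g: "norm g \<le> 1" "g (S m - S n) = norm (S m - S n)"
      using exists_norming_functional by metis
    have "norm (S m - S n) = (\<integral>t. g (r m t) \<partial>\<mu>) - (\<integral>t. g (r n t) \<partial>\<mu>)"
      unfolding g(2)[symmetric] by (simp add: S_def blinfun.diff_right simple_bochner_integral_blinfun r_simple)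
    also have "\<dots> = (\<integral>t. g (f t - r n t) \<partial>\<mu>) - (\<integral>t. g (f t - r m t) \<partial>\<mu>)"
      by (simp add: integral_blinfun_diff[OF f int r_sm integrable_norm_simple[OF r_simple]])
    also have "\<dots> \<le> norm g * (\<integral>t. norm (f t - r n t) \<partial>\<mu>) + norm g * (\<integral>t. norm (f t - r m t) \<partial>\<mu>)"
      using abs_integral_blinfun_le[OF strongly_measurable_diff[OF f r_sm[of n]] int_diff, of g]
        abs_integral_blinfun_le[OF strongly_measurable_diff[OF f r_sm[of m]] int_diff, of g] by linarith
    also have "\<dots> \<le> 1 * (\<integral>t. norm (f t - r n t) \<partial>\<mu>) + 1 * (\<integral>t. norm (f t - r m t) \<partial>\<mu>)"
      using g by (intro add_mono mult_right_mono integral_nonneg) auto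
    finally show ?thesis by (simp add: dist_norm)
  qed
  have "Cauchy S"
  proof (rule metric_CauchyI)
    fix e :: real assume "0 < e"
    then have "eventually (\<lambda>n. (\<integral>t. norm (f t - r n t) \<partial>\<mu>) < e/2) sequentially"
      using order_tendstoD(2)[OF L1, of "e/2"] by simp
    then obtain N where N: "\<And>n. n \<ge> N \<Longrightarrow> (\<integral>t. norm (f t - r n t) \<partial>\<mu>) < e/2"
      by (auto simp: eventually_sequentially)
    show "\<exists>M. \<forall>m\<ge>M. \<forall>n\<ge>M. dist (S m) (S n) < e"
    proof (intro exI[of _ N] allI impI)
      fix m n assume "N \<le> m" "N \<le> n"
      then show "dist (S m) (S n) < e" using dist_S[of m n] N[of m] N[of n] by linarith
    qed
  qed
  then obtain x where x: "S \<longlonglongrightarrow> x" by (auto simp: Cauchy_convergent_iff convergent_def)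
  have "(\<lambda>n. \<integral>\<^sup>+t. ennreal (norm (f t - r n t)) \<partial>\<mu>) \<longlonglongrightarrow> 0"
  proof -
    have "(\<integral>\<^sup>+t. ennreal (norm (f t - r n t)) \<partial>\<mu>) = ennreal (\<integral>t. norm (f t - r n t) \<partial>\<mu>)" for n
      by (intro nn_integral_eq_integral int_diff) auto
    then show ?thesis using tendsto_ennrealI[OF L1] by simp
  qed
  then have "has_Bochner_integral_01 f x"
    unfolding has_Bochner_integral_01_def using x f simple_function_simple_bochner_integrable[OF r_simple]
    by (intro conjI exI[of _ r]) (auto simp: S_def[abs_def])
  then show ?thesis by (rule that)
qed

text \<open>
  For strongly measurable functions with integrable norm, the Bochner integral is the weak integral.
  Linearity, norm estimates and uniqueness thus reduce to real-valued integration.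
\<close>

theorem has_Bochner_integral_01_iff:
  fixes f :: "real \<Rightarrow> 'a::banach"
  shows "has_Bochner_integral_01 f x \<longleftrightarrow>
    strongly_measurable f \<and> integrable \<mu> (\<lambda>t. norm (f t)) \<and>
    (\<forall>g :: 'a \<Rightarrow>\<^sub>L real. (\<integral>t. g (f t) \<partial>\<mu>) = g x)"
proof (intro iffI conjI allI; (elim conjE)?)
  assume f: "strongly_measurable f" "integrable \<mu> (\<lambda>t. norm (f t))"
    and g: "\<forall>g :: 'a \<Rightarrow>\<^sub>L real. (\<integral>t. g (f t) \<partial>\<mu>) = g x"
  obtain y where y: "has_Bochner_integral_01 f y" using Bochner_integral_exists[OF f] by metis
  have "y = x" by (rule blinfun_eqD) (metis g has_Bochner_integral_01_D(3)[OF y])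
  with y show "has_Bochner_integral_01 f x" by simp
qed (use has_Bochner_integral_01_D in auto)

corollary Bochner_integrable_iff:
  fixes f :: "real \<Rightarrow> 'a::banach"
  shows "Bochner_integrable f \<longleftrightarrow> strongly_measurable f \<and> integrable \<mu> (\<lambda>t. norm (f t))"
  unfolding Bochner_integrable_def using Bochner_integral_exists[of f] has_Bochner_integral_01_D(1,2) by metis

lemma norm_has_Bochner_integral_diff_le:
  fixes f h :: "real \<Rightarrow> 'a::banach"
  assumes f: "has_Bochner_integral_01 f x" and h: "has_Bochner_integral_01 h y"
  shows "norm (x - y) \<le> (\<integral>t. norm (f t - h t) \<partial>\<mu>)"
proof -
  note F = has_Bochner_integral_01_D[OF f] and H = has_Bochner_integral_01_D[OF h]
  obtain g :: "'a \<Rightarrow>\<^sub>L real" where g: "norm g \<le> 1" "g (x - y) = norm (x - y)"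
    using exists_norming_functional by metis
  have "norm (x - y) = (\<integral>t. g (f t - h t) \<partial>\<mu>)"
    by (simp add: g(2)[symmetric] integral_blinfun_diff[OF F(1,2) H(1,2)] F(3) H(3) blinfun.diff_right[of g x y])
  also have "\<dots> \<le> norm g * (\<integral>t. norm (f t - h t) \<partial>\<mu>)"
    using abs_integral_blinfun_le[OF strongly_measurable_diff[OF F(1) H(1)] integrable_norm_diff[OF F(1,2) H(1,2)], of g]
    by linarith
  also have "\<dots> \<le> 1 * (\<integral>t. norm (f t - h t) \<partial>\<mu>)"
    using g by (intro mult_right_mono integral_nonneg) auto
  finally show ?thesis by simp
qed

lemma has_Bochner_integral_lincomb:
  fixes f h :: "real \<Rightarrow> 'a::banach"
  assumes f: "has_Bochner_integral_01 f x" and h: "has_Bochner_integral_01 h y"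
  shows "has_Bochner_integral_01 (\<lambda>t. a *\<^sub>R f t + b *\<^sub>R h t) (a *\<^sub>R x + b *\<^sub>R y)"
proof -
  note F = has_Bochner_integral_01_D[OF f] and H = has_Bochner_integral_01_D[OF h]
  have sm: "strongly_measurable (\<lambda>t. a *\<^sub>R f t + b *\<^sub>R h t)" by (intro strongly_measurable_lincomb F H)
  moreover have "integrable \<mu> (\<lambda>t. norm (a *\<^sub>R f t + b *\<^sub>R h t))"
  proof (rule integrable_bounded_by)
    show "integrable \<mu> (\<lambda>t. \<bar>a\<bar> * norm (f t) + \<bar>b\<bar> * norm (h t))" using F H by simp
    show "AE t in \<mu>. \<bar>norm (a *\<^sub>R f t + b *\<^sub>R h t)\<bar> \<le> \<bar>a\<bar> * norm (f t) + \<bar>b\<bar> * norm (h t)"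
      by (auto intro!: order_trans[OF norm_triangle_ineq])
  qed (rule strongly_measurable_norm[OF sm])
  ultimately show ?thesis unfolding has_Bochner_integral_01_iff
    by (simp add: blinfun.add_right blinfun.scaleR_right integrable_blinfun_norm F(1,2) H(1,2) F(3) H(3))
qed

section \<open>McShane sums over uniform partitions\<close>

definition cell :: "nat \<Rightarrow> nat \<Rightarrow> real set" where
  "cell n i = {real i / real n .. (real i + 1) / real n}"

text \<open>
  Since tags are free, all the partitions needed can be taken to be uniform.
\<close>

definition fine_tags :: "(real \<Rightarrow> real) \<Rightarrow> nat \<Rightarrow> (nat \<Rightarrow> real) \<Rightarrow> bool" where
  "fine_tags \<delta> n s \<longleftrightarrow> 0 < n \<and> (\<forall>i<n. s i \<in> {0..1} \<and> cell n i \<subseteq> {s i - \<delta> (s i) <..< s i + \<delta> (s i)})"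

lemma cell_bounds: "i < n \<Longrightarrow> 0 \<le> real i / real n \<and> real i / real n < (real i + 1) / real n \<and> (real i + 1) / real n \<le> 1"
  by (simp add: field_simps)

lemma cell_in_closed_subintervals: "i < n \<Longrightarrow> cell n i \<in> closed_subintervals"
  using cell_bounds[of i n] unfolding closed_subintervals_def cell_def by blast

lemma measure_cell: "i < n \<Longrightarrow> measure lebesgue (cell n i) = 1 / real n"
  using cell_bounds[of i n] by (simp add: cell_def diff_divide_distrib[symmetric])

lemma interior_cell: "interior (cell n i) = {real i / real n <..< (real i + 1) / real n}"
  by (simp add: cell_def)

lemma interior_cells_disjoint:
  assumes "i < n" "j < n" "i \<noteq> j"
  shows "interior (cell n i) \<inter> interior (cell n j) = {}"
proof -
  have *: "{real i / real n <..< (real i + 1) / real n} \<inter> {real j / real n <..< (real j + 1) / real n} = {}"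
    if "i < j" "j < n" for i j :: nat
  proof -
    have "(real i + 1) / real n \<le> real j / real n" using that by (intro divide_right_mono) auto
    then show ?thesis by auto
  qed
  show ?thesis unfolding interior_cell using *[of i j] *[of j i] assms
    by (cases "i < j") (auto simp: Int_commute)
qed

definition cell_index :: "nat \<Rightarrow> real \<Rightarrow> nat" where
  "cell_index n t = nat \<lfloor>real n * t\<rfloor>"

lemma cell_index:
  assumes "0 < n" "0 \<le> t" "t < 1"
  shows "cell_index n t < n" "real (cell_index n t) / real n \<le> t" "t < (real (cell_index n t) + 1) / real n"
proof -
  have *: "real (cell_index n t) = of_int \<lfloor>real n * t\<rfloor>"
    using assms by (simp add: cell_index_def)
  have "of_int \<lfloor>real n * t\<rfloor> \<le> real n * t" "real n * t < of_int \<lfloor>real n * t\<rfloor> + 1" by linarith+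
  then show 1: "real (cell_index n t) / real n \<le> t" "t < (real (cell_index n t) + 1) / real n"
    unfolding * using assms by (simp_all add: field_simps)
  have "real (cell_index n t) \<le> real n * t" unfolding * by linarith
  also have "\<dots> < real n * 1" using assms by (intro mult_strict_left_mono) auto
  finally have "real (cell_index n t) < real n" by simp
  then show "cell_index n t < n" by simp
qed

text \<open>
  A Lebesgue number of the cover by the gauge intervals works as a bound for the mesh.
\<close>

lemma fine_tags_exist:
  assumes "gauge_fun \<delta>"
  obtains N where "0 < N" "\<And>n. N \<le> n \<Longrightarrow> \<exists>s. fine_tags \<delta> n s"
proof -
  let ?U = "\<lambda>t. {t - \<delta> t <..< t + \<delta> t}"
  have cover: "{0..1} \<subseteq> \<Union> (?U ` {0..1})" using assms by (force simp: gauge_fun_def)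
  obtain r where r: "0 < r" "\<And>T. T \<subseteq> {0..1} \<Longrightarrow> diameter T < r \<Longrightarrow> \<exists>B\<in>?U ` {0..1}. T \<subseteq> B"
  proof (rule Lebesgue_number_lemma[OF compact_Icc _ cover])
    show "\<And>B. B \<in> ?U ` {0..1} \<Longrightarrow> open B" by auto
  qed auto
  obtain N :: nat where N: "1 / r < real N" using reals_Archimedean2 by blast
  have N0: "0 < real N" using N r(1) by (smt (verit) divide_pos_pos)
  show ?thesis
  proof (rule that[of N])
    show "0 < N" using N0 by simp
    fix n assume n: "N \<le> n"
    have n0: "0 < real n" using N0 n by linarith
    have "1 / real n < r"
    proof -
      have "1 / r < real n" using N n by linarith
      then show ?thesis using r(1) n0 by (simp add: field_simps)
    qed
    then have "\<exists>s. s \<in> {0..1} \<and> cell n i \<subseteq> ?U s" if "i < n" for i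
    proof -
      have "diameter (cell n i) = 1 / real n"
        using cell_bounds[OF that] by (simp add: cell_def diff_divide_distrib[symmetric])
      moreover have "cell n i \<subseteq> {0..1}" using cell_bounds[OF that] unfolding cell_def by auto
      ultimately show ?thesis using r(2)[of "cell n i"] \<open>1 / real n < r\<close> by auto
    qed
    then show "\<exists>s. fine_tags \<delta> n s" unfolding fine_tags_def using n0 by (simp, metis)
  qed
qed

lemma AE_not_in_countable:
  assumes "countable A" shows "AE t in \<mu>. t \<notin> A"
proof -
  have "A \<in> null_sets lebesgue"
    using assms by (intro null_sets_completionI countable_imp_null_set_lborel)
  then have "AE t in lebesgue. t \<notin> A" by (rule AE_not_in)
  then show ?thesis by (subst AE_restrict_space_iff) auto
qed

lemma half_open_cell_subset:
  assumes "i < n" shows "{real i / real n ..< (real i + 1) / real n} \<subseteq> {0..1}"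
proof
  fix x assume "x \<in> {real i / real n ..< (real i + 1) / real n}"
  moreover have "0 \<le> real i / real n" by simp
  ultimately show "x \<in> {0..1}"
    using cell_bounds[OF assms] unfolding atLeastLessThan_iff atLeastAtMost_iff by linarith
qed

lemma emeasure_half_open_cell:
  assumes "i < n"
  shows "emeasure \<mu> {real i / real n ..< (real i + 1) / real n} = ennreal (1 / real n)"
proof -
  show ?thesis using cell_bounds[OF assms] half_open_cell_subset[OF assms]
    by (simp add: emeasure_restrict_space diff_divide_distrib[symmetric])
qed

lemma half_open_cell_in_sets: "{a..<b::real} \<inter> {0..1} \<in> sets \<mu>"
  by (simp add: sets_restrict_space_iff)

lemma half_open_cells_indicator:
  fixes c :: "nat \<Rightarrow> 'b::semiring_1"
  assumes "0 < n" "0 \<le> t" "t < 1"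
  shows "(\<Sum>i<n. c i * indicator {real i / real n ..< (real i + 1) / real n} t) = c (cell_index n t)"
proof -
  have "indicator {real i / real n ..< (real i + 1) / real n} t = (if i = cell_index n t then 1 else 0 :: 'b)"
    if "i < n" for i
  proof -
    have "i = cell_index n t" if "real i / real n \<le> t" "t < (real i + 1) / real n"
    proof -
      have "\<lfloor>real n * t\<rfloor> = int i"
        using that \<open>0 < n\<close> by (intro floor_unique) (auto simp: field_simps)
      then show ?thesis by (simp add: cell_index_def)
    qed
    then show ?thesis using cell_index(2,3)[OF assms] by (cases "i = cell_index n t") (auto simp: indicator_def)
  qed
  then have "(\<Sum>i<n. c i * indicator {real i / real n ..< (real i + 1) / real n} t)
      = (\<Sum>i<n. if i = cell_index n t then c i else 0)"
    by (intro sum.cong) auto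
  also have "\<dots> = c (cell_index n t)" using cell_index(1)[OF assms] by (simp add: sum.delta)
  finally show ?thesis .
qed

text \<open>
  For each cell separately, the values of \<open>D\<close> at admissible tags are bounded, since changing a single
  tag of a fine partition leaves it fine; so the supremum over the admissible tags of each cell is
  attained up to \<open>e\<close>.
\<close>

lemma mcshane_sums_near_maximal_tags:
  fixes D :: "real \<Rightarrow> real"
  assumes D: "\<And>t. t \<in> {0..1} \<Longrightarrow> 0 \<le> D t"
    and sums: "\<And>s. fine_tags \<delta> n s \<Longrightarrow> (\<Sum>i<n. D (s i) / n) \<le> c"
    and s0: "fine_tags \<delta> n s0" and e: "0 < e"
  obtains s where "fine_tags \<delta> n s"
    "\<And>i t. i < n \<Longrightarrow> t \<in> {0..1} \<Longrightarrow> cell n i \<subseteq> {t - \<delta> t <..< t + \<delta> t} \<Longrightarrow> D t \<le> D (s i) + e"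
proof -
  have n: "0 < n" using s0 by (simp add: fine_tags_def)
  let ?A = "\<lambda>i. {t \<in> {0..1}. cell n i \<subseteq> {t - \<delta> t <..< t + \<delta> t}}"
  have "\<exists>s\<in>?A i. \<forall>t\<in>?A i. D t \<le> D s + e" if i: "i < n" for i
  proof -
    have ne: "?A i \<noteq> {}" using s0 i by (auto simp: fine_tags_def)
    have bdd: "bdd_above (D ` ?A i)"
    proof (rule bdd_aboveI2)
      fix t assume t: "t \<in> ?A i"
      have fine: "fine_tags \<delta> n (s0(i := t))" using s0 t by (auto simp: fine_tags_def)
      have "D t / n = D ((s0(i := t)) i) / n" by simp
      also have "\<dots> \<le> (\<Sum>j<n. D ((s0(i := t)) j) / n)"
      proof (rule member_le_sum)
        fix j assume "j \<in> {..<n} - {i}"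
        then have "(s0(i := t)) j \<in> {0..1}" using fine by (auto simp: fine_tags_def)
        then show "0 \<le> D ((s0(i := t)) j) / n" using D by simp
      qed (use i in auto)
      also have "\<dots> \<le> c" by (rule sums[OF fine])
      finally show "D t \<le> c * n" using n by (simp add: field_simps)
    qed
    have "D ` ?A i \<noteq> {}" "Sup (D ` ?A i) - e < Sup (D ` ?A i)" using e ne by simp_all
    from less_cSupD[OF this] obtain s where s: "s \<in> ?A i" "Sup (D ` ?A i) - e < D s"
      by blast
    have "D t \<le> D s + e" if "t \<in> ?A i" for t
      using cSup_upper[OF imageI[OF that] bdd] s(2) by simp
    then show ?thesis using s by blast
  qed
  then have "\<forall>i. \<exists>s. i < n \<longrightarrow> s \<in> ?A i \<and> (\<forall>t\<in>?A i. D t \<le> D s + e)" by blast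
  from choice[OF this] obtain s where s: "\<forall>i<n. s i \<in> ?A i \<and> (\<forall>t\<in>?A i. D t \<le> D (s i) + e)" by blast
  show ?thesis
  proof (rule that[of s])
    show "fine_tags \<delta> n s" unfolding fine_tags_def using n s by blast
    show "D t \<le> D (s i) + e" if "i < n" "t \<in> {0..1}" "cell n i \<subseteq> {t - \<delta> t <..< t + \<delta> t}" for i t
      using s that by blast
  qed
qed

text \<open>
  Let \<open>g n\<close> be the step function that takes on each cell the nearly maximal value of \<open>D\<close> at an
  admissible tag. Its integral is a McShane sum, up to \<open>1 / n\<close>. Every \<open>t\<close> is eventually an admissible
  tag for the cell that contains it, so \<open>D\<close> lies below the lower limit of the \<open>g n\<close>, and Fatou's
  lemma bounds the integral of this lower limit, which is a measurable majorant of \<open>D\<close>.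
\<close>

theorem mcshane_sums_bound_upper_integral:
  fixes D :: "real \<Rightarrow> real"
  assumes \<delta>: "gauge_fun \<delta>" and D: "\<And>t. t \<in> {0..1} \<Longrightarrow> 0 \<le> D t"
    and sums: "\<And>n s. fine_tags \<delta> n s \<Longrightarrow> (\<Sum>i<n. D (s i) / n) \<le> c"
  obtains w where "integrable \<mu> w" "\<And>t. 0 \<le> w t" "AE t in \<mu>. D t \<le> w t" "(\<integral>t. w t \<partial>\<mu>) \<le> c"
proof -
  obtain N where N: "0 < N" "\<And>n. N \<le> n \<Longrightarrow> \<exists>s. fine_tags \<delta> n s"
    using fine_tags_exist[OF \<delta>] by metis
  have *: "\<exists>s. fine_tags \<delta> n s \<and> (\<forall>i t. i < n \<longrightarrow> t \<in> {0..1} \<longrightarrow>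
      cell n i \<subseteq> {t - \<delta> t <..< t + \<delta> t} \<longrightarrow> D t \<le> D (s i) + 1 / n)" if n: "N \<le> n" for n
  proof -
    obtain s0 where "fine_tags \<delta> n s0" using N(2)[OF n] by blast
    moreover have "0 < 1 / real n" using N(1) n by simp
    ultimately obtain s where "fine_tags \<delta> n s" "\<And>i t. i < n \<Longrightarrow> t \<in> {0..1} \<Longrightarrow>
        cell n i \<subseteq> {t - \<delta> t <..< t + \<delta> t} \<Longrightarrow> D t \<le> D (s i) + 1 / n"
      using mcshane_sums_near_maximal_tags[where \<delta>=\<delta> and n=n and D=D and c=c, OF D sums] by blast
    then show ?thesis by blast
  qed
  then obtain s where s: "\<And>n. N \<le> n \<Longrightarrow> fine_tags \<delta> n (s n)"
    and max: "\<And>n i t. N \<le> n \<Longrightarrow> i < n \<Longrightarrow> t \<in> {0..1} \<Longrightarrow>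
      cell n i \<subseteq> {t - \<delta> t <..< t + \<delta> t} \<Longrightarrow> D t \<le> D (s n i) + 1 / n"
  proof -
    have "\<forall>n. \<exists>s. N \<le> n \<longrightarrow> fine_tags \<delta> n s \<and> (\<forall>i t. i < n \<longrightarrow> t \<in> {0..1} \<longrightarrow>
      cell n i \<subseteq> {t - \<delta> t <..< t + \<delta> t} \<longrightarrow> D t \<le> D (s i) + 1 / n)" using * by blast
    from choice[OF this] show ?thesis using that by blast
  qed
  define g where "g n t = (\<Sum>i<n. ennreal (D (s n i) + 1 / n) * indicator ({real i / real n ..< (real i + 1) / real n} \<inter> {0..1}) t)" for n t
  have g_meas [measurable]: "g n \<in> borel_measurable \<mu>" for n
    unfolding g_def using half_open_cell_in_sets
    by (intro borel_measurable_sum borel_measurable_times_ennreal borel_measurable_indicator) auto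
  have D0: "0 \<le> D (s n i)" if "N \<le> n" "i < n" for n i
    using D s[OF that(1)] that(2) by (auto simp: fine_tags_def)
  have c: "0 \<le> c"
  proof -
    have "0 \<le> (\<Sum>i<N. D (s N i) / N)" using D0 by (intro sum_nonneg) auto
    also have "\<dots> \<le> c" by (rule sums[OF s]) simp
    finally show ?thesis .
  qed
  have int_g: "(\<integral>\<^sup>+t. g n t \<partial>\<mu>) \<le> ennreal (c + 1 / n)" if n: "N \<le> n" for n
  proof -
    have n0: "0 < n" using N n by simp
    have "(\<integral>\<^sup>+t. g n t \<partial>\<mu>) = (\<Sum>i<n. ennreal (D (s n i) + 1 / n) * emeasure \<mu> ({real i / real n ..< (real i + 1) / real n} \<inter> {0..1}))"
      unfolding g_def using half_open_cell_in_sets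
      by (subst nn_integral_sum)
        (auto intro!: borel_measurable_times_ennreal borel_measurable_indicator sum.cong nn_integral_cmult_indicator)
    also have "\<dots> = (\<Sum>i<n. ennreal ((D (s n i) + 1 / n) * (1 / n)))"
    proof (rule sum.cong)
      fix i assume i: "i \<in> {..<n}"
      then have "{real i / real n ..< (real i + 1) / real n} \<inter> {0..1} = {real i / real n ..< (real i + 1) / real n}"
        using half_open_cell_subset[of i n] by auto
      then show "ennreal (D (s n i) + 1 / n) * emeasure \<mu> ({real i / real n ..< (real i + 1) / real n} \<inter> {0..1})
          = ennreal ((D (s n i) + 1 / n) * (1 / n))"
        using emeasure_half_open_cell[of i n] D0[OF n, of i] i
        by (simp add: ennreal_mult'[symmetric] del: ennreal_plus)
    qed simp
    also have "\<dots> = ennreal (\<Sum>i<n. (D (s n i) + 1 / n) * (1 / n))"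
      using D0[OF n] by (intro sum_ennreal) auto
    also have "(\<Sum>i<n. (D (s n i) + 1 / n) * (1 / n)) = (\<Sum>i<n. D (s n i) / n) + 1 / n"
      using n0 by (simp add: algebra_simps sum.distrib)
    also have "ennreal \<dots> \<le> ennreal (c + 1 / n)"
      using sums[OF s[OF n]] by (intro ennreal_leI) simp
    finally show ?thesis .
  qed
  define h where "h t = liminf (\<lambda>n. g n t)" for t
  have h_meas [measurable]: "h \<in> borel_measurable \<mu>" unfolding h_def by measurable
  have "(\<integral>\<^sup>+t. h t \<partial>\<mu>) \<le> liminf (\<lambda>n. \<integral>\<^sup>+t. g n t \<partial>\<mu>)"
    unfolding h_def by (rule nn_integral_liminf) measurable
  also have "\<dots> \<le> liminf (\<lambda>n. ennreal (c + 1 / n))"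
    using int_g by (intro Liminf_mono) (auto simp: eventually_sequentially)
  also have "\<dots> = ennreal c"
  proof (rule lim_imp_Liminf)
    have "(\<lambda>n. c + 1 / real n) \<longlonglongrightarrow> c + 0" by (intro tendsto_intros lim_1_over_n)
    then show "(\<lambda>n. ennreal (c + 1 / real n)) \<longlonglongrightarrow> ennreal c" by (simp add: tendsto_ennrealI)
  qed simp
  finally have int_h: "(\<integral>\<^sup>+t. h t \<partial>\<mu>) \<le> ennreal c" .
  have fin: "AE t in \<mu>. h t \<noteq> \<infinity>"
    using int_h by (intro nn_integral_noteq_infinite h_meas) (auto simp: top_unique)
  have ge: "AE t in \<mu>. ennreal (D t) \<le> h t"
    using AE_not_in_countable[of "{1}", simplified] AE_space
  proof eventually_elim
    case (elim t)
    then have t: "0 \<le> t" "t < 1" "t \<in> {0..1}" by auto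
    have \<delta>t: "0 < \<delta> t" using \<delta> t by (auto simp: gauge_fun_def)
    obtain M :: nat where M: "1 / \<delta> t < real M" using reals_Archimedean2 by blast
    have "ennreal (D t) \<le> g n t" if n: "N \<le> n" "M \<le> n" for n
    proof -
      have n0: "0 < n" using N n by simp
      note idx = cell_index[OF n0 t(1,2)]
      have "1 / \<delta> t < real n" using M n by linarith
      then have "1 / real n < \<delta> t" using \<delta>t n0 by (simp add: field_simps)
      then have "cell n (cell_index n t) \<subseteq> {t - \<delta> t <..< t + \<delta> t}"
        using idx(2,3) by (auto simp: cell_def add_divide_distrib)
      then have "D t \<le> D (s n (cell_index n t)) + 1 / n" by (intro max n idx t)
      moreover have "g n t = ennreal (D (s n (cell_index n t)) + 1 / n)"
        unfolding g_def using half_open_cells_indicator[OF n0 t(1,2), of "\<lambda>i. ennreal (D (s n i) + 1 / n)"] t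
        by (simp add: indicator_inter_arith)
      ultimately show ?thesis by (simp add: ennreal_leI)
    qed
    then show "ennreal (D t) \<le> h t"
      unfolding h_def by (intro Liminf_bounded) (auto simp: eventually_sequentially intro!: exI[of _ "N + M"])
  qed
  have eq: "AE t in \<mu>. ennreal (enn2real (h t)) = h t"
    using fin by eventually_elim (simp add: less_top)
  have nn: "(\<integral>\<^sup>+t. ennreal (enn2real (h t)) \<partial>\<mu>) = (\<integral>\<^sup>+t. h t \<partial>\<mu>)"
    by (rule nn_integral_cong_AE[OF eq])
  show ?thesis
  proof (rule that[of "\<lambda>t. enn2real (h t)"])
    show int: "integrable \<mu> (\<lambda>t. enn2real (h t))"
      using nn int_h by (intro integrableI_nonneg) (auto simp: top_unique less_top[symmetric])
    have "ennreal (\<integral>t. enn2real (h t) \<partial>\<mu>) \<le> ennreal c"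
      using nn_integral_eq_integral[OF int] nn int_h by simp
    then show "(\<integral>t. enn2real (h t) \<partial>\<mu>) \<le> c" using c by simp
    show "AE t in \<mu>. D t \<le> enn2real (h t)"
      using eq ge AE_space
    proof eventually_elim
      case (elim t)
      then have "ennreal (D t) \<le> ennreal (enn2real (h t))" by simp
      then show ?case by simp
    qed
  qed simp
qed

section \<open>Variational McShane primitives\<close>

lemma mcshane_partition_cells:
  assumes "fine_tags \<delta> n s"
  defines "P \<equiv> (\<lambda>i. (cell n i, s i)) ` {..<n}"
  shows "mcshane_partition P" "delta_fine \<delta> P"
    "(\<Sum>(I, t)\<in>P. F I t) = (\<Sum>i<n. F (cell n i) (s i))"
proof -
  have n: "0 < n" and s: "\<And>i. i < n \<Longrightarrow> s i \<in> {0..1}"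
    and fine: "\<And>i. i < n \<Longrightarrow> cell n i \<subseteq> {s i - \<delta> (s i) <..< s i + \<delta> (s i)}"
    using assms(1) by (auto simp: fine_tags_def)
  have union: "(\<Union>i<n. cell n i) = {0..1}"
  proof
    show "(\<Union>i<n. cell n i) \<subseteq> {0..1}"
    proof
      fix t assume "t \<in> (\<Union>i<n. cell n i)"
      then obtain i where i: "i < n" "real i / real n \<le> t" "t \<le> (real i + 1) / real n"
        by (auto simp: cell_def)
      then show "t \<in> {0..1}"
        using cell_bounds[of i n] unfolding atLeastAtMost_iff by linarith
    qed
    show "{0..1} \<subseteq> (\<Union>i<n. cell n i)"
    proof
      fix t :: real assume t: "t \<in> {0..1}"
      show "t \<in> (\<Union>i<n. cell n i)"
      proof (cases "t < 1")
        case True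
        then have "t \<in> cell n (cell_index n t)" "cell_index n t < n"
          using cell_index[OF n, of t] t by (auto simp: cell_def)
        then show ?thesis by blast
      next
        case False
        then have "t \<in> cell n (n - 1)" using t n by (auto simp: cell_def of_nat_diff)
        then show ?thesis using n by (intro UN_I[of "n - 1"]) auto
      qed
    qed
  qed
  show "mcshane_partition P"
    unfolding mcshane_partition_def
  proof (intro conjI)
    show "\<forall>(I, t)\<in>P. I \<in> closed_subintervals \<and> t \<in> {0..1}"
      using s by (auto simp: P_def intro: cell_in_closed_subintervals)
    show "\<forall>(I, t)\<in>P. \<forall>(J, s)\<in>P. (I, t) \<noteq> (J, s) \<longrightarrow> interior I \<inter> interior J = {}"
    proof (clarsimp simp: P_def)
      fix i j assume "i < n" "j < n" "cell n i = cell n j \<longrightarrow> s i \<noteq> s j"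
      then have "i \<noteq> j" by auto
      then show "interior (cell n i) \<inter> interior (cell n j) = {}"
        using \<open>i < n\<close> \<open>j < n\<close> by (intro interior_cells_disjoint)
    qed
    show "(\<Union>(I, t)\<in>P. I) = {0..1}" using union by (simp add: P_def)
  qed (simp add: P_def)
  show "delta_fine \<delta> P" using fine by (auto simp: delta_fine_def P_def)
  have "inj_on (\<lambda>i. (cell n i, s i)) {..<n}"
  proof (rule inj_onI)
    fix i j assume ij: "i \<in> {..<n}" "j \<in> {..<n}" "(cell n i, s i) = (cell n j, s j)"
    show "i = j"
    proof (rule ccontr)
      assume "i \<noteq> j"
      then have "interior (cell n i) = {}" using interior_cells_disjoint[of i n j] ij by auto
      then show False using cell_bounds[of i n] ij by (simp add: interior_cell)
    qed
  qed
  then show "(\<Sum>(I, t)\<in>P. F I t) = (\<Sum>i<n. F (cell n i) (s i))"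
    by (simp add: P_def sum.reindex)
qed

lemma vM_primitive_cells:
  assumes "vM_primitive \<Gamma> \<Phi>" "0 < \<epsilon>"
  obtains \<delta> where "gauge_fun \<delta>"
    "\<And>n s. fine_tags \<delta> n s \<Longrightarrow>
      (\<Sum>i<n. hausdorff_dist (\<Phi> (cell n i)) ((*\<^sub>R) (1 / n) ` \<Gamma> (s i))) < \<epsilon>"
proof -
  obtain \<delta> where \<delta>: "gauge_fun \<delta>" and sums: "\<And>P. mcshane_partition P \<and> delta_fine \<delta> P \<Longrightarrow>
      (\<Sum>(I, t)\<in>P. hausdorff_dist (\<Phi> I) ((*\<^sub>R) (measure lebesgue I) ` \<Gamma> t)) < \<epsilon>"
    using assms unfolding vM_primitive_def by blast
  have "(\<Sum>i<n. hausdorff_dist (\<Phi> (cell n i)) ((*\<^sub>R) (1 / n) ` \<Gamma> (s i))) < \<epsilon>"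
    if fine: "fine_tags \<delta> n s" for n s
  proof -
    have "(\<Sum>i<n. hausdorff_dist (\<Phi> (cell n i)) ((*\<^sub>R) (measure lebesgue (cell n i)) ` \<Gamma> (s i))) < \<epsilon>"
      using sums[OF conjI[OF mcshane_partition_cells(1,2)[OF fine]]]
      unfolding mcshane_partition_cells(3)[OF fine, of "\<lambda>I t. hausdorff_dist (\<Phi> I) ((*\<^sub>R) (measure lebesgue I) ` \<Gamma> t)"] .
    then show ?thesis by (simp add: measure_cell)
  qed
  with \<delta> show ?thesis by (rule that)
qed

lemma finitely_additive_cells:
  assumes add: "finitely_additive \<Phi>" and n: "0 < n"
  shows "\<Phi> {0..1} = (\<Sum>i<n. \<Phi> (cell n i))"
proof -
  have "\<Phi> {0..real m / real n} = (\<Sum>i<m. \<Phi> (cell n i))" if "0 < m" "m \<le> n" for m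
    using that
  proof (induction m rule: nat_induct_non_zero)
    case 1
    then show ?case by (simp add: cell_def)
  next
    case (Suc m)
    let ?I = "{0..real m / real n}"
    have "real m / real n < 1" using Suc by simp
    then have "?I \<in> closed_subintervals"
      unfolding closed_subintervals_def using Suc.hyps Suc.prems by (auto intro!: exI[of _ "real m / real n"])
    moreover have "cell n m \<in> closed_subintervals" using Suc.prems by (intro cell_in_closed_subintervals) simp
    moreover have un: "?I \<union> cell n m = {0..real (Suc m) / real n}"
    proof -
      have "real m / real n \<le> (real m + 1) / real n" by (intro divide_right_mono) auto
      then have "{0..real m / real n} \<union> {real m / real n..(real m + 1) / real n} = {0..(real m + 1) / real n}"
        by (intro ivl_disj_un_two_touch) auto
      then show ?thesis by (simp add: cell_def add.commute)
    qed
    moreover have "{0..real (Suc m) / real n} \<in> closed_subintervals"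
    proof -
      have "0 < real (Suc m) / real n" "real (Suc m) / real n \<le> 1" using Suc.prems by auto
      then show ?thesis unfolding closed_subintervals_def by blast
    qed
    moreover have "interior ?I \<inter> interior (cell n m) = {}" by (simp add: interior_cell)
    ultimately have "\<Phi> {0..real (Suc m) / real n} = \<Phi> ?I + \<Phi> (cell n m)"
      using add unfolding finitely_additive_def by metis
    then show ?case using Suc by simp
  qed
  from this[of n] show ?thesis using n by simp
qed

lemma fine_tags_obtain:
  assumes "gauge_fun \<delta>"
  obtains n s where "fine_tags \<delta> n s"
proof -
  obtain N where "\<And>n. N \<le> n \<Longrightarrow> \<exists>s. fine_tags \<delta> n s" using fine_tags_exist[OF assms] by blast
  then show ?thesis using that by blast
qed

lemma vM_primitive_cwk: "vM_primitive \<Gamma> \<Phi> \<Longrightarrow> I \<in> closed_subintervals \<Longrightarrow> \<Phi> I \<in> cwk"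
  by (simp add: vM_primitive_def)

lemma vM_primitive_cells_sum: "vM_primitive \<Gamma> \<Phi> \<Longrightarrow> 0 < n \<Longrightarrow> \<Phi> {0..1} = (\<Sum>i<n. \<Phi> (cell n i))"
  by (simp add: vM_primitive_def finitely_additive_cells)

lemma unit_in_closed_subintervals: "{0..1} \<in> closed_subintervals"
  unfolding closed_subintervals_def by (intro CollectI exI[of _ 0] exI[of _ 1]) auto

lemma fine_tags_min: "fine_tags (\<lambda>t. min (\<delta> t) (\<delta>' t)) n s \<Longrightarrow> fine_tags \<delta> n s \<and> fine_tags \<delta>' n s"
  unfolding fine_tags_def by fastforce

lemma riemann_sum_near_primitive:
  fixes \<Gamma> :: "real \<Rightarrow> 'a::real_normed_vector set"
  assumes prim: "vM_primitive \<Gamma> \<Phi>" and ne: "\<And>t. t \<in> {0..1} \<Longrightarrow> \<Gamma> t \<noteq> {}"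
    and fine: "fine_tags \<delta> n s" and x: "x \<in> \<Phi> {0..1}"
    and le: "(\<Sum>i<n. hausdorff_dist (\<Phi> (cell n i)) ((*\<^sub>R) (1 / n) ` \<Gamma> (s i))) < \<epsilon>"
  obtains k where "\<And>i. i < n \<Longrightarrow> k i \<in> \<Gamma> (s i)" "dist x (\<Sum>i<n. (1 / n) *\<^sub>R k i) < \<epsilon>"
proof -
  have n: "0 < n" and s: "\<And>i. i < n \<Longrightarrow> s i \<in> {0..1}" using fine by (auto simp: fine_tags_def)
  obtain a where a: "x = (\<Sum>i<n. a i)" "\<And>i. i < n \<Longrightarrow> a i \<in> \<Phi> (cell n i)"
    using x vM_primitive_cells_sum[OF prim n] set_sum_alt[of "{..<n}" "\<lambda>i. \<Phi> (cell n i)"] by auto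
  obtain b where b: "\<And>i. i \<in> {..<n} \<Longrightarrow> b i \<in> (*\<^sub>R) (1 / n) ` \<Gamma> (s i)" "dist (\<Sum>i<n. a i) (\<Sum>i<n. b i) < \<epsilon>"
  proof (rule sum_selection_near[where I="{..<n}" and A="\<lambda>i. \<Phi> (cell n i)" and a=a
        and B="\<lambda>i. (*\<^sub>R) (1 / n) ` \<Gamma> (s i)" and r=\<epsilon>])
    show "bounded (\<Phi> (cell n i))" if "i \<in> {..<n}" for i
      using that by (intro cwk_bounded vM_primitive_cwk[OF prim] cell_in_closed_subintervals) simp
  qed (use a le ne s in auto)
  have "\<forall>i. \<exists>k. i < n \<longrightarrow> k \<in> \<Gamma> (s i) \<and> b i = (1 / n) *\<^sub>R k" using b(1) by blast
  from choice[OF this] obtain k where k: "\<forall>i<n. k i \<in> \<Gamma> (s i) \<and> b i = (1 / n) *\<^sub>R k i" by blast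
  then have "(\<Sum>i<n. b i) = (\<Sum>i<n. (1 / n) *\<^sub>R k i)" by (intro sum.cong) auto
  with b(2) a(1) k show ?thesis by (intro that[of k]) auto
qed

lemma vM_primitive_near_riemann_sum:
  fixes \<Gamma> :: "real \<Rightarrow> 'a::real_normed_vector set"
  assumes prim: "vM_primitive \<Gamma> \<Phi>" and cwk: "\<And>t. t \<in> {0..1} \<Longrightarrow> \<Gamma> t \<in> cwk"
    and fine: "fine_tags \<delta> n s" and k: "\<And>i. i < n \<Longrightarrow> k i \<in> \<Gamma> (s i)"
    and le: "(\<Sum>i<n. hausdorff_dist (\<Phi> (cell n i)) ((*\<^sub>R) (1 / n) ` \<Gamma> (s i))) < \<epsilon>"
  obtains x where "x \<in> \<Phi> {0..1}" "dist (\<Sum>i<n. (1 / n) *\<^sub>R k i) x < \<epsilon>"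
proof -
  have n: "0 < n" and s: "\<And>i. i < n \<Longrightarrow> s i \<in> {0..1}" using fine by (auto simp: fine_tags_def)
  obtain a where a: "\<And>i. i \<in> {..<n} \<Longrightarrow> a i \<in> \<Phi> (cell n i)" "dist (\<Sum>i<n. (1 / n) *\<^sub>R k i) (\<Sum>i<n. a i) < \<epsilon>"
  proof (rule sum_selection_near[where I="{..<n}" and B="\<lambda>i. \<Phi> (cell n i)" and a="\<lambda>i. (1 / n) *\<^sub>R k i"
        and A="\<lambda>i. (*\<^sub>R) (1 / n) ` \<Gamma> (s i)" and r=\<epsilon>])
    show "bounded ((*\<^sub>R) (1 / real n) ` \<Gamma> (s i))" if "i \<in> {..<n}" for i
      using that by (intro bounded_scaling cwk_bounded cwk s) simp
    show "\<Phi> (cell n i) \<noteq> {}" if "i \<in> {..<n}" for i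
      using that by (intro cwk_nonempty vM_primitive_cwk[OF prim] cell_in_closed_subintervals) simp
  qed (use k le in \<open>auto simp: hausdorff_dist_commute\<close>)
  then have "(\<Sum>i<n. a i) \<in> \<Phi> {0..1}"
    using vM_primitive_cells_sum[OF prim n] set_sum_alt[of "{..<n}" "\<lambda>i. \<Phi> (cell n i)"] by auto
  with a(2) show ?thesis by (rule that[rotated])
qed

text \<open>
  Both primitives are approximated by Riemann sums over a common partition. The case of a singleton
  \<open>{f t}\<close> contained in \<open>\<Gamma> t\<close> places integrals of selections in the integral of \<open>\<Gamma>\<close>, and the case
  of equality shows that the value of the integral is unique.
\<close>

theorem vM_primitive_mono:
  fixes \<Gamma> \<Gamma>' :: "real \<Rightarrow> 'a::real_normed_vector set"
  assumes prim: "vM_primitive \<Gamma> \<Phi>" "vM_primitive \<Gamma>' \<Phi>'"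
    and cwk: "\<And>t. t \<in> {0..1} \<Longrightarrow> \<Gamma> t \<in> cwk" "\<And>t. t \<in> {0..1} \<Longrightarrow> \<Gamma>' t \<in> cwk"
    and sub: "\<And>t. t \<in> {0..1} \<Longrightarrow> \<Gamma> t \<subseteq> \<Gamma>' t"
  shows "\<Phi> {0..1} \<subseteq> \<Phi>' {0..1}"
proof
  fix x assume x: "x \<in> \<Phi> {0..1}"
  have "\<exists>y\<in>\<Phi>' {0..1}. dist y x < e" if e: "0 < e" for e
  proof -
    have e2: "0 < e/2" using e by simp
    obtain \<delta> where \<delta>: "gauge_fun \<delta>" "\<And>n s. fine_tags \<delta> n s \<Longrightarrow>
        (\<Sum>i<n. hausdorff_dist (\<Phi> (cell n i)) ((*\<^sub>R) (1 / n) ` \<Gamma> (s i))) < e/2"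
      using vM_primitive_cells[OF prim(1) e2] by metis
    obtain \<delta>' where \<delta>': "gauge_fun \<delta>'" "\<And>n s. fine_tags \<delta>' n s \<Longrightarrow>
        (\<Sum>i<n. hausdorff_dist (\<Phi>' (cell n i)) ((*\<^sub>R) (1 / n) ` \<Gamma>' (s i))) < e/2"
      using vM_primitive_cells[OF prim(2) e2] by metis
    have "gauge_fun (\<lambda>t. min (\<delta> t) (\<delta>' t))" using \<delta>(1) \<delta>'(1) by (simp add: gauge_fun_def)
    then obtain n s where min: "fine_tags (\<lambda>t. min (\<delta> t) (\<delta>' t)) n s"
      by (rule fine_tags_obtain)
    note fine = conjunct1[OF fine_tags_min[OF min]] conjunct2[OF fine_tags_min[OF min]]
    have s: "\<And>i. i < n \<Longrightarrow> s i \<in> {0..1}" using fine(1) by (auto simp: fine_tags_def)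
    obtain k where k: "\<And>i. i < n \<Longrightarrow> k i \<in> \<Gamma> (s i)" "dist x (\<Sum>i<n. (1 / n) *\<^sub>R k i) < e/2"
      using riemann_sum_near_primitive[OF prim(1) cwk_nonempty[OF cwk(1)] fine(1) x \<delta>(2)[OF fine(1)]] by blast
    have k': "\<And>i. i < n \<Longrightarrow> k i \<in> \<Gamma>' (s i)" using k(1) sub s by blast
    obtain y where y: "y \<in> \<Phi>' {0..1}" "dist (\<Sum>i<n. (1 / n) *\<^sub>R k i) y < e/2"
      using vM_primitive_near_riemann_sum[OF prim(2) cwk(2) fine(2) k' \<delta>'(2)[OF fine(2)]] by blast
    have "dist x y < e"
      using dist_triangle[of x y "\<Sum>i<n. (1 / n) *\<^sub>R k i"] k(2) y(2) by linarith
    then show ?thesis using y(1) by (auto simp: dist_commute)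
  qed
  then have "x \<in> closure (\<Phi>' {0..1})" by (auto simp: closure_approachable)
  then show "x \<in> \<Phi>' {0..1}"
    using cwk_closed[OF vM_primitive_cwk[OF prim(2) unit_in_closed_subintervals]] by simp
qed

corollary vM_integral_eq:
  fixes \<Gamma> :: "real \<Rightarrow> 'a::real_normed_vector set"
  assumes prim: "vM_primitive \<Gamma> \<Phi>" and cwk: "\<And>t. t \<in> {0..1} \<Longrightarrow> \<Gamma> t \<in> cwk"
  shows "vM_integral \<Gamma> = \<Phi> {0..1}"
  unfolding vM_integral_def
proof (rule the_equality)
  fix S assume "\<exists>\<Psi>. vM_primitive \<Gamma> \<Psi> \<and> S = \<Psi> {0..1}"
  then obtain \<Psi> where \<Psi>: "vM_primitive \<Gamma> \<Psi>" "S = \<Psi> {0..1}" by blast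
  show "S = \<Phi> {0..1}"
    unfolding \<Psi>(2)
    using vM_primitive_mono[OF \<Psi>(1) prim cwk cwk order_refl] vM_primitive_mono[OF prim \<Psi>(1) cwk cwk order_refl]
    by (rule subset_antisym)
qed (use prim in auto)

section \<open>Step approximations of an integrable multifunction\<close>

locale vM_multifunction =
  fixes \<Gamma> :: "real \<Rightarrow> 'a::banach set" and \<Phi> :: "real set \<Rightarrow> 'a set"
  assumes cwk_value: "t \<in> {0..1} \<Longrightarrow> \<Gamma> t \<in> cwk"
    and primitive: "vM_primitive \<Gamma> \<Phi>"
begin

lemma hausdorff_dist_value_nonneg:
  "s \<in> {0..1} \<Longrightarrow> t \<in> {0..1} \<Longrightarrow> 0 \<le> hausdorff_dist (\<Gamma> s) (\<Gamma> t)"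
  by (intro hausdorff_dist_nonneg cwk_bounded cwk_nonempty cwk_value)

text \<open>
  The function \<open>\<tau>\<close> sends a point to the tag of its cell in a fixed fine partition. A finer gauge
  forces every interval tagged at \<open>t\<close> into that cell, so the interval may be retagged with \<open>\<tau> t\<close>
  without losing fineness. The grid points, where cells meet, are sent to themselves.
\<close>

lemma step_approximation:
  assumes \<epsilon>: "0 < \<epsilon>"
  obtains \<tau> w n s where
    "simple_function \<mu> \<tau>" "\<And>t. t \<in> {0..1} \<Longrightarrow> \<tau> t \<in> {0..1}"
    "integrable \<mu> w" "\<And>t. 0 \<le> w t" "AE t in \<mu>. hausdorff_dist (\<Gamma> t) (\<Gamma> (\<tau> t)) \<le> w t" "(\<integral>t. w t \<partial>\<mu>) \<le> 2 * \<epsilon>"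
    "0 < n" "AE t in \<mu>. \<tau> t = s (cell_index n t)"
    "\<And>x. x \<in> \<Phi> {0..1} \<Longrightarrow> \<exists>k. (\<forall>i<n. k i \<in> \<Gamma> (s i)) \<and> dist x (\<Sum>i<n. (1 / n) *\<^sub>R k i) < \<epsilon>"
proof -
  obtain \<delta> where \<delta>: "gauge_fun \<delta>" and sums: "\<And>n s. fine_tags \<delta> n s \<Longrightarrow>
      (\<Sum>i<n. hausdorff_dist (\<Phi> (cell n i)) ((*\<^sub>R) (1 / n) ` \<Gamma> (s i))) < \<epsilon>"
    using vM_primitive_cells[OF primitive \<epsilon>] by metis
  obtain n s where fine: "fine_tags \<delta> n s" using fine_tags_obtain[OF \<delta>] .
  have n: "0 < n" and s: "\<And>i. i < n \<Longrightarrow> s i \<in> {0..1}"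
    and s_fine: "\<And>i. i < n \<Longrightarrow> cell n i \<subseteq> {s i - \<delta> (s i) <..< s i + \<delta> (s i)}"
    using fine by (auto simp: fine_tags_def)
  define grid where "grid = (\<lambda>i. real i / real n) ` {..n}"
  have grid: "finite grid" by (simp add: grid_def)
  define \<tau> where "\<tau> t = (if t \<in> grid then t else s (cell_index n t))" for t
  have off_grid: "cell_index n t < n" "real (cell_index n t) / real n < t" "t < (real (cell_index n t) + 1) / real n"
    if t: "t \<in> {0..1}" "t \<notin> grid" for t
  proof -
    have "1 \<in> grid" using n by (auto simp: grid_def image_iff intro!: bexI[of _ n])
    then have "t < 1" using t by (cases "t = 1") auto
    note c = cell_index[OF n _ this]
    show "cell_index n t < n" "t < (real (cell_index n t) + 1) / real n" using c t by auto
    have "real (cell_index n t) / real n \<in> grid" using c t by (auto simp: grid_def)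
    then show "real (cell_index n t) / real n < t" using c(2) t by (metis atLeastAtMost_iff order_le_less)
  qed
  have \<tau>_in: "\<tau> t \<in> {0..1}" if "t \<in> {0..1}" for t
    using that s off_grid(1)[OF that] by (simp add: \<tau>_def)
  \<comment> \<open>Off the grid, an interval that is fine for this gauge stays inside the cell of its tag.\<close>
  define \<delta>' where "\<delta>' t = (if t \<in> grid then \<delta> t else
     min (\<delta> t) (min (t - real (cell_index n t) / real n) ((real (cell_index n t) + 1) / real n - t)))" for t
  have \<delta>': "gauge_fun \<delta>'"
    using \<delta> off_grid unfolding gauge_fun_def \<delta>'_def by auto
  have sum_le: "(\<Sum>j<m. hausdorff_dist (\<Gamma> (r j)) (\<Gamma> (\<tau> (r j))) / m) \<le> 2 * \<epsilon>" if r: "fine_tags \<delta>' m r" for m r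
  proof -
    have m: "0 < m" and r_in: "\<And>j. j < m \<Longrightarrow> r j \<in> {0..1}"
      and r_fine: "\<And>j. j < m \<Longrightarrow> cell m j \<subseteq> {r j - \<delta>' (r j) <..< r j + \<delta>' (r j)}"
      using r by (auto simp: fine_tags_def)
    have fine1: "fine_tags \<delta> m r"
      unfolding fine_tags_def
    proof (intro conjI allI impI)
      fix j assume j: "j < m"
      have "\<delta>' (r j) \<le> \<delta> (r j)" by (simp add: \<delta>'_def)
      then have "{r j - \<delta>' (r j) <..< r j + \<delta>' (r j)} \<subseteq> {r j - \<delta> (r j) <..< r j + \<delta> (r j)}" by auto
      with r_fine[OF j] show "cell m j \<subseteq> {r j - \<delta> (r j) <..< r j + \<delta> (r j)}" by (rule order_trans)
    qed (use m r_in in auto)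
    have fine2: "fine_tags \<delta> m (\<lambda>j. \<tau> (r j))"
      unfolding fine_tags_def
    proof (intro conjI allI impI)
      fix j assume j: "j < m"
      show "cell m j \<subseteq> {\<tau> (r j) - \<delta> (\<tau> (r j)) <..< \<tau> (r j) + \<delta> (\<tau> (r j))}"
      proof (cases "r j \<in> grid")
        case True
        then show ?thesis using fine1 j by (simp add: \<tau>_def fine_tags_def)
      next
        case False
        let ?i = "cell_index n (r j)"
        have "\<delta>' (r j) \<le> r j - real ?i / real n" "\<delta>' (r j) \<le> (real ?i + 1) / real n - r j"
          using False by (simp_all add: \<delta>'_def)
        then have "{r j - \<delta>' (r j) <..< r j + \<delta>' (r j)} \<subseteq> cell n ?i" by (auto simp: cell_def)
        then show ?thesis
          using r_fine[OF j] s_fine[OF off_grid(1)[OF r_in[OF j] False]] False by (simp add: \<tau>_def)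
      qed
    qed (use m r_in \<tau>_in in auto)
    have "hausdorff_dist (\<Gamma> (r j)) (\<Gamma> (\<tau> (r j))) / m
        \<le> hausdorff_dist (\<Phi> (cell m j)) ((*\<^sub>R) (1 / m) ` \<Gamma> (r j))
          + hausdorff_dist (\<Phi> (cell m j)) ((*\<^sub>R) (1 / m) ` \<Gamma> (\<tau> (r j)))" if j: "j < m" for j
    proof -
      have \<Gamma>1: "\<Gamma> (r j) \<in> cwk" by (rule cwk_value[OF r_in[OF j]])
      have \<Gamma>2: "\<Gamma> (\<tau> (r j)) \<in> cwk" by (rule cwk_value[OF \<tau>_in[OF r_in[OF j]]])
      have \<Phi>1: "\<Phi> (cell m j) \<in> cwk" by (intro vM_primitive_cwk[OF primitive] cell_in_closed_subintervals j)
      have "(1 / m) * hausdorff_dist (\<Gamma> (r j)) (\<Gamma> (\<tau> (r j)))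
          \<le> hausdorff_dist ((*\<^sub>R) (1 / m) ` \<Gamma> (r j)) ((*\<^sub>R) (1 / m) ` \<Gamma> (\<tau> (r j)))"
        using m \<Gamma>1 \<Gamma>2 by (intro hausdorff_dist_scaleR cwk_bounded cwk_nonempty) auto
      also have "\<dots> \<le> hausdorff_dist ((*\<^sub>R) (1 / m) ` \<Gamma> (r j)) (\<Phi> (cell m j))
          + hausdorff_dist (\<Phi> (cell m j)) ((*\<^sub>R) (1 / m) ` \<Gamma> (\<tau> (r j)))"
        by (rule hausdorff_dist_triangle)
          (use \<Gamma>1 \<Gamma>2 \<Phi>1 in \<open>auto intro: bounded_scaling cwk_bounded dest: cwk_nonempty\<close>)
      finally show ?thesis by (simp add: hausdorff_dist_commute)
    qed
    then have "(\<Sum>j<m. hausdorff_dist (\<Gamma> (r j)) (\<Gamma> (\<tau> (r j))) / m)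
        \<le> (\<Sum>j<m. hausdorff_dist (\<Phi> (cell m j)) ((*\<^sub>R) (1 / m) ` \<Gamma> (r j))
          + hausdorff_dist (\<Phi> (cell m j)) ((*\<^sub>R) (1 / m) ` \<Gamma> (\<tau> (r j))))"
      by (intro sum_mono) auto
    also have "\<dots> \<le> 2 * \<epsilon>"
      using sums[OF fine1] sums[OF fine2] by (simp add: sum.distrib)
    finally show ?thesis .
  qed
  obtain w where w: "integrable \<mu> w" "\<And>t. 0 \<le> w t"
    "AE t in \<mu>. hausdorff_dist (\<Gamma> t) (\<Gamma> (\<tau> t)) \<le> w t" "(\<integral>t. w t \<partial>\<mu>) \<le> 2 * \<epsilon>"
  proof (rule mcshane_sums_bound_upper_integral[where \<delta>=\<delta>' and c="2 * \<epsilon>"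
        and D="\<lambda>t. hausdorff_dist (\<Gamma> t) (\<Gamma> (\<tau> t))"])
    show "0 \<le> hausdorff_dist (\<Gamma> t) (\<Gamma> (\<tau> t))" if "t \<in> {0..1}" for t
      by (rule hausdorff_dist_value_nonneg[OF that \<tau>_in[OF that]])
  qed (use \<delta>' sum_le in \<open>blast+\<close>)
  have \<tau>_simple: "simple_function \<mu> \<tau>"
  proof (rule simple_function_borel_measurable)
    have [measurable]: "grid \<in> sets borel" using grid by (simp add: borel_closed finite_imp_closed)
    have "\<tau> \<in> borel_measurable borel" unfolding \<tau>_def cell_index_def by measurable
    then show "\<tau> \<in> borel_measurable \<mu>" by (simp add: measurable_completion measurable_restrict_space1)
    have "\<tau> ` space \<mu> \<subseteq> grid \<union> s ` {..<n}" using off_grid(1) by (auto simp: \<tau>_def)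
    then show "finite (\<tau> ` space \<mu>)" using grid by (auto intro: finite_subset)
  qed
  have ae: "AE t in \<mu>. \<tau> t = s (cell_index n t)"
    using AE_not_in_countable[OF countable_finite[OF grid]] by eventually_elim (simp add: \<tau>_def)
  have near: "\<exists>k. (\<forall>i<n. k i \<in> \<Gamma> (s i)) \<and> dist x (\<Sum>i<n. (1 / n) *\<^sub>R k i) < \<epsilon>" if "x \<in> \<Phi> {0..1}" for x
    using riemann_sum_near_primitive[OF primitive cwk_nonempty[OF cwk_value] fine that sums[OF fine]] by blast
  show ?thesis by (rule that[OF \<tau>_simple \<tau>_in w n ae near])
qed

text \<open>
  The step approximation takes finitely many bounded values, and the Hausdorff distance to it is
  dominated by an integrable function.
\<close>

lemma integrably_bounded:
  obtains w where "integrable \<mu> w" "\<And>t. 1 \<le> w t" "AE t in \<mu>. \<forall>z\<in>\<Gamma> t. norm z \<le> w t"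
proof -
  obtain \<tau> w n s where \<tau>: "simple_function \<mu> \<tau>" "\<And>t. t \<in> {0..1} \<Longrightarrow> \<tau> t \<in> {0..1}"
    and w: "integrable \<mu> w" "\<And>t. 0 \<le> w t" "AE t in \<mu>. hausdorff_dist (\<Gamma> t) (\<Gamma> (\<tau> t)) \<le> w t"
    by (rule step_approximation[of 1]) (use zero_less_one in blast)+
  have "bounded (\<Union>r\<in>\<tau> ` {0..1}. \<Gamma> r)"
    using \<tau> by (intro bounded_UN) (auto simp: simple_function_def intro!: cwk_bounded cwk_value)
  then obtain B where "\<And>r z. r \<in> \<tau> ` {0..1} \<Longrightarrow> z \<in> \<Gamma> r \<Longrightarrow> norm z \<le> B" by (auto simp: bounded_iff)
  then have B: "norm z \<le> max B 0" if "r \<in> \<tau> ` {0..1}" "z \<in> \<Gamma> r" for r z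
    using that by (meson max.coboundedI1)
  show ?thesis
  proof (rule that[of "\<lambda>t. w t + (max B 0 + 1)"])
    show "integrable \<mu> (\<lambda>t. w t + (max B 0 + 1))" using w by simp
    show "1 \<le> w t + (max B 0 + 1)" for t using w(2)[of t] by simp
    show "AE t in \<mu>. \<forall>z\<in>\<Gamma> t. norm z \<le> w t + (max B 0 + 1)"
      using w(3) AE_space
    proof (eventually_elim, intro ballI)
      fix t z assume t: "hausdorff_dist (\<Gamma> t) (\<Gamma> (\<tau> t)) \<le> w t" "t \<in> space \<mu>" and z: "z \<in> \<Gamma> t"
      then have "\<Gamma> t \<in> cwk" "\<Gamma> (\<tau> t) \<in> cwk" using \<tau>(2)[of t] by (auto intro: cwk_value)
      then have *: "bounded (\<Gamma> t)" "\<Gamma> (\<tau> t) \<noteq> {}" by (auto intro: cwk_bounded dest: cwk_nonempty)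
      have "hausdorff_dist (\<Gamma> t) (\<Gamma> (\<tau> t)) < w t + 1" using t(1) by simp
      then obtain b where b: "b \<in> \<Gamma> (\<tau> t)" "dist z b < w t + 1"
        using hausdorff_dist_lessD[OF * _ z] by blast
      have "norm z \<le> norm b + dist z b" by (simp add: dist_norm norm_triangle_sub)
      also have "norm b \<le> max B 0" using b t by (intro B[of "\<tau> t"]) auto
      finally show "norm z \<le> w t + (max B 0 + 1)" using b(2) by simp
    qed
  qed
qed

end

section \<open>Effros measurability and density of selection integrals\<close>

text \<open>
  Monotone convergence; used whenever \<open>L\<^sup>1\<close>-estimates with geometric decay have to give convergence
  almost everywhere.
\<close>

lemma AE_summable_of_geometric_integrals:
  fixes w :: "nat \<Rightarrow> real \<Rightarrow> real"
  assumes int: "\<And>n. integrable \<mu> (w n)" and nonneg: "\<And>n t. 0 \<le> w n t"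
    and le: "\<And>n. (\<integral>t. w n t \<partial>\<mu>) \<le> c * (1/2) ^ n"
  shows "AE t in \<mu>. summable (\<lambda>n. w n t)"
    and "integrable \<mu> (\<lambda>t. \<Sum>n. w n t)" and "(\<integral>t. (\<Sum>n. w n t) \<partial>\<mu>) \<le> 2 * c"
proof -
  have geo: "summable (\<lambda>n. c * (1/2) ^ n :: real)" by (intro summable_mult summable_geometric) simp
  have sum_int: "summable (\<lambda>n. \<integral>t. w n t \<partial>\<mu>)"
    by (rule summable_comparison_test'[OF geo]) (use le nonneg in \<open>auto intro!: integral_nonneg_AE simp: abs_of_nonneg integral_nonneg\<close>)
  have "(\<integral>\<^sup>+t. (\<Sum>n. ennreal (w n t)) \<partial>\<mu>) = (\<Sum>n. \<integral>\<^sup>+t. ennreal (w n t) \<partial>\<mu>)"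
    using int by (intro nn_integral_suminf) auto
  also have "\<dots> = (\<Sum>n. ennreal (\<integral>t. w n t \<partial>\<mu>))"
    using int nonneg by (intro suminf_cong nn_integral_eq_integral) auto
  also have "\<dots> = ennreal (\<Sum>n. \<integral>t. w n t \<partial>\<mu>)"
    using nonneg by (intro suminf_ennreal2 sum_int integral_nonneg) auto
  finally have "(\<integral>\<^sup>+t. (\<Sum>n. ennreal (w n t)) \<partial>\<mu>) \<noteq> \<infinity>" by simp
  then have "AE t in \<mu>. (\<Sum>n. ennreal (w n t)) \<noteq> \<infinity>"
    using int by (intro nn_integral_noteq_infinite borel_measurable_suminf_order) auto
  then show sum: "AE t in \<mu>. summable (\<lambda>n. w n t)"
    by eventually_elim (intro summable_suminf_not_top nonneg, auto)
  have sum': "AE t in \<mu>. summable (\<lambda>n. norm (w n t))" "summable (\<lambda>n. \<integral>t. norm (w n t) \<partial>\<mu>)"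
    using sum sum_int nonneg by simp_all
  show "integrable \<mu> (\<lambda>t. \<Sum>n. w n t)" by (rule integrable_suminf[OF int sum'])
  have "(\<integral>t. (\<Sum>n. w n t) \<partial>\<mu>) = (\<Sum>n. \<integral>t. w n t \<partial>\<mu>)" by (rule integral_suminf[OF int sum'])
  also have "\<dots> \<le> (\<Sum>n. c * (1/2) ^ n)" by (intro suminf_le le sum_int geo)
  also have "\<dots> = 2 * c" by (simp add: suminf_mult suminf_geometric summable_geometric)
  finally show "(\<integral>t. (\<Sum>n. w n t) \<partial>\<mu>) \<le> 2 * c" .
qed

lemma simple_function_measurable_pred:
  "simple_function \<mu> f \<Longrightarrow> {t \<in> space \<mu>. P (f t)} \<in> sets \<mu>"
  by (rule predE) (rule measurable_compose[OF measurable_simple_function], auto)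

lemma simple_function_cell_index:
  assumes n: "0 < n" shows "simple_function \<mu> (cell_index n)"
  unfolding simple_function_def
proof (intro conjI ballI)
  have "cell_index n t \<le> n" if "t \<in> {0..1}" for t
  proof -
    have "real n * t \<le> real n" using that by (simp add: mult_left_le)
    then show ?thesis unfolding cell_index_def by linarith
  qed
  then have "cell_index n ` space \<mu> \<subseteq> {..n}" by auto
  then show "finite (cell_index n ` space \<mu>)" by (rule finite_subset) simp
  have "cell_index n \<in> measurable borel (count_space UNIV)"
    unfolding cell_index_def by measurable
  then have "cell_index n \<in> measurable \<mu> (count_space UNIV)"
    by (simp add: measurable_completion measurable_restrict_space1)
  then show "cell_index n -` {k} \<inter> space \<mu> \<in> sets \<mu>" for k by (rule measurable_sets) auto
qed

lemma integral_step_function: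
  fixes c :: "nat \<Rightarrow> real"
  assumes n: "0 < n" and f: "AE t in \<mu>. f t = c (cell_index n t)" and meas: "f \<in> borel_measurable \<mu>"
  shows "(\<integral>t. f t \<partial>\<mu>) = (\<Sum>i<n. c i / n)"
proof -
  let ?I = "\<lambda>i. {real i / real n ..< (real i + 1) / real n} \<inter> {0..1}"
  have int: "integrable \<mu> (indicator (?I i) :: real \<Rightarrow> real)" for i
    using half_open_cell_in_sets by (intro unit.integrable_const_bound[of _ 1]) (auto simp: indicator_def)
  have "(\<integral>t. f t \<partial>\<mu>) = (\<integral>t. (\<Sum>i<n. c i * indicator (?I i) t) \<partial>\<mu>)"
  proof (rule integral_cong_AE)
    show "AE t in \<mu>. f t = (\<Sum>i<n. c i * indicator (?I i) t)"
      using f AE_not_in_countable[of "{1}", simplified] AE_space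
    proof eventually_elim
      case (elim t)
      then show ?case
        using half_open_cells_indicator[OF n, of t c] by (simp add: indicator_inter_arith)
    qed
    show "(\<lambda>t. \<Sum>i<n. c i * indicator (?I i) t) \<in> borel_measurable \<mu>"
      using int by (intro borel_measurable_sum borel_measurable_times) auto
  qed fact
  also have "\<dots> = (\<Sum>i<n. \<integral>t. c i * indicator (?I i) t \<partial>\<mu>)"
    using int by (intro Bochner_Integration.integral_sum) auto
  also have "\<dots> = (\<Sum>i<n. c i / n)"
  proof (rule sum.cong)
    fix i assume i: "i \<in> {..<n}"
    then have "?I i = {real i / real n ..< (real i + 1) / real n}"
      using half_open_cell_subset[of i n] by auto
    then have "measure \<mu> (?I i) = 1 / n"
      using emeasure_half_open_cell[of i n] i by (simp add: measure_def)
    then show "(\<integral>t. c i * indicator (?I i) t \<partial>\<mu>) = c i / n"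
      using half_open_cell_in_sets[of "real i / real n" "(real i + 1) / real n"] by simp
  qed simp
  finally show ?thesis .
qed

context vM_multifunction
begin

lemma step_approximating_sequence:
  assumes "0 < \<eta>"
  obtains \<tau> w n s where
    "\<And>m::nat. simple_function \<mu> (\<tau> m)" "\<And>m t. t \<in> {0..1} \<Longrightarrow> \<tau> m t \<in> {0..1}"
    "\<And>m. integrable \<mu> (w m)" "\<And>m t. 0 \<le> w m t"
    "\<And>m. AE t in \<mu>. hausdorff_dist (\<Gamma> t) (\<Gamma> (\<tau> m t)) \<le> w m t"
    "\<And>m. (\<integral>t. w m t \<partial>\<mu>) \<le> 2 * \<eta> * (1/2) ^ m"
    "0 < n" "AE t in \<mu>. \<tau> 0 t = s (cell_index n t)"
    "\<And>x. x \<in> \<Phi> {0..1} \<Longrightarrow> \<exists>k. (\<forall>i<n. k i \<in> \<Gamma> (s i)) \<and> dist x (\<Sum>i<n. (1 / n) *\<^sub>R k i) < \<eta>"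
proof -
  define P where "P m = (\<lambda>(\<tau>, w, n, s). simple_function \<mu> \<tau> \<and> (\<forall>t\<in>{0..1}. \<tau> t \<in> {0..1}) \<and>
    integrable \<mu> w \<and> (\<forall>t. 0 \<le> w t) \<and> (AE t in \<mu>. hausdorff_dist (\<Gamma> t) (\<Gamma> (\<tau> t)) \<le> w t) \<and>
    (\<integral>t. w t \<partial>\<mu>) \<le> 2 * (\<eta> * (1/2) ^ m) \<and> 0 < n \<and> (AE t in \<mu>. \<tau> t = s (cell_index n t)) \<and>
    (\<forall>x\<in>\<Phi> {0..1}. \<exists>k. (\<forall>i<n. k i \<in> \<Gamma> (s i)) \<and> dist x (\<Sum>i<n. (1 / n) *\<^sub>R k i) < \<eta> * (1/2) ^ m))"
    for m :: nat
  have "\<exists>a. P m a" for m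
  proof -
    have "0 < \<eta> * (1/2) ^ m" using assms by simp
    then show ?thesis
    proof (rule step_approximation)
      fix \<tau> w n s
      assume "simple_function \<mu> \<tau>" "\<And>t. t \<in> {0..1} \<Longrightarrow> \<tau> t \<in> {0..1}"
        "integrable \<mu> w" "\<And>t. 0 \<le> w t" "AE t in \<mu>. hausdorff_dist (\<Gamma> t) (\<Gamma> (\<tau> t)) \<le> w t"
        "(\<integral>t. w t \<partial>\<mu>) \<le> 2 * (\<eta> * (1/2) ^ m)" "0 < n" "AE t in \<mu>. \<tau> t = s (cell_index n t)"
        "\<And>x. x \<in> \<Phi> {0..1} \<Longrightarrow>
          \<exists>k. (\<forall>i<n. k i \<in> \<Gamma> (s i)) \<and> dist x (\<Sum>i<n. (1 / n) *\<^sub>R k i) < \<eta> * (1/2) ^ m"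
      then have "P m (\<tau>, w, n, s)" unfolding P_def prod.case by blast
      then show ?thesis by blast
    qed
  qed
  then have "\<forall>m. \<exists>a. P m a" by blast
  from choice[OF this] obtain a where a: "\<And>m. P m (a m)" by blast
  define \<tau> w n s where "\<tau> m = fst (a m)" and "w m = fst (snd (a m))"
    and "n m = fst (snd (snd (a m)))" and "s m = snd (snd (snd (a m)))" for m
  have *: "P m (\<tau> m, w m, n m, s m)" for m using a[of m] by (simp add: \<tau>_def w_def n_def s_def)
  note * = this[unfolded P_def prod.case]
  show ?thesis
  proof (rule that[of \<tau> w "n 0" "s 0"])
    show "(\<integral>t. w m t \<partial>\<mu>) \<le> 2 * \<eta> * (1/2) ^ m" for m using *[of m] by (simp add: mult.assoc)
    show "\<exists>k. (\<forall>i<n 0. k i \<in> \<Gamma> (s 0 i)) \<and> dist x (\<Sum>i<n 0. (1 / n 0) *\<^sub>R k i) < \<eta>" if "x \<in> \<Phi> {0..1}" for x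
      using *[of 0] that by simp
  qed (use * in blast)+
qed

text \<open>
  If \<open>\<Gamma> t\<close> is the limit in the Hausdorff distance of \<open>\<Gamma> (\<tau> m t)\<close>, then it meets the open set \<open>U\<close> iff
  for some \<open>k\<close> the sets \<open>\<Gamma> (\<tau> m t)\<close> eventually meet \<open>V k\<close>, the set of points whose closed
  \<open>r k\<close>-ball lies in \<open>U\<close>. The latter condition only involves countably many simple functions.
\<close>

lemma Effros_measurable_multifunction: "Effros_measurable \<Gamma>"
  unfolding Effros_measurable_def
proof (intro allI impI)
  fix U :: "'a set" assume U: "open U"
  obtain \<tau> w where \<tau>: "\<And>m::nat. simple_function \<mu> (\<tau> m)" "\<And>m t. t \<in> {0..1} \<Longrightarrow> \<tau> m t \<in> {0..1}"
    and w: "\<And>m. integrable \<mu> (w m)" "\<And>m t. 0 \<le> w m t"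
      "\<And>m. AE t in \<mu>. hausdorff_dist (\<Gamma> t) (\<Gamma> (\<tau> m t)) \<le> w m t"
      "\<And>m. (\<integral>t. w m t \<partial>\<mu>) \<le> 2 * 1 * (1/2) ^ m"
    by (rule step_approximating_sequence[of 1]) (use zero_less_one in blast)+
  define r where "r k = 1 / real (Suc k)" for k
  have r: "0 < r k" for k by (simp add: r_def)
  define V where "V k = {x. cball x (r k) \<subseteq> U}" for k
  define A where "A = {t \<in> space \<mu>. \<exists>k N. \<forall>m\<ge>N. \<Gamma> (\<tau> m t) \<inter> V k \<noteq> {}}"
  have "{t \<in> space \<mu>. \<Gamma> (\<tau> m t) \<inter> V k \<noteq> {}} \<in> sets \<mu>" for m k
    by (rule simple_function_measurable_pred[OF \<tau>(1)])
  then have A: "A \<in> sets \<mu>" unfolding A_def by measurable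
  have "AE t in \<mu>. t \<in> A \<longleftrightarrow> t \<in> {t\<in>{0..1}. \<Gamma> t \<inter> U \<noteq> {}}"
  proof -
    have "AE t in \<mu>. \<forall>m. hausdorff_dist (\<Gamma> t) (\<Gamma> (\<tau> m t)) \<le> w m t"
      using w(3) by (simp add: AE_all_countable)
    moreover have "AE t in \<mu>. summable (\<lambda>m. w m t)"
      by (rule AE_summable_of_geometric_integrals(1)[OF w(1,2,4)])
    ultimately show ?thesis using AE_space
    proof eventually_elim
      case (elim t)
      then have t: "t \<in> {0..1}" by simp
      have cw: "\<Gamma> t \<in> cwk" "\<Gamma> (\<tau> m t) \<in> cwk" for m using t \<tau>(2)[OF t] by (auto intro: cwk_value)
      note bn = cwk_bounded[OF cw(1)] cwk_bounded[OF cw(2)] cwk_nonempty[OF cw(1)] cwk_nonempty[OF cw(2)]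
      have small: "\<exists>N. \<forall>m\<ge>N. hausdorff_dist (\<Gamma> t) (\<Gamma> (\<tau> m t)) < r k" for k
      proof -
        have "eventually (\<lambda>m. w m t < r k) sequentially"
          using summable_LIMSEQ_zero[OF elim(2)] r[of k] by (rule order_tendstoD)
        then show ?thesis using elim(1) by (auto simp: eventually_sequentially intro: order_le_less_trans)
      qed
      show ?case
      proof
        assume "t \<in> A"
        then obtain k N where N: "\<forall>m\<ge>N. \<Gamma> (\<tau> m t) \<inter> V k \<noteq> {}" by (auto simp: A_def)
        obtain M where M: "\<forall>m\<ge>M. hausdorff_dist (\<Gamma> t) (\<Gamma> (\<tau> m t)) < r k" using small by blast
        let ?m = "max N M"
        have "\<Gamma> (\<tau> ?m t) \<inter> V k \<noteq> {}" using N by simp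
        then obtain y where y: "y \<in> \<Gamma> (\<tau> ?m t)" "cball y (r k) \<subseteq> U" unfolding V_def by blast
        have "hausdorff_dist (\<Gamma> (\<tau> ?m t)) (\<Gamma> t) < r k"
          using M by (simp add: hausdorff_dist_commute)
        then obtain x where x: "x \<in> \<Gamma> t" "dist y x < r k"
          using hausdorff_dist_lessD[OF bn(2,3) _ y(1)] by blast
        then have "x \<in> U" using y(2) by (auto simp: subset_eq)
        then show "t \<in> {t\<in>{0..1}. \<Gamma> t \<inter> U \<noteq> {}}" using x t by auto
      next
        assume "t \<in> {t\<in>{0..1}. \<Gamma> t \<inter> U \<noteq> {}}"
        then obtain x where x: "x \<in> \<Gamma> t" "x \<in> U" by auto
        then obtain e where e: "0 < e" "ball x e \<subseteq> U" using U open_contains_ball by blast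
        obtain k where k: "r k < e / 2"
          using reals_Archimedean[of "e/2"] e by (auto simp: r_def inverse_eq_divide)
        obtain M where M: "\<forall>m\<ge>M. hausdorff_dist (\<Gamma> t) (\<Gamma> (\<tau> m t)) < r k" using small by blast
        have "\<Gamma> (\<tau> m t) \<inter> V k \<noteq> {}" if m: "m \<ge> M" for m
        proof -
          obtain y where y: "y \<in> \<Gamma> (\<tau> m t)" "dist x y < r k"
            using hausdorff_dist_lessD[OF bn(1,4) _ x(1)] M m by blast
          have "cball y (r k) \<subseteq> ball x e"
          proof
            fix z assume "z \<in> cball y (r k)"
            then show "z \<in> ball x e" using dist_triangle[of x z y] y(2) k by simp
          qed
          then have "cball y (r k) \<subseteq> U" using e(2) by (rule order_trans)
          then show ?thesis using y(1) unfolding V_def by blast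
        qed
        then show "t \<in> A" using t by (auto simp: A_def)
      qed
    qed
  qed
  then have "{t\<in>{0..1}. \<Gamma> t \<inter> U \<noteq> {}} \<in> sets \<mu>"
    by (rule unit.in_sets_AE[OF _ A]) auto
  then show "{t\<in>{0..1}. \<Gamma> t \<inter> U \<noteq> {}} \<in> sets lebesgue"
    by (subst (asm) sets_restrict_space_iff) auto
qed

lemma strongly_measurable_selection_integrable:
  assumes f: "strongly_measurable f" "selection_of f \<Gamma>"
  shows "integrable \<mu> (\<lambda>t. norm (f t))"
proof -
  obtain w where w: "integrable \<mu> w" "AE t in \<mu>. \<forall>z\<in>\<Gamma> t. norm z \<le> w t"
    by (rule integrably_bounded) (rule that; assumption)
  show ?thesis
  proof (rule integrable_bounded_by[OF w(1) strongly_measurable_norm[OF f(1)]])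
    show "AE t in \<mu>. \<bar>norm (f t)\<bar> \<le> w t"
      using w(2) AE_space by eventually_elim (use f(2) in \<open>auto simp: selection_of_def\<close>)
  qed
qed

text \<open>
  A Riemann sum near \<open>x\<close> is the integral of a simple selection \<open>f 0\<close> of the first step approximation.
  Given \<open>f m\<close>, a nearly closest point in the next approximation is chosen. The choice depends only on
  the values of two simple functions, so \<open>f (Suc m)\<close> is simple, and the steps are dominated by
  functions with geometrically decaying integrals. The limit is a selection of \<open>\<Gamma>\<close> almost
  everywhere, at a small \<open>L\<^sup>1\<close>-distance from \<open>f 0\<close>.
\<close>

lemma Bochner_selections_dense:
  assumes x: "x \<in> \<Phi> {0..1}" and e: "0 < e"
  obtains f z where "selection_of f \<Gamma>" "has_Bochner_integral_01 f z" "dist x z < e"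
proof -
  \<comment> \<open>The total error is \<open>\<eta>\<close> for the Riemann sum plus \<open>2 * (4 * \<eta>)\<close> for the steps, hence below \<open>e\<close>.\<close>
  define \<eta> where "\<eta> = e / 10"
  have \<eta>: "0 < \<eta>" using e by (simp add: \<eta>_def)
  obtain \<tau> w n s where \<tau>: "\<And>m::nat. simple_function \<mu> (\<tau> m)" "\<And>m t. t \<in> {0..1} \<Longrightarrow> \<tau> m t \<in> {0..1}"
    and w: "\<And>m. integrable \<mu> (w m)" "\<And>m t. 0 \<le> w m t"
      "\<And>m. AE t in \<mu>. hausdorff_dist (\<Gamma> t) (\<Gamma> (\<tau> m t)) \<le> w m t"
      "\<And>m. (\<integral>t. w m t \<partial>\<mu>) \<le> 2 * \<eta> * (1/2) ^ m"
    and n: "0 < n" and \<tau>0: "AE t in \<mu>. \<tau> 0 t = s (cell_index n t)"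
    and near: "\<And>x. x \<in> \<Phi> {0..1} \<Longrightarrow> \<exists>k. (\<forall>i<n. k i \<in> \<Gamma> (s i)) \<and> dist x (\<Sum>i<n. (1 / n) *\<^sub>R k i) < \<eta>"
    by (rule step_approximating_sequence[OF \<eta>]) (rule that; assumption)
  obtain k where k: "\<forall>i<n. k i \<in> \<Gamma> (s i)" "dist x (\<Sum>i<n. (1 / n) *\<^sub>R k i) < \<eta>"
    using near[OF x] by blast
  define start where "start r i = (if i < n \<and> r = s i then k i else (SOME z. z \<in> \<Gamma> r))" for r i
  define pick where "pick m y r = (SOME z. z \<in> \<Gamma> r \<and> dist y z < infdist y (\<Gamma> r) + \<eta> * (1/2) ^ m)" for m :: nat and y r
  define f where "f = rec_nat (\<lambda>t. start (\<tau> 0 t) (cell_index n t)) (\<lambda>m g t. pick m (g t) (\<tau> (Suc m) t))"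
  have f_0: "f 0 = (\<lambda>t. start (\<tau> 0 t) (cell_index n t))"
    and f_Suc: "f (Suc m) = (\<lambda>t. pick m (f m t) (\<tau> (Suc m) t))" for m by (simp_all add: f_def)
  have simple: "simple_function \<mu> (f m)" for m
  proof (induction m)
    case 0
    show ?case unfolding f_0 by (rule simple_function_compose2[OF \<tau>(1) simple_function_cell_index[OF n]])
  next
    case (Suc m)
    show ?case unfolding f_Suc by (rule simple_function_compose2[OF Suc \<tau>(1)])
  qed
  have ne: "\<Gamma> (\<tau> m t) \<noteq> {}" if "t \<in> {0..1}" for m t
    by (rule cwk_nonempty[OF cwk_value[OF \<tau>(2)[OF that]]])
  have pick: "pick m y r \<in> \<Gamma> r \<and> dist y (pick m y r) < infdist y (\<Gamma> r) + \<eta> * (1/2) ^ m" if "\<Gamma> r \<noteq> {}" for m y r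
  proof -
    have "infdist y (\<Gamma> r) < infdist y (\<Gamma> r) + \<eta> * (1/2) ^ m" using \<eta> by simp
    from infdist_lessD[OF this that] show ?thesis unfolding pick_def by (metis (mono_tags, lifting) someI)
  qed
  have f_in: "f m t \<in> \<Gamma> (\<tau> m t)" if t: "t \<in> {0..1}" for m t
  proof (cases m)
    case 0
    have "(SOME z. z \<in> \<Gamma> (\<tau> 0 t)) \<in> \<Gamma> (\<tau> 0 t)" using ne[OF t] by (rule some_in_eq[THEN iffD2])
    then show ?thesis using k(1) 0 by (auto simp: f_0 start_def)
  next
    case (Suc m')
    then show ?thesis using pick[OF ne[OF t]] by (simp add: f_Suc)
  qed
  define u where "u m t = w m t + w (Suc m) t + \<eta> * (1/2) ^ m" for m t
  have u: "integrable \<mu> (u m)" "0 \<le> u m t" for m t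
    unfolding u_def using w(1,2) \<eta> by (auto intro!: add_nonneg_nonneg)
  have u_le: "(\<integral>t. u m t \<partial>\<mu>) \<le> (4 * \<eta>) * (1/2) ^ m" for m
  proof -
    have "(\<integral>t. u m t \<partial>\<mu>) = (\<integral>t. w m t \<partial>\<mu>) + (\<integral>t. w (Suc m) t \<partial>\<mu>) + \<eta> * (1/2) ^ m"
      unfolding u_def using w(1) by (simp add: measure_unit)
    then show ?thesis using w(4)[of m] w(4)[of "Suc m"] by simp
  qed
  note sum_u = AE_summable_of_geometric_integrals[OF u u_le]
  note sum_w = AE_summable_of_geometric_integrals(1)[OF w(1,2,4)]
  have all: "AE t in \<mu>. \<forall>m. hausdorff_dist (\<Gamma> t) (\<Gamma> (\<tau> m t)) \<le> w m t"
    using w(3) by (simp add: AE_all_countable)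
  define f' where "f' t = lim (\<lambda>m. f m t)" for t
  have main: "AE t in \<mu>. (\<lambda>m. f m t) \<longlonglongrightarrow> f' t \<and> f' t \<in> \<Gamma> t \<and> norm (f' t - f 0 t) \<le> (\<Sum>m. u m t)"
    using sum_u(1) sum_w all AE_space
  proof eventually_elim
    case (elim t)
    then have t: "t \<in> {0..1}" by simp
    have cw: "\<Gamma> t \<in> cwk" "\<Gamma> (\<tau> m t) \<in> cwk" for m using t \<tau>(2)[OF t] by (auto intro: cwk_value)
    note bn = cwk_bounded[OF cw(1)] cwk_bounded[OF cw(2)] cwk_nonempty[OF cw(1)] cwk_nonempty[OF cw(2)]
    have step: "norm (f (Suc m) t - f m t) \<le> u m t" for m
    proof -
      have "dist (f m t) (f (Suc m) t) \<le> infdist (f m t) (\<Gamma> (\<tau> (Suc m) t)) + \<eta> * (1/2) ^ m"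
        using pick[OF bn(4)[of "Suc m"], where y="f m t" and m=m] by (simp add: f_Suc)
      also have "infdist (f m t) (\<Gamma> (\<tau> (Suc m) t)) \<le> hausdorff_dist (\<Gamma> (\<tau> m t)) (\<Gamma> (\<tau> (Suc m) t))"
        by (intro infdist_le_hausdorff_dist bn f_in t)
      also have "\<dots> \<le> hausdorff_dist (\<Gamma> (\<tau> m t)) (\<Gamma> t) + hausdorff_dist (\<Gamma> t) (\<Gamma> (\<tau> (Suc m) t))"
        by (intro hausdorff_dist_triangle bn)
      also have "\<dots> \<le> w m t + w (Suc m) t"
        using elim(3) by (intro add_mono) (auto simp: hausdorff_dist_commute[of _ "\<Gamma> t"])
      finally show ?thesis by (simp add: u_def dist_norm norm_minus_commute)
    qed
    have sum_step: "summable (\<lambda>m. norm (f (Suc m) t - f m t))"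
      by (rule summable_comparison_test'[OF elim(1)]) (simp add: step)
    have "(\<lambda>M. \<Sum>m<M. f (Suc m) t - f m t) \<longlonglongrightarrow> (\<Sum>m. f (Suc m) t - f m t)"
      by (rule summable_LIMSEQ[OF summable_norm_cancel[OF sum_step]])
    then have "(\<lambda>M. f M t - f 0 t) \<longlonglongrightarrow> (\<Sum>m. f (Suc m) t - f m t)"
      by (simp add: sum_lessThan_telescope[of "\<lambda>m. f m t"])
    then have lim: "(\<lambda>M. f M t) \<longlonglongrightarrow> f 0 t + (\<Sum>m. f (Suc m) t - f m t)"
      by (auto dest: tendsto_add[OF tendsto_const[of "f 0 t"]])
    then have f'_eq: "f' t = f 0 t + (\<Sum>m. f (Suc m) t - f m t)" unfolding f'_def by (rule limI)
    have "norm (f' t - f 0 t) \<le> (\<Sum>m. norm (f (Suc m) t - f m t))"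
      unfolding f'_eq using summable_norm[OF sum_step] by simp
    also have "\<dots> \<le> (\<Sum>m. u m t)" by (intro suminf_le step sum_step elim)
    finally have 3: "norm (f' t - f 0 t) \<le> (\<Sum>m. u m t)" .
    have "infdist (f' t) (\<Gamma> t) \<le> 0"
    proof (rule LIMSEQ_le)
      show "(\<lambda>m. infdist (f m t) (\<Gamma> t)) \<longlonglongrightarrow> infdist (f' t) (\<Gamma> t)"
        using lim unfolding f'_eq by (intro tendsto_infdist)
      show "(\<lambda>m. w m t) \<longlonglongrightarrow> 0" by (rule summable_LIMSEQ_zero[OF elim(2)])
      have "infdist (f m t) (\<Gamma> t) \<le> w m t" for m
      proof -
        have "infdist (f m t) (\<Gamma> t) \<le> hausdorff_dist (\<Gamma> (\<tau> m t)) (\<Gamma> t)"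
          by (intro infdist_le_hausdorff_dist bn f_in t)
        then show ?thesis using elim(3) by (auto simp: hausdorff_dist_commute[of _ "\<Gamma> t"] intro: order_trans)
      qed
      then show "\<exists>N. \<forall>m\<ge>N. infdist (f m t) (\<Gamma> t) \<le> w m t" by blast
    qed
    then have "f' t \<in> \<Gamma> t"
      using cwk_closed[OF cw(1)] bn(3) infdist_nonneg[of "f' t" "\<Gamma> t"] by (simp add: in_closed_iff_infdist_zero)
    then show ?case using lim 3 by (simp add: f'_eq)
  qed
  \<comment> \<open>On the exceptional null set any point of \<open>\<Gamma> t\<close> will do.\<close>
  define h where "h t = (if f' t \<in> \<Gamma> t then f' t else (SOME z. z \<in> \<Gamma> t))" for t
  have h_eq: "AE t in \<mu>. f' t = h t" using main by eventually_elim (simp add: h_def)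
  have h_sel: "selection_of h \<Gamma>"
    unfolding selection_of_def h_def using cwk_nonempty[OF cwk_value] by (auto simp: some_in_eq)
  have "strongly_measurable f'"
    unfolding strongly_measurable_def using simple main by (intro exI[of _ f]) auto
  then have h_sm: "strongly_measurable h" using h_eq by (rule strongly_measurable_cong_AE)
  obtain z where z: "has_Bochner_integral_01 h z"
    using Bochner_integral_exists[OF h_sm strongly_measurable_selection_integrable[OF h_sm h_sel]] by metis
  have f0_sm: "strongly_measurable (f 0)" by (rule strongly_measurable_simple[OF simple])
  have f0_int: "has_Bochner_integral_01 (f 0) (\<Sum>i<n. (1 / n) *\<^sub>R k i)"
    unfolding has_Bochner_integral_01_iff
  proof (intro conjI allI f0_sm integrable_norm_simple simple)
    fix g :: "'a \<Rightarrow>\<^sub>L real"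
    have "(\<integral>t. g (f 0 t) \<partial>\<mu>) = (\<Sum>i<n. g (k i) / n)"
    proof (rule integral_step_function[OF n])
      show "AE t in \<mu>. g (f 0 t) = g (k (cell_index n t))"
        using \<tau>0 AE_not_in_countable[of "{1}", simplified] AE_space
      proof eventually_elim
        case (elim t)
        then show ?case using cell_index(1)[OF n, of t] by (simp add: f_0 start_def)
      qed
    qed (rule strongly_measurable_blinfun[OF f0_sm])
    then show "(\<integral>t. g (f 0 t) \<partial>\<mu>) = blinfun_apply g (\<Sum>i<n. (1 / real n) *\<^sub>R k i)"
      by (simp add: blinfun.sum_right blinfun.scaleR_right)
  qed
  have "norm (z - (\<Sum>i<n. (1 / n) *\<^sub>R k i)) \<le> (\<integral>t. norm (h t - f 0 t) \<partial>\<mu>)"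
    by (rule norm_has_Bochner_integral_diff_le[OF z f0_int])
  also have "\<dots> \<le> (\<integral>t. (\<Sum>m. u m t) \<partial>\<mu>)"
  proof (rule integral_mono_AE)
    show "integrable \<mu> (\<lambda>t. norm (h t - f 0 t))"
      by (intro integrable_norm_diff h_sm strongly_measurable_selection_integrable h_sel f0_sm integrable_norm_simple simple)
    show "AE t in \<mu>. norm (h t - f 0 t) \<le> (\<Sum>m. u m t)"
      using main h_eq by eventually_elim simp
  qed (rule sum_u(2))
  also have "\<dots> \<le> 8 * \<eta>" using sum_u(3) by simp
  finally have "dist z (\<Sum>i<n. (1 / n) *\<^sub>R k i) \<le> 8 * \<eta>" by (simp add: dist_norm)
  then have "dist x z < e"
    using k(2) dist_triangle2[of x z "\<Sum>i<n. (1 / n) *\<^sub>R k i"] \<eta> unfolding \<eta>_def by linarith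
  with h_sel z show ?thesis by (rule that)
qed

end

section \<open>Bochner integrable functions are variationally McShane integrable\<close>

text \<open>
  Outer regularity makes the difference set small in measure. Splitting \<open>h\<close> at a height \<open>M\<close> above
  which its integral is small then makes the integral over the difference set small.
\<close>

lemma exists_open_superset_small_integral:
  fixes h :: "real \<Rightarrow> real"
  assumes h: "integrable \<mu> h" "\<And>t. 0 \<le> h t" and E: "E \<in> sets \<mu>" and e: "0 < e"
  obtains U where "open U" "E \<subseteq> U" "(\<integral>t. indicator (U - E) t * h t \<partial>\<mu>) < e"
proof -
  have [measurable]: "h \<in> borel_measurable \<mu>" using h(1) by auto
  have "(\<lambda>n. \<integral>t. h t - min (h t) (real n) \<partial>\<mu>) \<longlonglongrightarrow> (\<integral>t. 0 \<partial>\<mu>)"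
  proof (rule integral_dominated_convergence[where w=h])
    show "AE t in \<mu>. (\<lambda>n. h t - min (h t) (real n)) \<longlonglongrightarrow> 0"
    proof (intro AE_I2)
      fix t
      obtain N :: nat where "h t \<le> real N" using real_arch_simple by blast
      then have "\<forall>n\<ge>N. h t - min (h t) (real n) = 0" by (auto simp: min_def)
      then have "eventually (\<lambda>n. h t - min (h t) (real n) = 0) sequentially" unfolding eventually_sequentially by blast
      then show "(\<lambda>n. h t - min (h t) (real n)) \<longlonglongrightarrow> 0" by (rule tendsto_eventually)
    qed
    show "AE t in \<mu>. norm (h t - min (h t) (real n)) \<le> h t" for n
      using h(2) by (intro AE_I2) (auto simp: min_def)
  qed (use h in auto)
  then have "eventually (\<lambda>n. (\<integral>t. h t - min (h t) (real n) \<partial>\<mu>) < e / 2) sequentially"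
    using e by (intro order_tendstoD) auto
  then obtain M :: nat where M: "(\<integral>t. h t - min (h t) (real M) \<partial>\<mu>) < e / 2"
    by (auto simp: eventually_sequentially)
  have E_leb: "E \<in> sets lebesgue" and E01: "E \<subseteq> {0..1}"
    using E by (simp_all add: sets_restrict_space_iff)
  have e': "0 < e / (2 * (real M + 1))" using e by simp
  obtain U where U: "open U" "E \<subseteq> U" "U - E \<in> lmeasurable" "emeasure lebesgue (U - E) < ennreal (e / (2 * (real M + 1)))"
    using sets_lebesgue_outer_open[OF E_leb e'] by blast
  have UE [measurable]: "(U - E) \<inter> {0..1} \<in> sets \<mu>"
    using sets.Int[OF fmeasurableD[OF U(3)], of "{0..1}"] by (simp add: sets_restrict_space_iff)
  have "emeasure \<mu> ((U - E) \<inter> {0..1}) = emeasure lebesgue ((U - E) \<inter> {0..1})"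
    by (rule emeasure_restrict_space) auto
  also have "\<dots> \<le> emeasure lebesgue (U - E)"
    by (rule emeasure_mono[OF Int_lower1 fmeasurableD[OF U(3)]])
  also have "\<dots> < ennreal (e / (2 * (real M + 1)))" by (rule U)
  finally have small: "measure \<mu> ((U - E) \<inter> {0..1}) < e / (2 * (real M + 1))"
    using e' by (simp add: unit.emeasure_eq_measure ennreal_less_iff)
  have int_ind: "integrable \<mu> (indicator ((U - E) \<inter> {0..1}) :: real \<Rightarrow> real)"
    by (intro unit.integrable_const_bound[of _ 1]) (auto simp: indicator_def)
  have "(\<integral>t. indicator (U - E) t * h t \<partial>\<mu>) = (\<integral>t. indicator ((U - E) \<inter> {0..1}) t * h t \<partial>\<mu>)"
    by (intro Bochner_Integration.integral_cong) (auto simp: indicator_def)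
  also have "\<dots> \<le> (\<integral>t. (h t - min (h t) (real M)) + real M * indicator ((U - E) \<inter> {0..1}) t \<partial>\<mu>)"
  proof (rule integral_mono)
    show "integrable \<mu> (\<lambda>t. indicator ((U - E) \<inter> {0..1}) t * h t)"
    proof (rule integrable_bounded_by[OF h(1)])
      show "(\<lambda>t. indicator ((U - E) \<inter> {0..1}) t * h t) \<in> borel_measurable \<mu>" by measurable
    qed (use h(2) in \<open>auto simp: indicator_def\<close>)
    show "integrable \<mu> (\<lambda>t. (h t - min (h t) (real M)) + real M * indicator ((U - E) \<inter> {0..1}) t)"
      using h(1) int_ind by (intro Bochner_Integration.integrable_add Bochner_Integration.integrable_diff integrable_min
          integrable_mult_right) auto
    show "indicator ((U - E) \<inter> {0..1}) t * h t
        \<le> (h t - min (h t) (real M)) + real M * indicator ((U - E) \<inter> {0..1}) t" for t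
      using h(2)[of t] by (auto simp: indicator_def min_def)
  qed
  also have "\<dots> = (\<integral>t. h t - min (h t) (real M) \<partial>\<mu>) + real M * measure \<mu> ((U - E) \<inter> {0..1})"
    using h(1) int_ind
    by (subst Bochner_Integration.integral_add) (auto intro!: integrable_min)
  also have "\<dots> < e / 2 + (real M + 1) * (e / (2 * (real M + 1)))"
    using small by (intro add_less_le_mono[OF M] mult_mono) auto
  also have "\<dots> = e" by (simp add: field_simps)
  finally show ?thesis using U by (intro that) auto
qed

text \<open>
  Almost every value lies within \<open>\<eta> / 2\<close> of one of the points of a sequence \<open>d\<close>; the preimages of
  the balls around these points are the sets of even index. The remaining null set, on which the
  function may be unbounded, is cut into the pieces where it is bounded by \<open>k\<close>; these are the sets of
  odd index, for which the oscillation condition holds vacuously almost everywhere.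
\<close>

lemma exists_small_oscillation_cover:
  fixes f :: "real \<Rightarrow> 'a::real_normed_vector"
  assumes f: "strongly_measurable f" and \<eta>: "0 < \<eta>"
  obtains E :: "nat \<Rightarrow> real set" and b :: "nat \<Rightarrow> real" where
    "\<And>k. E k \<in> sets \<mu>" "{0..1} \<subseteq> (\<Union>k. E k)" "\<And>k t. t \<in> E k \<Longrightarrow> norm (f t) \<le> b k"
    "\<And>k t. t \<in> E k \<Longrightarrow> AE s in \<mu>. s \<in> E k \<longrightarrow> norm (f s - f t) \<le> \<eta>"
proof -
  obtain d :: "nat \<Rightarrow> 'a" where d: "AE t in \<mu>. f t \<in> closure (range d)"
    using strongly_measurable_imp_separably_valued[OF f] .
  define G where "G = {t \<in> space \<mu>. f t \<in> closure (range d)}"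
  have null: "{t \<in> space \<mu>. f t \<notin> closure (range d)} \<in> null_sets \<mu>"
    using d by (simp add: unit.AE_iff_null_sets)
  have "space \<mu> - {t \<in> space \<mu>. f t \<notin> closure (range d)} \<in> sets \<mu>" using null by blast
  also have "space \<mu> - {t \<in> space \<mu>. f t \<notin> closure (range d)} = G" by (auto simp: G_def)
  finally have G: "G \<in> sets \<mu>" .
  define A where "A k = G \<inter> {t \<in> space \<mu>. norm (f t - d k) \<le> \<eta> / 2}" for k
  define N where "N k = {t \<in> space \<mu>. f t \<notin> closure (range d) \<and> norm (f t) \<le> real k}" for k
  define E where "E k = (if even k then A (k div 2) else N (k div 2))" for k
  define b where "b k = (if even k then norm (d (k div 2)) + \<eta> else real (k div 2))" for k
  have A_sets: "A k \<in> sets \<mu>" for k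
  proof -
    have "(\<lambda>t. norm (f t - d k)) \<in> borel_measurable \<mu>"
      by (intro strongly_measurable_norm strongly_measurable_diff f strongly_measurable_const)
    then have "{t \<in> space \<mu>. norm (f t - d k) \<le> \<eta> / 2} \<in> sets \<mu>" by measurable
    then show ?thesis using G by (simp add: A_def sets.Int)
  qed
  have N_null: "N k \<in> null_sets \<mu>" for k
    by (rule unit.complete2[OF _ null]) (auto simp: N_def)
  show ?thesis
  proof (rule that[of E b])
    show "E k \<in> sets \<mu>" for k using A_sets N_null by (auto simp: E_def)
    show "{0..1} \<subseteq> (\<Union>k. E k)"
    proof
      fix t :: real assume t: "t \<in> {0..1}"
      show "t \<in> (\<Union>k. E k)"
      proof (cases "f t \<in> closure (range d)")
        case True
        then obtain k where "dist (d k) (f t) < \<eta> / 2"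
          using half_gt_zero[OF \<eta>] unfolding closure_approachable by blast
        then have "norm (f t - d k) \<le> \<eta> / 2" by (simp add: dist_norm norm_minus_commute)
        then have "t \<in> E (2 * k)" using True t by (simp add: E_def A_def G_def)
        then show ?thesis by blast
      next
        case False
        obtain k :: nat where "norm (f t) \<le> real k" using real_arch_simple by blast
        then have "t \<in> E (2 * k + 1)" using False t by (simp add: E_def N_def)
        then show ?thesis by blast
      qed
    qed
    show "norm (f t) \<le> b k" if "t \<in> E k" for t k
    proof (cases "even k")
      case True
      then have "norm (f t - d (k div 2)) \<le> \<eta> / 2" using that by (simp add: E_def A_def)
      then show ?thesis using True norm_triangle_sub[of "f t" "d (k div 2)"] \<eta> by (simp add: b_def)
    next
      case False
      then show ?thesis using that by (simp add: E_def N_def b_def)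
    qed
    show "AE s in \<mu>. s \<in> E k \<longrightarrow> norm (f s - f t) \<le> \<eta>" if "t \<in> E k" for t k
    proof (cases "even k")
      case True
      let ?d = "d (k div 2)"
      have t: "norm (f t - ?d) \<le> \<eta> / 2" using that True by (simp add: E_def A_def)
      show ?thesis
      proof (intro AE_I2 impI)
        fix s assume "s \<in> E k"
        then have "norm (f s - ?d) \<le> \<eta> / 2" using True by (simp add: E_def A_def)
        then show "norm (f s - f t) \<le> \<eta>"
          using t norm_triangle_ineq4[of "f s - ?d" "f t - ?d"] by simp
      qed
    next
      case False
      then show ?thesis using AE_not_in[OF N_null[of "k div 2"]] by (simp add: E_def) (auto elim: eventually_mono)
    qed
  qed
qed

lemma closed_subintervals_in_sets: "I \<in> closed_subintervals \<Longrightarrow> I \<in> sets \<mu>"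
  by (auto simp: closed_subintervals_def sets_restrict_space_iff)

lemma AE_not_in_both:
  assumes "I \<in> closed_subintervals" "J \<in> closed_subintervals" "interior I \<inter> interior J = {}"
  shows "AE t in \<mu>. \<not> (t \<in> I \<and> t \<in> J)"
proof -
  obtain a b c d where IJ: "I = {a..b}" "J = {c..d}" "a < b" "c < d"
    using assms by (auto simp: closed_subintervals_def)
  have "AE t in \<mu>. t \<notin> {a, b, c, d}" by (rule AE_not_in_countable) simp
  then show ?thesis
  proof eventually_elim
    case (elim t)
    then have "t \<in> interior I \<inter> interior J" if "t \<in> I" "t \<in> J" using that by (auto simp: IJ)
    then show ?case using assms(3) by blast
  qed
qed

lemma simple_function_indicator_scaleR:
  assumes "I \<in> sets \<mu>"
  shows "simple_function \<mu> (\<lambda>s. indicator I s *\<^sub>R (c :: 'a::real_normed_vector))"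
proof -
  have "simple_function \<mu> (indicator I :: real \<Rightarrow> real)" using assms by (rule simple_function_indicator)
  from simple_function_compose1[OF this, of "\<lambda>r. r *\<^sub>R c"] show ?thesis .
qed

lemma has_Bochner_integral_indicator:
  fixes c :: "'a::banach"
  assumes I: "I \<in> sets \<mu>"
  shows "has_Bochner_integral_01 (\<lambda>s. indicator I s *\<^sub>R c) (measure \<mu> I *\<^sub>R c)"
  unfolding has_Bochner_integral_01_iff
proof (intro conjI allI strongly_measurable_simple integrable_norm_simple simple_function_indicator_scaleR I)
  fix g :: "'a \<Rightarrow>\<^sub>L real"
  have "(\<integral>t. indicator I t * blinfun_apply g c \<partial>\<mu>) = measure \<mu> I * blinfun_apply g c"
    using I sets.sets_into_space[OF I] by (simp add: Int_absorb2)
  then show "(\<integral>t. blinfun_apply g (indicator I t *\<^sub>R c) \<partial>\<mu>) = blinfun_apply g (measure \<mu> I *\<^sub>R c)"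
    by (simp add: blinfun.scaleR_right)
qed

lemma has_Bochner_integral_unique:
  fixes f :: "real \<Rightarrow> 'a::banach"
  assumes "has_Bochner_integral_01 f x" "has_Bochner_integral_01 f y"
  shows "x = y"
  using norm_has_Bochner_integral_diff_le[OF assms] by simp

lemma has_Bochner_integral_cong_AE:
  fixes f h :: "real \<Rightarrow> 'a::banach"
  assumes f: "has_Bochner_integral_01 f x" and eq: "AE t in \<mu>. f t = h t"
  shows "has_Bochner_integral_01 h x"
proof -
  note F = has_Bochner_integral_01_D[OF f]
  have h: "strongly_measurable h" using F(1) eq by (rule strongly_measurable_cong_AE)
  have "integrable \<mu> (\<lambda>t. norm (h t))"
  proof (rule integrable_bounded_by[OF F(2) strongly_measurable_norm[OF h]])
    show "AE t in \<mu>. \<bar>norm (h t)\<bar> \<le> norm (f t)" using eq by eventually_elim simp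
  qed
  moreover have "(\<integral>t. g (h t) \<partial>\<mu>) = g x" for g :: "'a \<Rightarrow>\<^sub>L real"
  proof -
    have "(\<integral>t. g (h t) \<partial>\<mu>) = (\<integral>t. g (f t) \<partial>\<mu>)"
    proof (rule integral_cong_AE)
      show "AE t in \<mu>. blinfun_apply g (h t) = blinfun_apply g (f t)" using eq by eventually_elim simp
    qed (intro strongly_measurable_blinfun F h)+
    then show ?thesis by (simp add: F(3))
  qed
  ultimately show ?thesis using h by (simp add: has_Bochner_integral_01_iff)
qed

lemma has_Bochner_integral_restrict:
  fixes f :: "real \<Rightarrow> 'a::banach"
  assumes f: "strongly_measurable f" "integrable \<mu> (\<lambda>t. norm (f t))" and I: "I \<in> sets \<mu>"
  obtains x where "has_Bochner_integral_01 (\<lambda>t. indicator I t *\<^sub>R f t) x"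
proof (rule Bochner_integral_exists)
  have "simple_function \<mu> (indicator I :: real \<Rightarrow> real)" using I by (rule simple_function_indicator)
  then have "strongly_measurable (indicator I :: real \<Rightarrow> real)" by (rule strongly_measurable_simple)
  then show sm: "strongly_measurable (\<lambda>t. indicator I t *\<^sub>R f t)"
    by (rule strongly_measurable_continuous2[OF _ f(1)]) (auto intro!: continuous_intros simp: split_beta)
  show "integrable \<mu> (\<lambda>t. norm (indicator I t *\<^sub>R f t))"
    by (rule integrable_bounded_by[OF f(2) strongly_measurable_norm[OF sm]]) (auto simp: indicator_def)
qed (rule that)

text \<open>
  At most one interval \<open>I\<close> contains the point \<open>s\<close>. With its tag \<open>t\<close> in \<open>E (k t)\<close>, either \<open>s\<close> is in
  the same set and the oscillation bound applies, or \<open>s\<close> lies in \<open>U (k t) - E (k t)\<close>.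
\<close>

lemma sum_oscillation_le:
  fixes f :: "real \<Rightarrow> 'a::real_normed_vector" and P :: "(real set \<times> real) set"
  assumes P: "finite P" and k: "\<And>I t. (I, t) \<in> P \<Longrightarrow> t \<in> E (k t) \<and> I \<subseteq> U (k t)"
    and b: "\<And>k t. t \<in> E k \<Longrightarrow> norm (f t) \<le> b k" and \<eta>: "0 \<le> \<eta>"
    and disj: "\<And>p q. p \<in> P \<Longrightarrow> q \<in> P \<Longrightarrow> s \<in> fst p \<Longrightarrow> s \<in> fst q \<Longrightarrow> p = q"
    and osc: "\<And>I t. (I, t) \<in> P \<Longrightarrow> s \<in> E (k t) \<longrightarrow> norm (f s - f t) \<le> \<eta>"
  shows "(\<Sum>(I, t)\<in>P. norm (indicator I s *\<^sub>R f s - indicator I s *\<^sub>R f t))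
    \<le> \<eta> + (\<Sum>j\<in>k ` snd ` P. indicator (U j - E j) s * (norm (f s) + \<bar>b j\<bar>))" (is "?L \<le> \<eta> + ?R")
proof (cases "\<exists>p\<in>P. s \<in> fst p")
  case False
  then have "?L = 0" by (intro sum.neutral) (auto simp: indicator_def)
  moreover have "0 \<le> ?R" by (intro sum_nonneg) auto
  ultimately show ?thesis using \<eta> by simp
next
  case True
  then obtain I t where p: "(I, t) \<in> P" "s \<in> I" by auto
  have "?L = (\<Sum>p\<in>P. if p = (I, t) then norm (f s - f t) else 0)"
  proof (rule sum.cong)
    fix q assume q: "q \<in> P"
    obtain J r where q_eq: "q = (J, r)" by (cases q)
    have "s \<notin> J" if "q \<noteq> (I, t)"
    proof
      assume "s \<in> J"
      then have "(I, t) = q" by (intro disj[OF p(1) q]) (simp_all add: p(2) q_eq)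
      then show False using that by simp
    qed
    then show "(case q of (I, t) \<Rightarrow> norm (indicator I s *\<^sub>R f s - indicator I s *\<^sub>R f t))
        = (if q = (I, t) then norm (f s - f t) else 0)"
      using p(2) q_eq by (cases "q = (I, t)") auto
  qed simp
  also have "\<dots> = norm (f s - f t)" using P p by simp
  finally have L: "?L = norm (f s - f t)" .
  show ?thesis
  proof (cases "s \<in> E (k t)")
    case True
    moreover have "0 \<le> ?R" by (intro sum_nonneg) auto
    ultimately show ?thesis using osc[OF p(1)] unfolding L by simp
  next
    case False
    have "norm (f s - f t) \<le> norm (f s) + norm (f t)" by (rule norm_triangle_ineq4)
    also have "norm (f t) \<le> \<bar>b (k t)\<bar>" using b[of t "k t"] k[OF p(1)] by simp
    also have "norm (f s) + \<bar>b (k t)\<bar> = indicator (U (k t) - E (k t)) s * (norm (f s) + \<bar>b (k t)\<bar>)"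
      using False k[OF p(1)] p(2) by auto
    also have "\<dots> \<le> ?R"
    proof (rule member_le_sum)
      show "k t \<in> k ` snd ` P" using p(1) by (intro imageI) (rule image_eqI[of _ _ "(I, t)"], simp_all)
    qed (use P in auto)
    finally show ?thesis using \<eta> unfolding L by simp
  qed
qed

text \<open>
  The gauge at \<open>t \<in> E (k t)\<close> keeps intervals inside an open \<open>U (k t)\<close> that exceeds \<open>E (k t)\<close> so little
  that the integrals over all the differences sum up to at most \<open>2 * \<eta>\<close>.
\<close>

theorem Bochner_imp_vM_primitive:
  fixes f :: "real \<Rightarrow> 'a::banach"
  assumes f: "has_Bochner_integral_01 f x"
  obtains \<phi> where "vM_primitive (\<lambda>t. {f t}) (\<lambda>I. {\<phi> I})" "\<phi> {0..1} = x"
proof -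
  note F = has_Bochner_integral_01_D(1,2)[OF f]
  define \<phi> where "\<phi> I = (SOME y. has_Bochner_integral_01 (\<lambda>t. indicator I t *\<^sub>R f t) y)" for I
  have \<phi>: "has_Bochner_integral_01 (\<lambda>t. indicator I t *\<^sub>R f t) (\<phi> I)" if I: "I \<in> closed_subintervals" for I
    unfolding \<phi>_def by (rule has_Bochner_integral_restrict[OF F closed_subintervals_in_sets[OF I]]) (rule someI)
  have \<phi>_unit: "\<phi> {0..1} = x"
  proof (rule has_Bochner_integral_unique[OF \<phi>[OF unit_in_closed_subintervals]])
    show "has_Bochner_integral_01 (\<lambda>t. indicator {0..1} t *\<^sub>R f t) x"
      by (rule has_Bochner_integral_cong_AE[OF f]) (auto intro!: AE_I2)
  qed
  have additive: "finitely_additive (\<lambda>I. {\<phi> I})"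
    unfolding finitely_additive_def
  proof (intro ballI impI)
    fix I J assume I: "I \<in> closed_subintervals" and J: "J \<in> closed_subintervals"
      and IJ: "interior I \<inter> interior J = {} \<and> I \<union> J \<in> closed_subintervals"
    have "has_Bochner_integral_01 (\<lambda>t. 1 *\<^sub>R (indicator I t *\<^sub>R f t) + 1 *\<^sub>R (indicator J t *\<^sub>R f t)) (1 *\<^sub>R \<phi> I + 1 *\<^sub>R \<phi> J)"
      by (intro has_Bochner_integral_lincomb \<phi> I J)
    then have "has_Bochner_integral_01 (\<lambda>t. indicator (I \<union> J) t *\<^sub>R f t) (1 *\<^sub>R \<phi> I + 1 *\<^sub>R \<phi> J)"
    proof (rule has_Bochner_integral_cong_AE)
      show "AE t in \<mu>. 1 *\<^sub>R (indicator I t *\<^sub>R f t) + 1 *\<^sub>R (indicator J t *\<^sub>R f t) = indicator (I \<union> J) t *\<^sub>R f t"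
        using AE_not_in_both[OF I J conjunct1[OF IJ]] by eventually_elim (auto simp: indicator_def)
    qed
    then have "\<phi> (I \<union> J) = \<phi> I + \<phi> J" using has_Bochner_integral_unique[OF \<phi>[of "I \<union> J"]] IJ by simp
    then show "{\<phi> (I \<union> J)} = {\<phi> I} + {\<phi> J}" by (simp add: set_plus_def)
  qed
  have small: "\<exists>\<delta>. gauge_fun \<delta> \<and> (\<forall>P. mcshane_partition P \<and> delta_fine \<delta> P \<longrightarrow>
      (\<Sum>(I, t)\<in>P. hausdorff_dist {\<phi> I} ((*\<^sub>R) (measure lebesgue I) ` {f t})) < \<epsilon>)" if \<epsilon>: "0 < \<epsilon>" for \<epsilon>
  proof -
    define \<eta> where "\<eta> = \<epsilon> / 4"
    have \<eta>: "0 < \<eta>" using \<epsilon> by (simp add: \<eta>_def)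
    obtain E b where E: "\<And>k::nat. E k \<in> sets \<mu>" "{0..1} \<subseteq> (\<Union>k. E k)"
      and b: "\<And>k t. t \<in> E k \<Longrightarrow> norm (f t) \<le> b k"
      and osc: "\<And>k t. t \<in> E k \<Longrightarrow> AE s in \<mu>. s \<in> E k \<longrightarrow> norm (f s - f t) \<le> \<eta>"
      by (rule exists_small_oscillation_cover[OF F(1) \<eta>]) (rule that; assumption)
    define h where "h k t = norm (f t) + \<bar>b k\<bar>" for k t
    have h: "integrable \<mu> (h k)" "0 \<le> h k t" for k t
      unfolding h_def using F(2) by auto
    have "\<exists>U. open U \<and> E k \<subseteq> U \<and> (\<integral>t. indicator (U - E k) t * h k t \<partial>\<mu>) < \<eta> * (1/2) ^ k" for k
    proof -
      have "0 < \<eta> * (1/2) ^ k" using \<eta> by simp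
      from exists_open_superset_small_integral[OF h E(1) this] show ?thesis by metis
    qed
    then obtain U where U: "\<And>k. open (U k)" "\<And>k. E k \<subseteq> U k"
      "\<And>k. (\<integral>t. indicator (U k - E k) t * h k t \<partial>\<mu>) < \<eta> * (1/2) ^ k" by metis
    define k where "k t = (SOME k. t \<in> E k)" for t
    have k: "t \<in> E (k t)" if "t \<in> {0..1}" for t
    proof -
      have "\<exists>k. t \<in> E k" using E(2) that by blast
      then show ?thesis unfolding k_def by (rule someI_ex)
    qed
    have "\<exists>r>0. {t - r <..< t + r} \<subseteq> U (k t)" if "t \<in> {0..1}" for t
    proof -
      have "t \<in> U (k t)" using k[OF that] U(2) by blast
      then obtain r where "0 < r" "ball t r \<subseteq> U (k t)" using U(1) open_contains_ball by blast
      then show ?thesis by (auto simp: ball_eq_greaterThanLessThan)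
    qed
    then obtain \<delta> where \<delta>: "\<And>t. t \<in> {0..1} \<Longrightarrow> 0 < \<delta> t \<and> {t - \<delta> t <..< t + \<delta> t} \<subseteq> U (k t)" by metis
    have "(\<Sum>(I, t)\<in>P. hausdorff_dist {\<phi> I} ((*\<^sub>R) (measure lebesgue I) ` {f t})) < \<epsilon>"
      if P: "mcshane_partition P" "delta_fine \<delta> P" for P
    proof -
      have fin: "finite P" and P_in: "\<And>I t. (I, t) \<in> P \<Longrightarrow> I \<in> closed_subintervals \<and> t \<in> {0..1}"
        and P_disj: "\<And>p q. p \<in> P \<Longrightarrow> q \<in> P \<Longrightarrow> p \<noteq> q \<Longrightarrow> interior (fst p) \<inter> interior (fst q) = {}"
      proof -
        note P1 = P(1)[unfolded mcshane_partition_def]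
        show "finite P" by (rule conjunct1[OF P1])
        have tags: "\<forall>(I, t)\<in>P. I \<in> closed_subintervals \<and> t \<in> {0..1}"
          by (rule conjunct1[OF conjunct2[OF P1]])
        show "I \<in> closed_subintervals \<and> t \<in> {0..1}" if "(I, t) \<in> P" for I t
          using bspec[OF tags that] by simp
        have *: "\<forall>(I, t)\<in>P. \<forall>(J, s)\<in>P. (I, t) \<noteq> (J, s) \<longrightarrow> interior I \<inter> interior J = {}"
          by (rule conjunct1[OF conjunct2[OF conjunct2[OF P1]]])
        fix p q assume pq: "p \<in> P" "q \<in> P" "p \<noteq> q"
        then show "interior (fst p) \<inter> interior (fst q) = {}"
          using bspec[OF bspec[OF *[unfolded split_beta] pq(1)] pq(2)] by simp
      qed
      have P_k: "t \<in> E (k t) \<and> I \<subseteq> U (k t)" if "(I, t) \<in> P" for I t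
      proof
        show "t \<in> E (k t)" using P_in[OF that] k by blast
        have "I \<subseteq> {t - \<delta> t <..< t + \<delta> t}" using P(2) that by (auto simp: delta_fine_def)
        also have "\<dots> \<subseteq> U (k t)" using \<delta> P_in[OF that] by blast
        finally show "I \<subseteq> U (k t)" .
      qed
      let ?D = "\<lambda>I t s. norm (indicator I s *\<^sub>R f s - indicator I s *\<^sub>R f t)"
      have summand: "hausdorff_dist {\<phi> I} ((*\<^sub>R) (measure lebesgue I) ` {f t}) \<le> (\<integral>s. ?D I t s \<partial>\<mu>)"
        "integrable \<mu> (?D I t)" if "(I, t) \<in> P" for I t
      proof -
        have I: "I \<in> closed_subintervals" "I \<in> sets \<mu>" using P_in[OF that] closed_subintervals_in_sets by auto
        then have "I \<subseteq> {0..1}" by (auto simp: sets_restrict_space_iff)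
        then have "measure \<mu> I = measure lebesgue I" by (simp add: measure_restrict_space)
        then show "hausdorff_dist {\<phi> I} ((*\<^sub>R) (measure lebesgue I) ` {f t}) \<le> (\<integral>s. ?D I t s \<partial>\<mu>)"
          using norm_has_Bochner_integral_diff_le[OF \<phi>[OF I(1)] has_Bochner_integral_indicator[OF I(2), of "f t"]]
          by (simp add: dist_norm)
        show "integrable \<mu> (?D I t)"
          by (rule integrable_norm_diff[OF has_Bochner_integral_01_D(1,2)[OF \<phi>[OF I(1)]]
                has_Bochner_integral_01_D(1,2)[OF has_Bochner_integral_indicator[OF I(2), of "f t"]]])
      qed
      let ?K = "k ` snd ` P"
      have int_U: "integrable \<mu> (\<lambda>s. indicator (U j - E j) s * h j s)" for j
      proof (rule integrable_bounded_by[OF h(1)])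
        have "(U j - E j) \<inter> {0..1} \<in> sets \<mu>"
        proof -
          have "U j \<in> sets lebesgue" "E j \<in> sets lebesgue"
            using U(1)[of j] E(1)[of j] by (simp_all add: sets_restrict_space_iff lebesgue_openin)
          then show ?thesis by (simp add: sets_restrict_space_iff sets.Int sets.Diff)
        qed
        then have "(\<lambda>s. indicator ((U j - E j) \<inter> {0..1}) s * h j s) \<in> borel_measurable \<mu>"
          using h(1)[of j] by (intro borel_measurable_times borel_measurable_indicator) auto
        then show "(\<lambda>s. indicator (U j - E j) s * h j s) \<in> borel_measurable \<mu>"
          by (rule measurable_cong[THEN iffD1, rotated]) (auto simp: indicator_def)
        show "AE s in \<mu>. \<bar>indicator (U j - E j) s * h j s\<bar> \<le> h j s"
          using h(2) by (auto simp: indicator_def)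
      qed
      have "(\<Sum>(I, t)\<in>P. hausdorff_dist {\<phi> I} ((*\<^sub>R) (measure lebesgue I) ` {f t}))
          \<le> (\<Sum>(I, t)\<in>P. \<integral>s. ?D I t s \<partial>\<mu>)"
        using summand(1) by (intro sum_mono) auto
      also have "\<dots> = (\<integral>s. (\<Sum>(I, t)\<in>P. ?D I t s) \<partial>\<mu>)"
        using summand(2) by (subst Bochner_Integration.integral_sum) (auto simp: split_beta)
      also have "\<dots> \<le> (\<integral>s. \<eta> + (\<Sum>j\<in>?K. indicator (U j - E j) s * h j s) \<partial>\<mu>)"
      proof (rule integral_mono_AE)
        show "integrable \<mu> (\<lambda>s. \<Sum>(I, t)\<in>P. ?D I t s)"
          using summand(2) by (intro Bochner_Integration.integrable_sum) (auto simp: split_beta)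
        show "integrable \<mu> (\<lambda>s. \<eta> + (\<Sum>j\<in>?K. indicator (U j - E j) s * h j s))"
          by (intro Bochner_Integration.integrable_add Bochner_Integration.integrable_sum int_U) auto
        have "AE s in \<mu>. \<forall>p\<in>P. s \<in> E (k (snd p)) \<longrightarrow> norm (f s - f (snd p)) \<le> \<eta>"
          using P_k by (intro AE_finite_allI fin osc) auto
        moreover have "AE s in \<mu>. \<forall>p\<in>P. \<forall>q\<in>P. p \<noteq> q \<longrightarrow> \<not> (s \<in> fst p \<and> s \<in> fst q)"
        proof (intro AE_finite_allI fin)
          fix p q assume p: "p \<in> P" and q: "q \<in> P"
          show "AE s in \<mu>. p \<noteq> q \<longrightarrow> \<not> (s \<in> fst p \<and> s \<in> fst q)"
          proof (cases "p = q")
            case False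
            have "fst p \<in> closed_subintervals" "fst q \<in> closed_subintervals"
              using P_in[of "fst p" "snd p"] P_in[of "fst q" "snd q"] p q by simp_all
            from AE_not_in_both[OF this P_disj[OF p q False]] show ?thesis by eventually_elim simp
          qed simp
        qed
        ultimately show "AE s in \<mu>. (\<Sum>(I, t)\<in>P. ?D I t s) \<le> \<eta> + (\<Sum>j\<in>?K. indicator (U j - E j) s * h j s)"
        proof eventually_elim
          case (elim s)
          show ?case unfolding h_def
          proof (rule sum_oscillation_le[where E=E and U=U and k=k and b=b])
            show "p = q" if "p \<in> P" "q \<in> P" "s \<in> fst p" "s \<in> fst q" for p q
              using elim(2) that by blast
            show "s \<in> E (k t) \<longrightarrow> norm (f s - f t) \<le> \<eta>" if "(I, t) \<in> P" for I t
              using bspec[OF elim(1) that] by simp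
          qed (use fin P_k b \<eta> in \<open>simp_all add: less_imp_le\<close>)
        qed
      qed
      also have "\<dots> = \<eta> + (\<Sum>j\<in>?K. \<integral>s. indicator (U j - E j) s * h j s \<partial>\<mu>)"
        using int_U by (subst Bochner_Integration.integral_add) (auto simp: measure_unit)
      also have "\<dots> \<le> \<eta> + (\<Sum>j\<in>?K. \<eta> * (1/2) ^ j)"
        using U(3) by (intro add_left_mono sum_mono less_imp_le)
      also have "(\<Sum>j\<in>?K. \<eta> * (1/2) ^ j) \<le> (\<Sum>j. \<eta> * (1/2) ^ j)"
        using fin \<eta> by (intro sum_le_suminf summable_mult summable_geometric) auto
      also have "(\<Sum>j. \<eta> * (1/2) ^ j) = 2 * \<eta>" by (simp add: suminf_mult suminf_geometric summable_geometric)
      finally show ?thesis using \<epsilon> by (simp add: \<eta>_def)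
    qed
    then show ?thesis using \<delta> by (intro exI[of _ \<delta>]) (auto simp: gauge_fun_def)
  qed
  have "vM_primitive (\<lambda>t. {f t}) (\<lambda>I. {\<phi> I})"
    unfolding vM_primitive_def using additive small by auto
  then show ?thesis using \<phi>_unit by (rule that)
qed

section \<open>Almost minimizers of a quadratic energy\<close>

text \<open>
  The infima over the decreasing sets increase to a limit \<open>s\<close>. Far enough along the sequence, an
  almost minimizer and the next one have energy close to \<open>s\<close>, while their midpoint has energy at least
  about \<open>s\<close>. If \<open>F\<close> is quadratic, the left-hand side is the energy of half of the difference.
\<close>

lemma almost_minimizers_almost_parallel:
  fixes F :: "'b \<Rightarrow> real" and C :: "nat \<Rightarrow> 'b set"
  assumes ne: "\<And>n. C n \<noteq> {}" and anti: "\<And>m n. m \<le> n \<Longrightarrow> C n \<subseteq> C m"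
    and mid: "\<And>n a b. a \<in> C n \<Longrightarrow> b \<in> C n \<Longrightarrow> mid a b \<in> C n"
    and bounds: "\<And>n a. a \<in> C n \<Longrightarrow> 0 \<le> F a \<and> F a \<le> B"
  obtains h where "\<And>j. h j \<in> C j" "\<And>j. (F (h j) + F (h (Suc j))) / 2 - F (mid (h j) (h (Suc j))) \<le> 2 * (1/4) ^ j"
proof -
  define e where "e n = (INF a\<in>C n. F a)" for n
  have bdd: "bdd_below (F ` C n)" for n using bounds by (intro bdd_belowI2[where m=0]) auto
  have e_le: "e n \<le> F a" if "a \<in> C n" for n a
    unfolding e_def using that by (intro cINF_lower bdd)
  have e_mono: "e m \<le> e n" if "m \<le> n" for m n
    unfolding e_def using anti[OF that] by (intro cINF_superset_mono ne bdd) auto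
  have e_bdd: "bdd_above (range e)"
  proof (rule bdd_aboveI2)
    fix n
    obtain a where "a \<in> C n" using ne[of n] by blast
    then show "e n \<le> B" using e_le[of a n] bounds[of a n] by simp
  qed
  define s where "s = (SUP n. e n)"
  have e_s: "e n \<le> s" for n unfolding s_def by (intro cSUP_upper e_bdd) auto
  have "\<exists>n. s - (1/4) ^ j \<le> e n" for j :: nat
  proof -
    have "s - (1/4) ^ j < Sup (range e)" by (simp add: s_def)
    from less_cSupD[OF _ this] obtain n where "s - (1/4) ^ j < e n" by auto
    then show ?thesis by (intro exI[of _ n] less_imp_le)
  qed
  then obtain N where N: "\<And>j. s - (1/4) ^ j \<le> e (N j)" by metis
  \<comment> \<open>Summing makes the indices increasing, and still at least \<open>N j\<close> and \<open>j\<close>.\<close>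
  define M where "M j = (\<Sum>i\<le>j. N i) + j" for j
  have M_ge: "N j \<le> M j" "j \<le> M j" "M j \<le> M (Suc j)" for j
    using member_le_sum[of j "{..j}" N] by (simp_all add: M_def)
  have "\<exists>a\<in>C (M j). F a \<le> e (M j) + (1/4) ^ j" for j
  proof -
    have "F ` C (M j) \<noteq> {}" "Inf (F ` C (M j)) < e (M j) + (1/4) ^ j" using ne by (simp_all add: e_def)
    from cInf_lessD[OF this] show ?thesis by (auto intro: less_imp_le)
  qed
  then obtain h where h: "\<And>j. h j \<in> C (M j)" "\<And>j. F (h j) \<le> e (M j) + (1/4) ^ j" by metis
  show ?thesis
  proof (rule that[of h])
    show "h j \<in> C j" for j using h(1)[of j] anti[OF M_ge(2)[of j]] by blast
    fix j
    have "h (Suc j) \<in> C (M j)" using h(1)[of "Suc j"] anti[OF M_ge(3)[of j]] by blast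
    then have "e (M j) \<le> F (mid (h j) (h (Suc j)))" by (intro e_le mid h(1))
    moreover define q :: real where "q = (1/4) ^ j"
    moreover have "s - q \<le> e (M j)" using N[of j] e_mono[OF M_ge(1)[of j]] unfolding q_def by linarith
    moreover have "F (h j) \<le> s + q" using h(2)[of j] e_s[of "M j"] unfolding q_def by linarith
    moreover have "F (h (Suc j)) \<le> s + q"
    proof -
      have "(1/4) ^ Suc j \<le> ((1/4) ^ j :: real)" by simp
      then show ?thesis using h(2)[of "Suc j"] e_s[of "M (Suc j)"] unfolding q_def by linarith
    qed
    ultimately show "(F (h j) + F (h (Suc j))) / 2 - F (mid (h j) (h (Suc j))) \<le> 2 * (1/4) ^ j"
      unfolding q_def[symmetric] by (simp add: field_simps)
  qed
qed

text \<open>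
  For functionals of norm at most \<open>1\<close> this is the square of a Hilbert seminorm dominated by the
  norm. It controls countably many functionals at once and obeys the parallelogram law.
\<close>

definition weighted_square_sum :: "(nat \<Rightarrow> 'a::real_normed_vector \<Rightarrow>\<^sub>L real) \<Rightarrow> 'a \<Rightarrow> real" where
  "weighted_square_sum y z = (\<Sum>k. (1/2) ^ k * (y k z)\<^sup>2)"

context
  fixes y :: "nat \<Rightarrow> 'a::real_normed_vector \<Rightarrow>\<^sub>L real"
  assumes y: "\<And>k. norm (y k) \<le> 1"
begin

lemma contraction_abs_le: "\<bar>y k z\<bar> \<le> norm z"
proof -
  have "norm (y k z) \<le> norm (y k) * norm z" by (rule norm_blinfun)
  also have "\<dots> \<le> 1 * norm z" by (intro mult_right_mono y) auto
  finally show ?thesis by simp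
qed

lemma summable_weighted_squares: "summable (\<lambda>k. (1/2) ^ k * (y k z)\<^sup>2)"
proof (rule summable_comparison_test')
  show "summable (\<lambda>k. (1/2) ^ k * (norm z)\<^sup>2)" by (intro summable_mult2 summable_geometric) simp
  show "norm ((1/2) ^ k * (y k z)\<^sup>2) \<le> (1/2) ^ k * (norm z)\<^sup>2" for k
    using contraction_abs_le[of k z] by (simp add: abs_mult abs_le_square_iff[symmetric] power2_abs)
qed

lemma weighted_square_sum_nonneg: "0 \<le> weighted_square_sum y z"
  unfolding weighted_square_sum_def by (intro suminf_nonneg summable_weighted_squares) auto

lemma weighted_square_sum_le: "weighted_square_sum y z \<le> 2 * (norm z)\<^sup>2"
proof -
  have "weighted_square_sum y z \<le> (\<Sum>k. (1/2) ^ k * (norm z)\<^sup>2)"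
    unfolding weighted_square_sum_def
  proof (intro suminf_le summable_weighted_squares)
    show "summable (\<lambda>k. (1/2) ^ k * (norm z)\<^sup>2)" by (intro summable_mult2 summable_geometric) simp
    show "(1/2) ^ k * (y k z)\<^sup>2 \<le> (1/2) ^ k * (norm z)\<^sup>2" for k
      using contraction_abs_le[of k z] by (simp add: abs_le_square_iff[symmetric])
  qed
  also have "\<dots> = (\<Sum>k. (1/2) ^ k) * (norm z)\<^sup>2"
    by (intro suminf_mult2[symmetric] summable_geometric) simp
  also have "(\<Sum>k. (1/2) ^ k) = (2 :: real)" by (simp add: suminf_geometric)
  finally show ?thesis .
qed

lemma square_le_weighted_square_sum: "(y k z)\<^sup>2 \<le> 2 ^ k * weighted_square_sum y z"
proof -
  have "(\<Sum>i\<in>{k}. (1/2) ^ i * (y i z)\<^sup>2) \<le> weighted_square_sum y z"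
    unfolding weighted_square_sum_def by (intro sum_le_suminf summable_weighted_squares) auto
  then show ?thesis by (simp add: power_one_over field_simps)
qed

lemma weighted_square_sum_parallelogram:
  "weighted_square_sum y ((1/2) *\<^sub>R a + (1/2) *\<^sub>R b) + weighted_square_sum y ((1/2) *\<^sub>R a + (-1/2) *\<^sub>R b)
    = (weighted_square_sum y a + weighted_square_sum y b) / 2"
proof -
  let ?s = "\<lambda>z k. (1/2) ^ k * (y k z)\<^sup>2"
  have "weighted_square_sum y ((1/2) *\<^sub>R a + (1/2) *\<^sub>R b) + weighted_square_sum y ((1/2) *\<^sub>R a + (-1/2) *\<^sub>R b)
      = (\<Sum>k. ?s ((1/2) *\<^sub>R a + (1/2) *\<^sub>R b) k + ?s ((1/2) *\<^sub>R a + (-1/2) *\<^sub>R b) k)"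
    unfolding weighted_square_sum_def by (intro suminf_add summable_weighted_squares)
  also have "\<dots> = (\<Sum>k. (?s a k + ?s b k) / 2)"
    by (intro suminf_cong) (simp add: blinfun.add_right blinfun.diff_right blinfun.scaleR_right power2_eq_square field_simps)
  also have "\<dots> = (\<Sum>k. ?s a k + ?s b k) / 2"
    by (intro suminf_divide summable_add summable_weighted_squares)
  also have "(\<Sum>k. ?s a k + ?s b k) = weighted_square_sum y a + weighted_square_sum y b"
    unfolding weighted_square_sum_def by (intro suminf_add[symmetric] summable_weighted_squares)
  finally show ?thesis .
qed

lemma weighted_square_sum_measurable:
  "strongly_measurable f \<Longrightarrow> (\<lambda>t. weighted_square_sum y (f t)) \<in> borel_measurable \<mu>"
  unfolding weighted_square_sum_def
  by (intro borel_measurable_suminf borel_measurable_times borel_measurable_power borel_measurable_const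
      strongly_measurable_blinfun)

end

section \<open>Closedness of the Aumann integral\<close>

text \<open>
  The weakly closed sets \<open>Y\<close> and \<open>{x. \<bar>y k x - c k\<bar> \<le> 1 / Suc j}\<close> have the finite intersection
  property in \<open>K\<close>, because all but finitely many \<open>z n\<close> lie in any given one.
\<close>

lemma cwk_weak_limit_point:
  fixes K :: "'a::real_normed_vector set" and y :: "nat \<Rightarrow> 'a \<Rightarrow>\<^sub>L real"
  assumes K: "K \<in> cwk" and Y: "subspace Y" "closed Y"
    and z: "\<And>n. z n \<in> K \<inter> Y" and lim: "\<And>k. (\<lambda>n. y k (z n)) \<longlonglongrightarrow> c k"
  obtains x where "x \<in> K" "x \<in> Y" "\<And>k. y k x = c k"
proof -
  define U where "U = insert Y (range (\<lambda>(k, j). {x. y k x \<in> cball (c k) (1 / real (Suc j))}))"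
  have closed: "\<forall>C\<in>U. closedin weak_topology C"
    unfolding U_def using weakly_closed_subspace[OF Y] closedin_weak_preimage[OF closed_cball] by auto
  have ev: "eventually (\<lambda>n. z n \<in> C) sequentially" if "C \<in> U" for C
  proof (cases "C = Y")
    case False
    then obtain k j where C: "C = {x. y k x \<in> cball (c k) (1 / real (Suc j))}"
      using \<open>C \<in> U\<close> by (auto simp: U_def)
    have "eventually (\<lambda>n. dist (y k (z n)) (c k) < 1 / real (Suc j)) sequentially"
      using lim[of k] by (intro tendstoD) auto
    then show ?thesis by eventually_elim (simp add: C dist_commute)
  qed (use z in auto)
  have "K \<inter> \<Inter> \<F> \<noteq> {}" if "finite \<F>" "\<F> \<subseteq> U" for \<F>
  proof -
    have "eventually (\<lambda>n. \<forall>C\<in>\<F>. z n \<in> C) sequentially"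
      using that ev by (intro eventually_ball_finite) auto
    then obtain n where "\<forall>C\<in>\<F>. z n \<in> C" by (auto simp: eventually_sequentially)
    then show ?thesis using z[of n] by blast
  qed
  then have "K \<inter> \<Inter> U \<noteq> {}"
    using cwk_compactin[OF K] closed unfolding compactin_fip by blast
  then obtain x where x: "x \<in> K" "\<And>C. C \<in> U \<Longrightarrow> x \<in> C" by blast
  have "y k x = c k" for k
  proof -
    have "dist (c k) (y k x) \<le> 1 / real (Suc j)" for j
    proof -
      have "{x. y k x \<in> cball (c k) (1 / real (Suc j))} \<in> U" unfolding U_def by (intro insertI2 image_eqI[of _ _ "(k, j)"]) auto
      from x(2)[OF this] show ?thesis by simp
    qed
    then have "dist (c k) (y k x) \<le> 0"
      using LIMSEQ_le_const[OF LIMSEQ_inverse_real_of_nat, of "dist (c k) (y k x)"] by (auto simp: inverse_eq_divide)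
    then show ?thesis by simp
  qed
  moreover have "x \<in> Y" using x(2) by (simp add: U_def)
  ultimately show ?thesis using x(1) by (intro that)
qed

text \<open>
  The rational linear combinations, encoded by lists of pairs of a coefficient and an index, are a
  countable set whose closure is a subspace.
\<close>

lemma countable_in_separable_closed_subspace:
  fixes D :: "'a::real_normed_vector set"
  assumes "countable D"
  obtains d :: "nat \<Rightarrow> 'a" where "D \<subseteq> closure (range d)" "subspace (closure (range d))"
proof -
  obtain e :: "nat \<Rightarrow> 'a" where e: "D \<subseteq> range e"
    using assms by (metis empty_subsetI range_from_nat_into subset_refl)
  define comb where "comb l = sum_list (map (\<lambda>(q, i). real_of_rat q *\<^sub>R e i) l)" for l :: "(rat \<times> nat) list"
  define d where "d = from_nat_into (range comb)"
  have d: "range d = range comb" unfolding d_def by (rule range_from_nat_into) auto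
  have "e i \<in> range comb" for i by (rule image_eqI[of _ _ "[(1, i)]"]) (auto simp: comb_def)
  then have "D \<subseteq> range d" using e unfolding d by blast
  then have "D \<subseteq> closure (range d)" by (rule order_trans[OF _ closure_subset])
  moreover have "subspace (closure (range comb))"
  proof (rule subspaceI)
    have "0 \<in> range comb" by (rule image_eqI[of _ _ "[]"]) (auto simp: comb_def)
    then show "0 \<in> closure (range comb)" by (rule subsetD[OF closure_subset])
  next
    fix u v assume u: "u \<in> closure (range comb)" and v: "v \<in> closure (range comb)"
    from u[unfolded closure_sequential] obtain a where a: "\<forall>n. a n \<in> range comb" "a \<longlonglongrightarrow> u" by blast
    from v[unfolded closure_sequential] obtain b where b: "\<forall>n. b n \<in> range comb" "b \<longlonglongrightarrow> v" by blast
    have "comb l + comb m = comb (l @ m)" for l m by (simp add: comb_def)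
    then have "\<forall>n. a n + b n \<in> range comb" using a(1) b(1) by (metis rangeE rangeI)
    moreover have "(\<lambda>n. a n + b n) \<longlonglongrightarrow> u + v" by (intro tendsto_add a b)
    ultimately show "u + v \<in> closure (range comb)"
      unfolding closure_sequential by (intro exI[of _ "\<lambda>n. a n + b n"] conjI)
  next
    fix c :: real and u assume u: "u \<in> closure (range comb)"
    from u[unfolded closure_sequential] obtain a where a: "\<forall>n. a n \<in> range comb" "a \<longlonglongrightarrow> u" by blast
    have "\<exists>q. \<bar>real_of_rat q - c\<bar> < 1 / real (Suc n)" for n
    proof -
      obtain q where "c < real_of_rat q" "real_of_rat q < c + 1 / real (Suc n)"
        using of_rat_dense[of c "c + 1 / real (Suc n)"] by auto
      then show ?thesis by (intro exI[of _ q]) simp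
    qed
    then obtain q where q: "\<And>n. \<bar>real_of_rat (q n) - c\<bar> < 1 / real (Suc n)" by metis
    have "(\<lambda>n. real_of_rat (q n)) \<longlonglongrightarrow> c"
    proof (rule LIM_zero_cancel, rule Lim_null_comparison)
      show "(\<lambda>n. 1 / real (Suc n)) \<longlonglongrightarrow> 0"
        using LIMSEQ_inverse_real_of_nat by (simp add: inverse_eq_divide)
      show "eventually (\<lambda>n. norm (real_of_rat (q n) - c) \<le> 1 / real (Suc n)) sequentially"
        using q by (auto intro: less_imp_le always_eventually)
    qed
    then have "(\<lambda>n. real_of_rat (q n) *\<^sub>R a n) \<longlonglongrightarrow> c *\<^sub>R u" by (intro tendsto_scaleR a)
    moreover have "real_of_rat r *\<^sub>R comb l = comb (map (\<lambda>(q, i). (r * q, i)) l)" for r l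
      by (induction l) (auto simp: comb_def scaleR_add_right of_rat_mult)
    then have "\<forall>n. real_of_rat (q n) *\<^sub>R a n \<in> range comb" using a(1) by (metis rangeE rangeI)
    ultimately show "c *\<^sub>R u \<in> closure (range comb)"
      unfolding closure_sequential by (intro exI[of _ "\<lambda>n. real_of_rat (q n) *\<^sub>R a n"] conjI)
  qed
  ultimately show ?thesis using that[of d] d by simp
qed

lemma exists_norming_sequence:
  fixes d :: "nat \<Rightarrow> 'a::real_normed_vector"
  obtains y :: "nat \<Rightarrow> 'a \<Rightarrow>\<^sub>L real" where "\<And>k. norm (y k) \<le> 1" "\<And>k. y k (d k) = norm (d k)"
proof -
  have "\<exists>g :: 'a \<Rightarrow>\<^sub>L real. norm g \<le> 1 \<and> blinfun_apply g (d k) = norm (d k)" for k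
    using exists_norming_functional[of "d k"] by metis
  then show ?thesis using that by metis
qed

text \<open>
  Otherwise a functional vanishing on \<open>Y\<close> would separate the integral from \<open>Y\<close>.
\<close>

lemma Bochner_integral_in_closed_subspace:
  fixes f :: "real \<Rightarrow> 'a::banach"
  assumes f: "has_Bochner_integral_01 f z" and Y: "subspace Y" "closed Y" and ae: "AE t in \<mu>. f t \<in> Y"
  shows "z \<in> Y"
proof (rule ccontr)
  assume "z \<notin> Y"
  then obtain g :: "'a \<Rightarrow>\<^sub>L real" where g: "\<And>y. y \<in> Y \<Longrightarrow> g y = 0" "g z \<noteq> 0"
    using separate_from_closed_subspace[OF Y] by metis
  have "(\<integral>t. g (f t) \<partial>\<mu>) = 0"
    using ae by (intro integral_eq_zero_AE) (auto elim!: eventually_mono simp: g)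
  then show False using has_Bochner_integral_01_D(3)[OF f] g(2) by simp
qed

lemma convergent_of_geometric_square_steps:
  fixes a :: "nat \<Rightarrow> real"
  assumes "eventually (\<lambda>j. (a j - a (Suc j))\<^sup>2 \<le> c * (1/2) ^ j) sequentially"
  shows "convergent a"
proof -
  define s where "s = sqrt (1/2)"
  have s: "0 \<le> s" "s < 1" "s\<^sup>2 = 1/2" by (auto simp: s_def real_sqrt_lt_1_iff)
  have "eventually (\<lambda>j. norm (a (Suc j) - a j) \<le> sqrt \<bar>c\<bar> * s ^ j) sequentially"
    using assms
  proof eventually_elim
    case (elim j)
    have half: "(1/2) ^ j = (s ^ j)\<^sup>2"
      unfolding s(3)[symmetric] by (simp add: power_mult[symmetric] mult.commute)
    note elim
    also have "c * (1/2) ^ j \<le> \<bar>c\<bar> * (1/2) ^ j" by (intro mult_right_mono) auto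
    also have "\<dots> = (sqrt \<bar>c\<bar> * s ^ j)\<^sup>2" unfolding half by (simp add: power_mult_distrib)
    finally have "(a j - a (Suc j))\<^sup>2 \<le> (sqrt \<bar>c\<bar> * s ^ j)\<^sup>2" .
    then have "\<bar>a j - a (Suc j)\<bar> \<le> sqrt \<bar>c\<bar> * s ^ j"
      using s(1) by (intro power2_le_imp_le[of "\<bar>a j - a (Suc j)\<bar>"]) auto
    then show ?case by (simp add: abs_minus_commute)
  qed
  moreover have "summable (\<lambda>j. sqrt \<bar>c\<bar> * s ^ j)" using s by (intro summable_mult summable_geometric) auto
  ultimately have "summable (\<lambda>j. a (Suc j) - a j)" by (rule summable_comparison_test_ev)
  then have "(\<lambda>n. \<Sum>j<n. a (Suc j) - a j) \<longlonglongrightarrow> (\<Sum>j. a (Suc j) - a j)" by (rule summable_LIMSEQ)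
  then have "(\<lambda>n. a n - a 0) \<longlonglongrightarrow> (\<Sum>j. a (Suc j) - a j)" by (simp add: sum_lessThan_telescope)
  from tendsto_add[OF this tendsto_const[of "a 0"]] show ?thesis by (auto intro: convergentI)
qed

context vM_multifunction
begin

text \<open>
  The set \<open>C n\<close> of selections with values in \<open>Y\<close> almost everywhere and integral within \<open>1 / Suc n\<close> of
  \<open>x\<close> is stable under midpoints, because the values of \<open>\<Gamma>\<close> are convex. The energy is divided by the
  square of an integrable bound \<open>w\<close> of \<open>\<Gamma>\<close>, which keeps it at most \<open>2\<close>. Near-minimizers \<open>h j\<close> taken
  in \<open>C j\<close> converge along each \<open>y k\<close>.
\<close>

theorem primitive_subset_Aumann_integral:
  assumes x: "x \<in> \<Phi> {0..1}"
  shows "\<exists>f. selection_of f \<Gamma> \<and> has_Bochner_integral_01 f x"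
proof -
  have "\<exists>f z. selection_of f \<Gamma> \<and> has_Bochner_integral_01 f z \<and> dist x z < 1 / real (Suc n)" for n
    using Bochner_selections_dense[OF x, of "1 / real (Suc n)"] by (metis of_nat_0_less_iff zero_less_Suc zero_less_divide_1_iff)
  then obtain f z where f: "\<And>n. selection_of (f n) \<Gamma>" "\<And>n. has_Bochner_integral_01 (f n) (z n)"
      "\<And>n. dist x (z n) < 1 / real (Suc n)" by metis
  have "\<exists>d :: nat \<Rightarrow> 'a. AE t in \<mu>. f n t \<in> closure (range d)" for n
    using strongly_measurable_imp_separably_valued[OF has_Bochner_integral_01_D(1)[OF f(2)]] by blast
  then obtain d0 :: "nat \<Rightarrow> nat \<Rightarrow> 'a" where d0: "\<And>n. AE t in \<mu>. f n t \<in> closure (range (d0 n))" by metis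
  obtain d :: "nat \<Rightarrow> 'a" where d: "(\<Union>n. range (d0 n)) \<subseteq> closure (range d)" "subspace (closure (range d))"
    using countable_in_separable_closed_subspace[of "\<Union>n. range (d0 n)"] by (metis countableI_type countable_UN countable_image)
  define Y where "Y = closure (range d)"
  have Y: "subspace Y" "closed Y" using d by (simp_all add: Y_def)
  have f_Y: "AE t in \<mu>. f n t \<in> Y" for n
  proof -
    have "closure (range (d0 n)) \<subseteq> Y" unfolding Y_def using d(1) by (intro closure_minimal) auto
    then show ?thesis using d0[of n] by (auto elim: eventually_mono)
  qed
  obtain y :: "nat \<Rightarrow> 'a \<Rightarrow>\<^sub>L real" where y: "\<And>k. norm (y k) \<le> 1" "\<And>k. y k (d k) = norm (d k)"
    using exists_norming_sequence by metis
  obtain w where w: "integrable \<mu> w" "\<And>t. 1 \<le> w t" "AE t in \<mu>. \<forall>z\<in>\<Gamma> t. norm z \<le> w t"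
    by (rule integrably_bounded) (rule that; assumption)
  have w_pos: "0 < w t" for t using w(2)[of t] by simp
  define C where "C n = {g. selection_of g \<Gamma> \<and> (\<exists>z. has_Bochner_integral_01 g z \<and> dist x z \<le> 1 / real (Suc n))
    \<and> (AE t in \<mu>. g t \<in> Y)}" for n
  define en where "en g t = weighted_square_sum y (g t) / (w t)\<^sup>2" for g t
  define F where "F g = (\<integral>t. en g t \<partial>\<mu>)" for g
  define mid where "mid g h t = (1/2) *\<^sub>R g t + (1/2) *\<^sub>R h t" for g h :: "real \<Rightarrow> 'a" and t :: real
  define dif where "dif g h t = (1/2) *\<^sub>R g t + (-1/2) *\<^sub>R h t" for g h :: "real \<Rightarrow> 'a" and t :: real
  have sm: "strongly_measurable g" if "g \<in> C n" for g n
    using that has_Bochner_integral_01_D(1) by (auto simp: C_def)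
  have bounded: "AE t in \<mu>. norm (g t) \<le> w t" if "selection_of g \<Gamma>" for g
    using w(3) AE_space by eventually_elim (use that in \<open>auto simp: selection_of_def\<close>)
  have en_nonneg: "0 \<le> en g t" for g t
    unfolding en_def by (intro divide_nonneg_nonneg weighted_square_sum_nonneg y) simp
  have en: "integrable \<mu> (en g)" "AE t in \<mu>. en g t \<le> 2" if g: "strongly_measurable g" "AE t in \<mu>. norm (g t) \<le> w t" for g
  proof -
    show le: "AE t in \<mu>. en g t \<le> 2"
      using g(2)
    proof eventually_elim
      case (elim t)
      have "weighted_square_sum y (g t) \<le> 2 * (norm (g t))\<^sup>2" by (rule weighted_square_sum_le[OF y(1)])
      also have "\<dots> \<le> 2 * (w t)\<^sup>2" using elim by (intro mult_left_mono power_mono) auto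
      finally show ?case using w_pos[of t] by (simp add: en_def field_simps)
    qed
    have "en g \<in> borel_measurable \<mu>"
      unfolding en_def using w(1) weighted_square_sum_measurable[OF y(1) g(1)] by measurable
    then show "integrable \<mu> (en g)"
      by (rule unit.integrable_const_bound[rotated, of _ 2]) (use le en_nonneg in auto)
  qed
  obtain h where h: "\<And>j. h j \<in> C j" "\<And>j. (F (h j) + F (h (Suc j))) / 2 - F (mid (h j) (h (Suc j))) \<le> 2 * (1/4) ^ j"
  proof (rule almost_minimizers_almost_parallel[of C mid F 2])
    show "C n \<noteq> {}" for n
    proof -
      have "f n \<in> C n" using f(1,2)[of n] f(3)[of n] f_Y by (auto simp: C_def intro: less_imp_le)
      then show ?thesis by blast
    qed
    show "C n \<subseteq> C m" if mn: "m \<le> n" for m n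
    proof -
      have "1 / real (Suc n) \<le> 1 / real (Suc m)" using mn by (simp add: field_simps)
      then show ?thesis unfolding C_def by (auto intro: order_trans)
    qed
    show "mid a b \<in> C n" if a: "a \<in> C n" and b: "b \<in> C n" for n a b
    proof -
      obtain za zb where za: "has_Bochner_integral_01 a za" "dist x za \<le> 1 / real (Suc n)"
        and zb: "has_Bochner_integral_01 b zb" "dist x zb \<le> 1 / real (Suc n)" using a b by (auto simp: C_def)
      have sel: "selection_of (mid a b) \<Gamma>"
        unfolding selection_of_def
      proof
        fix t :: real assume t: "t \<in> {0..1}"
        have "a t \<in> \<Gamma> t" "b t \<in> \<Gamma> t" using a b t by (auto simp: C_def selection_of_def)
        then show "mid a b t \<in> \<Gamma> t"
          unfolding mid_def by (intro convexD[OF cwk_convex[OF cwk_value[OF t]]]) auto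
      qed
      have int: "has_Bochner_integral_01 (mid a b) ((1/2) *\<^sub>R za + (1/2) *\<^sub>R zb)"
        unfolding mid_def by (rule has_Bochner_integral_lincomb[OF za(1) zb(1)])
      have "(1/2) *\<^sub>R za + (1/2) *\<^sub>R zb \<in> cball x (1 / real (Suc n))"
        by (intro convexD[OF convex_cball]) (use za zb in auto)
      moreover have "AE t in \<mu>. a t \<in> Y" "AE t in \<mu>. b t \<in> Y" using a b by (auto simp: C_def)
      then have "AE t in \<mu>. mid a b t \<in> Y"
        unfolding mid_def by eventually_elim (intro subspace_add subspace_scale Y)
      ultimately show ?thesis using sel int by (auto simp: C_def)
    qed
    show "0 \<le> F a \<and> F a \<le> 2" if a: "a \<in> C n" for n a
    proof
      show "0 \<le> F a" unfolding F_def by (intro Bochner_Integration.integral_nonneg en_nonneg)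
      have "selection_of a \<Gamma>" using a by (simp add: C_def)
      note e = en[OF sm[OF a] bounded[OF this]]
      have "F a \<le> (\<integral>t. 2 \<partial>\<mu>)" unfolding F_def by (rule integral_mono_AE[OF e(1) _ e(2)]) simp
      then show "F a \<le> 2" by (simp add: measure_unit)
    qed
  qed (rule that; assumption)
  have h_sel: "selection_of (h j) \<Gamma>" and h_Y: "AE t in \<mu>. h j t \<in> Y" for j using h(1)[of j] by (auto simp: C_def)
  have "\<exists>z. has_Bochner_integral_01 (h j) z \<and> dist x z \<le> 1 / real (Suc j)" for j using h(1)[of j] by (simp add: C_def)
  then obtain v where v: "\<And>j. has_Bochner_integral_01 (h j) (v j)" "\<And>j. dist x (v j) \<le> 1 / real (Suc j)" by metis
  note h_sm = sm[OF h(1)]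
  have v_lim: "v \<longlonglongrightarrow> x"
  proof (rule metric_tendsto_imp_tendsto)
    show "(\<lambda>n. inverse (real (Suc n))) \<longlonglongrightarrow> 0" by (rule LIMSEQ_inverse_real_of_nat)
    show "eventually (\<lambda>n. dist (v n) x \<le> dist (inverse (real (Suc n))) 0) sequentially"
      using v(2) by (auto simp: dist_commute inverse_eq_divide)
  qed
  have dif_small: "(\<integral>t. en (dif (h j) (h (Suc j))) t \<partial>\<mu>) \<le> 2 * (1/4) ^ j"
    and dif_int: "integrable \<mu> (en (dif (h j) (h (Suc j))))" for j
  proof -
    have sm_mid: "strongly_measurable (mid (h j) (h (Suc j)))" "strongly_measurable (dif (h j) (h (Suc j)))"
      unfolding mid_def dif_def by (intro strongly_measurable_lincomb h_sm)+
    have comb: "AE t in \<mu>. norm ((1/2) *\<^sub>R h j t + c *\<^sub>R h (Suc j) t) \<le> w t" if c: "\<bar>c\<bar> = 1/2" for c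
      using bounded[OF h_sel[of j]] bounded[OF h_sel[of "Suc j"]]
    proof eventually_elim
      case (elim t)
      have "norm ((1/2) *\<^sub>R h j t + c *\<^sub>R h (Suc j) t) \<le> norm ((1/2) *\<^sub>R h j t) + norm (c *\<^sub>R h (Suc j) t)"
        by (rule norm_triangle_ineq)
      then show ?case using elim c by simp
    qed
    have "AE t in \<mu>. norm (mid (h j) (h (Suc j)) t) \<le> w t" "AE t in \<mu>. norm (dif (h j) (h (Suc j)) t) \<le> w t"
      unfolding mid_def dif_def by (rule comb, simp)+
    note e = en(1)[OF sm_mid(1) this(1)] en(1)[OF sm_mid(2) this(2)]
      en(1)[OF h_sm[of j] bounded[OF h_sel[of j]]] en(1)[OF h_sm[of "Suc j"] bounded[OF h_sel[of "Suc j"]]]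
    show "integrable \<mu> (en (dif (h j) (h (Suc j))))" by (rule e(2))
    have "en (mid (h j) (h (Suc j))) t + en (dif (h j) (h (Suc j))) t = (en (h j) t + en (h (Suc j)) t) / 2" for t
      unfolding en_def mid_def dif_def add_divide_distrib[symmetric] weighted_square_sum_parallelogram[OF y(1)]
      by (simp add: field_simps)
    then have "(\<integral>t. en (mid (h j) (h (Suc j))) t + en (dif (h j) (h (Suc j))) t \<partial>\<mu>)
        = (\<integral>t. (en (h j) t + en (h (Suc j)) t) / 2 \<partial>\<mu>)" by (simp only:)
    then have "F (mid (h j) (h (Suc j))) + (\<integral>t. en (dif (h j) (h (Suc j))) t \<partial>\<mu>) = (F (h j) + F (h (Suc j))) / 2"
      unfolding F_def using e by simp
    then show "(\<integral>t. en (dif (h j) (h (Suc j))) t \<partial>\<mu>) \<le> 2 * (1/4) ^ j" using h(2)[of j] by linarith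
  qed
  \<comment> \<open>The factor \<open>2 ^ j\<close> gives pointwise geometric decay of the energies of the steps.\<close>
  have "AE t in \<mu>. summable (\<lambda>j. 2 ^ j * en (dif (h j) (h (Suc j))) t)"
  proof (rule AE_summable_of_geometric_integrals(1))
    show "integrable \<mu> (\<lambda>t. 2 ^ j * en (dif (h j) (h (Suc j))) t)" for j using dif_int by simp
    show "0 \<le> 2 ^ j * en (dif (h j) (h (Suc j))) t" for j t using en_nonneg by simp
    show "(\<integral>t. 2 ^ j * en (dif (h j) (h (Suc j))) t \<partial>\<mu>) \<le> 2 * (1/2) ^ j" for j
    proof -
      have "(\<integral>t. 2 ^ j * en (dif (h j) (h (Suc j))) t \<partial>\<mu>) \<le> 2 ^ j * (2 * (1/4) ^ j)"
        using dif_small[of j] by simp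
      also have "\<dots> = 2 * (2 * (1/4)) ^ j" by (simp only: power_mult_distrib)
      finally show ?thesis by simp
    qed
  qed
  then have conv: "AE t in \<mu>. \<forall>k. convergent (\<lambda>j. y k (h j t))"
  proof (eventually_elim, intro allI)
    fix t k assume sum: "summable (\<lambda>j. 2 ^ j * en (dif (h j) (h (Suc j))) t)"
    show "convergent (\<lambda>j. y k (h j t))"
    proof (rule convergent_of_geometric_square_steps)
      have "eventually (\<lambda>j. 2 ^ j * en (dif (h j) (h (Suc j))) t < 1) sequentially"
        using summable_LIMSEQ_zero[OF sum] by (rule order_tendstoD) simp
      then show "eventually (\<lambda>j. (y k (h j t) - y k (h (Suc j) t))\<^sup>2 \<le> (4 * 2 ^ k * (w t)\<^sup>2) * (1/2) ^ j) sequentially"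
      proof eventually_elim
        case (elim j)
        have "en (dif (h j) (h (Suc j))) t \<le> (1/2) ^ j" using elim by (simp add: power_one_over field_simps)
        then have "weighted_square_sum y (dif (h j) (h (Suc j)) t) \<le> (1/2) ^ j * (w t)\<^sup>2"
          using w_pos[of t] by (simp add: en_def pos_divide_le_eq)
        then have "2 ^ k * weighted_square_sum y (dif (h j) (h (Suc j)) t) \<le> 2 ^ k * ((1/2) ^ j * (w t)\<^sup>2)"
          by (intro mult_left_mono) auto
        with square_le_weighted_square_sum[where y=y and k=k and z="dif (h j) (h (Suc j)) t", OF y(1)]
        have *: "(y k (dif (h j) (h (Suc j)) t))\<^sup>2 \<le> 2 ^ k * ((1/2) ^ j * (w t)\<^sup>2)" by linarith
        have "y k (h j t) - y k (h (Suc j) t) = 2 * y k (dif (h j) (h (Suc j)) t)"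
          by (simp add: dif_def blinfun.diff_right blinfun.scaleR_right)
        then have "(y k (h j t) - y k (h (Suc j) t))\<^sup>2 = 4 * (y k (dif (h j) (h (Suc j)) t))\<^sup>2"
          by (simp add: power_mult_distrib)
        with * show ?case by (simp add: algebra_simps)
      qed
    qed
  qed
  define good where "good t u \<longleftrightarrow> u \<in> \<Gamma> t \<and> u \<in> Y \<and> (\<forall>k. (\<lambda>j. y k (h j t)) \<longlonglongrightarrow> y k u)" for t u
  define g where "g t = (if \<exists>u. good t u then SOME u. good t u else SOME u. u \<in> \<Gamma> t)" for t
  have g_sel: "selection_of g \<Gamma>"
    unfolding selection_of_def
  proof
    fix t :: real assume t: "t \<in> {0..1}"
    show "g t \<in> \<Gamma> t"
    proof (cases "\<exists>u. good t u")
      case True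
      then have "good t (g t)" by (simp add: g_def someI_ex)
      then show ?thesis by (simp add: good_def)
    next
      case False
      then show ?thesis using cwk_nonempty[OF cwk_value[OF t]] by (simp add: g_def some_in_eq)
    qed
  qed
  have "AE t in \<mu>. \<forall>j. h j t \<in> Y" using h_Y by (simp add: AE_all_countable)
  then have g_good: "AE t in \<mu>. good t (g t)"
    using conv AE_space
  proof eventually_elim
    case (elim t)
    then have t: "t \<in> {0..1}" by simp
    have "h j t \<in> \<Gamma> t \<inter> Y" for j using elim(1) h_sel[of j] t by (simp add: selection_of_def)
    moreover have "(\<lambda>j. y k (h j t)) \<longlonglongrightarrow> lim (\<lambda>j. y k (h j t))" for k
      using elim(2) by (simp add: convergent_LIMSEQ_iff)
    ultimately obtain u where "u \<in> \<Gamma> t" "u \<in> Y" "\<And>k. y k u = lim (\<lambda>j. y k (h j t))"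
      using cwk_weak_limit_point[OF cwk_value[OF t] Y, of "\<lambda>j. h j t" y "\<lambda>k. lim (\<lambda>j. y k (h j t))"] by metis
    then have "\<exists>u. good t u" using elim(2) by (auto simp: good_def convergent_LIMSEQ_iff)
    then show ?case by (simp add: g_def someI_ex)
  qed
  have g_sm: "strongly_measurable g"
  proof (rule pettis_measurability[OF d(2) y])
    show "AE t in \<mu>. g t \<in> closure (range d)" using g_good by eventually_elim (simp add: good_def Y_def)
    fix k
    show "(\<lambda>t. y k (g t)) \<in> borel_measurable \<mu>"
    proof (rule borel_measurable_AE_LIMSEQ)
      show "(\<lambda>t. y k (h j t)) \<in> borel_measurable \<mu>" for j by (rule strongly_measurable_blinfun[OF h_sm])
      show "AE t in \<mu>. (\<lambda>j. y k (h j t)) \<longlonglongrightarrow> y k (g t)" using g_good by eventually_elim (simp add: good_def)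
    qed
  qed
  obtain u where u: "has_Bochner_integral_01 g u"
    using Bochner_integral_exists[OF g_sm strongly_measurable_selection_integrable[OF g_sm g_sel]] by metis
  have "y k u = y k x" for k
  proof -
    have "(\<lambda>j. \<integral>t. y k (h j t) \<partial>\<mu>) \<longlonglongrightarrow> (\<integral>t. y k (g t) \<partial>\<mu>)"
    proof (rule integral_dominated_convergence[where w=w])
      show "AE t in \<mu>. (\<lambda>j. y k (h j t)) \<longlonglongrightarrow> y k (g t)" using g_good by eventually_elim (simp add: good_def)
      show "AE t in \<mu>. norm (y k (h j t)) \<le> w t" for j
        using bounded[OF h_sel[of j]]
      proof eventually_elim
        case (elim t)
        then show ?case using contraction_abs_le[where y=y and k=k and z="h j t", OF y(1)] by simp
      qed
    qed (intro w(1) strongly_measurable_blinfun g_sm h_sm)+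
    then have "(\<lambda>j. y k (v j)) \<longlonglongrightarrow> y k u"
      by (simp add: has_Bochner_integral_01_D(3)[OF v(1)] has_Bochner_integral_01_D(3)[OF u])
    moreover have "(\<lambda>j. y k (v j)) \<longlonglongrightarrow> y k x" by (intro tendsto_intros v_lim)
    ultimately show ?thesis by (rule LIMSEQ_unique)
  qed
  moreover have "u - x \<in> Y"
  proof (rule subspace_diff[OF Y(1)])
    show "u \<in> Y"
      using g_good by (intro Bochner_integral_in_closed_subspace[OF u Y]) (auto elim: eventually_mono simp: good_def)
    have "v j \<in> Y" for j by (rule Bochner_integral_in_closed_subspace[OF v(1) Y h_Y])
    then show "x \<in> Y" using closed_sequentially[OF Y(2) _ v_lim] by blast
  qed
  then have "norm (u - x) = (SUP k. y k (u - x))" unfolding Y_def by (rule norm_eq_SUP_norming[OF y])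
  ultimately have "u = x" by (simp add: blinfun.diff_right)
  then show ?thesis using u g_sel by blast
qed

lemma strongly_measurable_selection_Bochner_integrable:
  "strongly_measurable f \<Longrightarrow> selection_of f \<Gamma> \<Longrightarrow> Bochner_integrable f"
  by (simp add: Bochner_integrable_iff strongly_measurable_selection_integrable)

end

section \<open>Selections and the Aumann integral\<close>

text \<open>
  Pettis' theorem, with a norming sequence for a dense sequence of the whole space.
\<close>

lemma scalarly_measurable_imp_strongly_measurable:
  fixes f :: "real \<Rightarrow> 'a::real_normed_vector"
  assumes sep: "separable_space (euclidean :: 'a topology)" and f: "scalarly_measurable f"
  shows "strongly_measurable f"
proof -
  obtain D :: "'a set" where D: "countable D" "closure D = UNIV"
    using sep by (auto simp: separable_space_def)
  then have "D \<noteq> {}" by auto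
  then have "closure (range (from_nat_into D)) = UNIV" using D by (simp add: range_from_nat_into)
  moreover obtain y :: "nat \<Rightarrow> 'a \<Rightarrow>\<^sub>L real" where
    "\<And>k. norm (y k) \<le> 1" "\<And>k. y k (from_nat_into D k) = norm (from_nat_into D k)"
    using exists_norming_sequence[of "from_nat_into D"] by blast
  ultimately show ?thesis using f
    by (intro pettis_measurability[of "from_nat_into D" y]) (auto simp: scalarly_measurable_def)
qed

theorem theorem3p7:
  fixes \<Gamma> :: "real \<Rightarrow> 'a::banach set"
  assumes cwk_valued: "\<forall>t\<in>{0..1}. \<Gamma> t \<in> cwk"
    and integrable: "vM_integrable \<Gamma>"
  shows "(\<forall>f. selection_of f \<Gamma> \<and> strongly_measurable f \<longrightarrow>
              vM_integrable_fun f \<and> (vM_integrable_fun f \<longleftrightarrow> Bochner_integrable f)) \<and>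
         (separable_space (euclidean :: 'a topology) \<longrightarrow>
            (\<forall>f. selection_of f \<Gamma> \<and> scalarly_measurable f \<longrightarrow> Bochner_integrable f)) \<and>
         Aumann_integrable \<Gamma> \<and>
         Aumann_integral \<Gamma> = vM_integral \<Gamma>"
proof -
  obtain \<Phi> where \<Phi>: "vM_primitive \<Gamma> \<Phi>" using integrable by (auto simp: vM_integrable_def)
  interpret vM_multifunction \<Gamma> \<Phi> by unfold_locales (use cwk_valued \<Phi> in auto)
  have vM: "vM_integrable_fun f" if "Bochner_integrable f" for f :: "real \<Rightarrow> 'a"
    using that Bochner_imp_vM_primitive[of f] unfolding Bochner_integrable_def vM_integrable_fun_def by metis
  have "\<Phi> {0..1} \<noteq> {}" using vM_primitive_cwk[OF \<Phi> unit_in_closed_subintervals] by (rule cwk_nonempty)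
  then obtain x where "x \<in> \<Phi> {0..1}" by blast
  then obtain f where "selection_of f \<Gamma>" "has_Bochner_integral_01 f x"
    using primitive_subset_Aumann_integral by blast
  then have Aumann: "Aumann_integrable \<Gamma>"
    using Effros_measurable_multifunction by (auto simp: Aumann_integrable_def Bochner_integrable_def)
  have "Aumann_integral \<Gamma> \<subseteq> \<Phi> {0..1}"
  proof
    fix x assume "x \<in> Aumann_integral \<Gamma>"
    then obtain f where f: "selection_of f \<Gamma>" "has_Bochner_integral_01 f x" by (auto simp: Aumann_integral_def)
    obtain \<phi> where \<phi>: "vM_primitive (\<lambda>t. {f t}) (\<lambda>I. {\<phi> I})" "\<phi> {0..1} = x"
      using Bochner_imp_vM_primitive[OF f(2)] .
    have "{\<phi> {0..1}} \<subseteq> \<Phi> {0..1}"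
      by (rule vM_primitive_mono[OF \<phi>(1) \<Phi>]) (use f(1) cwk_value in \<open>auto simp: selection_of_def\<close>)
    then show "x \<in> \<Phi> {0..1}" using \<phi>(2) by simp
  qed
  moreover have "\<Phi> {0..1} \<subseteq> Aumann_integral \<Gamma>"
    using primitive_subset_Aumann_integral by (auto simp: Aumann_integral_def)
  ultimately have "Aumann_integral \<Gamma> = vM_integral \<Gamma>"
    using vM_integral_eq[OF \<Phi> cwk_value] by simp
  then show ?thesis
    using Aumann vM strongly_measurable_selection_Bochner_integrable scalarly_measurable_imp_strongly_measurable
    by blast
qed

end
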